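(* Let $d\in\mathbb{N}$ and let $\xi,\xi_1,\xi_2,\ldots$ be i.i.d. random variables in $\mathbb{R}^d$ with $\mathbb{E}\|\xi\|<\infty$ and $\mathbb{E}\xi=\mu$. Let $S_0:=0$, $S_n:=\sum_{i=1}^n\xi_i$, and $D_n:=\max_{0\le i,j\le n}\|S_i-S_j\|$. (a) $n^{-1}D_n\to\|\mu\|$ almost surely as $n\to\infty$. (b) If $\mu=0$, $\mathbb{E}[\|\xi\|^2]<\infty$ and $\Sigma:=\mathbb{E}[\xi\xi^{\top}]$, then $n^{-1/2}D_n\to\operatorname{diam}(\Sigma^{1/2}b_d[0,1])$ in distribution as $n\to\infty$.
   Context: $\|\cdot\|$ is the Euclidean norm. $b_d$ is standard $d$-dimensional Brownian motion started at $0$ with continuous paths; $\Sigma^{1/2}$ is the nonnegative-definite symmetric square root of $\Sigma$; $\Sigma^{1/2}b_d[0,1]:=\{\Sigma^{1/2}b_d(t):t\in[0,1]\}$; $\operatorname{diam}A:=\sup_{x,y\in A}\|x-y\|$. *)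

theory Defs
  imports "HOL-Probability.Probability"
begin

definition partial_sum :: "(nat \<Rightarrow> 'a \<Rightarrow> real ^ 'd) \<Rightarrow> nat \<Rightarrow> 'a \<Rightarrow> real ^ 'd" where
  "partial_sum \<xi> n \<omega> = (\<Sum>i = 1..n. \<xi> i \<omega>)"

definition walk_diameter :: "(nat \<Rightarrow> 'a \<Rightarrow> real ^ 'd) \<Rightarrow> nat \<Rightarrow> 'a \<Rightarrow> real" where
  "walk_diameter \<xi> n \<omega> =
     Max {norm (partial_sum \<xi> i \<omega> - partial_sum \<xi> j \<omega>) | i j. i \<le> n \<and> j \<le> n}"

text \<open>The matrix of second moments, i.e. the expectation of $X X^\top$.\<close>

definition second_moment_matrix :: "'a measure \<Rightarrow> ('a \<Rightarrow> real ^ 'd) \<Rightarrow> real ^ 'd ^ 'd" where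
  "second_moment_matrix M X = (\<chi> i j. \<integral>\<omega>. X \<omega> $ i * X \<omega> $ j \<partial>M)"

definition nonneg_definite :: "real ^ 'd ^ 'd \<Rightarrow> bool" where
  "nonneg_definite A \<longleftrightarrow> (\<forall>x. 0 \<le> x \<bullet> (A *v x))"

text \<open>The description is proper only for symmetric nonnegative-definite \<open>A\<close>, for which the
  square root exists and is unique.\<close>

definition matrix_sqrt :: "real ^ 'd ^ 'd \<Rightarrow> real ^ 'd ^ 'd" where
  "matrix_sqrt A = (THE R. transpose R = R \<and> nonneg_definite R \<and> R ** R = A)"

text \<open>The time parameter ranges over the nonnegative reals; values of \<open>b\<close> at negative times are
  irrelevant.  For \<open>s < t\<close> the increment has the centred Gaussian law with covariance
  matrix \<open>t - s\<close> times the identity, given by its density; note that the second argument of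
  \<open>normal_density\<close> is the standard deviation.\<close>

definition standard_brownian_motion :: "'b measure \<Rightarrow> (real \<Rightarrow> 'b \<Rightarrow> real ^ 'd) \<Rightarrow> bool" where
  "standard_brownian_motion N b \<longleftrightarrow>
     prob_space N \<and>
     (\<forall>t\<ge>0. b t \<in> borel_measurable N) \<and>
     (\<forall>\<omega>\<in>space N. b 0 \<omega> = 0) \<and>
     (\<forall>\<omega>\<in>space N. continuous_on {0..} (\<lambda>t. b t \<omega>)) \<and>
     (\<forall>(n::nat) \<tau>. 0 \<le> \<tau> 0 \<and> (\<forall>i<n. \<tau> i < \<tau> (Suc i)) \<longrightarrow>
        prob_space.indep_vars N (\<lambda>_. borel) (\<lambda>i \<omega>. b (\<tau> (Suc i)) \<omega> - b (\<tau> i) \<omega>) {..<n}) \<and>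
     (\<forall>s t. 0 \<le> s \<and> s < t \<longrightarrow>
        distributed N lborel (\<lambda>\<omega>. b t \<omega> - b s \<omega>)
          (\<lambda>x. ennreal (\<Prod>i\<in>UNIV. normal_density 0 (sqrt (t - s)) (x $ i))))"

end

(*
  (a) The strong law is obtained coordinatewise. By Garsia's maximal ergodic lemma, a random walk
  with steps of negative mean cannot have almost surely a positive partial sum, so by the
  Kolmogorov 0-1 law its partial sums are almost surely bounded above; apply this to the steps
  shifted by mu + epsilon, and to their negatives. Once S_n / n tends to mu, the limit of D_n / n
  is a deterministic fact.

  (b) Cut the time axis into m blocks. The characteristic function of the vector of the m block
  increments of S / sqrt n converges to that of the increments of Sigma^(1/2) b, and
  Stone-Weierstrass turns this into convergence of expectations of bounded continuous functionals,
  such as the diameter of the walk observed on the block grid. The oscillation within blocks is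
  controlled by Ottaviani's argument, applied to all blocks at once: its probability is at most
  twice that of some block increment being large, which in the limit n -> infinity is governed by
  the increments of the Brownian path over intervals of length 1/m, and these tend to 0 with 1/m
  by continuity. Hence no moments beyond the second are needed.
*)
theory Submission
  imports Defs
begin

section \<open>The strong law of large numbers\<close>

text \<open>Part (a) has only a first moment at its disposal; the maximal-lemma route needs neither
  truncation nor variances. In (b) no functional limit theorem is proved: the diameter of the walk
  lies between that of its grid skeleton and the same plus a multiple of the oscillation.

  The obstacle is the oscillation. With \<open>v\<close> the second moment of the step norm,
  Chebyshev bounds the chance that a given rescaled block increment exceeds \<open>l\<close> by
  about \<open>v / (m l^2)\<close>; the union bound over \<open>m\<close> blocks gives
  \<open>v / l^2\<close>, which does not improve with \<open>m\<close>. So Chebyshev is used only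
  where a bound of 1/2 is enough, for the rest of a block after a first passage, and smallness is
  read off from the limit process. A single first passage time for the whole walk, measured from the
  start of the block in which it falls, keeps the event that some block increment is large
  undivided; a sum over blocks would call for Gaussian tail estimates. This event is majorized by a
  continuous functional, so that the convergence theorem used for the grid diameter applies to it as
  well.\<close>

lemma (in prob_space) indep_vars_reindex:
  assumes "indep_vars M' X I" "inj_on f J" "f ` J \<subseteq> I"
  shows "indep_vars (\<lambda>j. M' (f j)) (\<lambda>j. X (f j)) J"
proof -
  \<comment> \<open>Regrouping along the singleton blocks \<open>{f j}\<close>, which are disjoint
    because \<open>f\<close> is injective.\<close>
  have "indep_vars (\<lambda>j. PiM {f j} M') (\<lambda>j \<omega>. restrict (\<lambda>i. X i \<omega>) {f j}) J"
    using assms by (intro indep_vars_restrict[OF assms(1)]) (auto simp: disjoint_family_on_def inj_on_def)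
  then have "indep_vars (\<lambda>j. M' (f j)) (\<lambda>j \<omega>. (\<lambda>g. g (f j)) (restrict (\<lambda>i. X i \<omega>) {f j})) J"
    by (rule indep_vars_compose2) auto
  then show ?thesis by simp
qed

text \<open>An independent sequence has the product of its marginals as joint law. For a sequence
  and its shift, this is the stationarity that Garsia's argument consumes.\<close>

lemma (in prob_space) distr_PiM_iid_cong:
  fixes X Y :: "nat \<Rightarrow> 'a \<Rightarrow> real"
  assumes X: "indep_vars (\<lambda>_. borel) X UNIV" and Y: "indep_vars (\<lambda>_. borel) Y UNIV"
    and eq: "\<And>i. distr M borel (X i) = distr M borel (Y i)"
  shows "distr M (PiM UNIV (\<lambda>_. borel)) (\<lambda>\<omega> i. X i \<omega>) = distr M (PiM UNIV (\<lambda>_. borel)) (\<lambda>\<omega> i. Y i \<omega>)"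
proof -
  have "random_variable borel (X i)" "random_variable borel (Y i)" for i
    using X Y by (auto simp: indep_vars_def2)
  with X Y have "distr M (PiM UNIV (\<lambda>_. borel)) (\<lambda>x. \<lambda>i\<in>UNIV. X i x) = PiM UNIV (\<lambda>i. distr M borel (X i))"
    "distr M (PiM UNIV (\<lambda>_. borel)) (\<lambda>x. \<lambda>i\<in>UNIV. Y i x) = PiM UNIV (\<lambda>i. distr M borel (Y i))"
    by (auto simp: indep_vars_iff_distr_eq_PiM[symmetric])
  then show ?thesis using eq by (simp add: restrict_UNIV)
qed

text \<open>The maximum of the first \<open>n + 1\<close> partial sums (including the empty one), in the recursive
  form that exhibits the shift of the sequence.\<close>

fun max_partial_sum :: "nat \<Rightarrow> (nat \<Rightarrow> real) \<Rightarrow> real" where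
  "max_partial_sum 0 x = 0"
| "max_partial_sum (Suc n) x = max 0 (x 0 + max_partial_sum n (\<lambda>i. x (Suc i)))"

lemma max_partial_sum_nonneg: "0 \<le> max_partial_sum n x"
  by (cases n) auto

lemma max_partial_sum_le_Suc: "max_partial_sum n x \<le> max_partial_sum (Suc n) x"
proof (induction n arbitrary: x)
  case (Suc n)
  from Suc[of "\<lambda>i. x (Suc i)"] show ?case by auto
qed simp

lemma max_partial_sum_mono: "m \<le> n \<Longrightarrow> max_partial_sum m x \<le> max_partial_sum n x"
  by (rule lift_Suc_mono_le[of "\<lambda>n. max_partial_sum n x", OF max_partial_sum_le_Suc])

lemma sum_le_max_partial_sum: "(\<Sum>i<n. x i) \<le> max_partial_sum n x"
proof (induction n arbitrary: x)
  case (Suc n)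
  have "(\<Sum>i<Suc n. x i) = x 0 + (\<Sum>i<n. x (Suc i))"
    by (rule sum.lessThan_Suc_shift)
  with Suc[of "\<lambda>i. x (Suc i)"] show ?case by auto
qed simp

lemma max_partial_sum_measurable [measurable]:
  "max_partial_sum n \<in> borel_measurable (PiM UNIV (\<lambda>_. borel))"
proof (induction n)
  case (Suc n)
  have "(\<lambda>x i. x (Suc i)) \<in> PiM UNIV (\<lambda>_. borel) \<rightarrow>\<^sub>M PiM UNIV (\<lambda>_. borel :: real measure)"
    by (rule measurable_PiM_single') auto
  from measurable_compose[OF this Suc]
  have "(\<lambda>x. max 0 (x 0 + max_partial_sum n (\<lambda>i. x (Suc i)))) \<in> borel_measurable (PiM UNIV (\<lambda>_. borel))"
    by (intro borel_measurable_max borel_measurable_add) auto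
  moreover have "max_partial_sum (Suc n) = (\<lambda>x. max 0 (x 0 + max_partial_sum n (\<lambda>i. x (Suc i))))"
    by (rule ext) simp
  ultimately show ?case by (simp only:)
qed simp

lemma (in prob_space) integrable_max_partial_sum:
  assumes "\<And>i. integrable M (\<lambda>\<omega>. X i \<omega>)"
  shows "integrable M (\<lambda>\<omega>. max_partial_sum n (\<lambda>i. X i \<omega>))"
  using assms
  by (induction n arbitrary: X) auto

text \<open>Garsia's argument: where the maximum of the partial sums is positive, it equals \<open>X 0\<close> plus
  the maximum for the shifted sequence, and the latter has the same expectation as the maximum for
  the original sequence with one term less.\<close>

lemma (in prob_space) expectation_nonneg_of_max_partial_sum:
  fixes X :: "nat \<Rightarrow> 'a \<Rightarrow> real"
  assumes X: "indep_vars (\<lambda>_. borel) X UNIV" and eq: "\<And>i. distr M borel (X i) = distr M borel (X 0)"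
    and int: "integrable M (X 0)"
  shows "0 \<le> (\<integral>\<omega>. indicator {\<omega>\<in>space M. 0 < max_partial_sum n (\<lambda>i. X i \<omega>)} \<omega> * X 0 \<omega> \<partial>M)"
proof (cases n)
  case (Suc m)
  have rv[measurable]: "random_variable borel (X i)" for i using X by (auto simp: indep_vars_def2)
  have rvP[measurable]: "(\<lambda>\<omega> i. Z i \<omega>) \<in> M \<rightarrow>\<^sub>M PiM UNIV (\<lambda>_. borel)"
    if "\<And>i. random_variable borel (Z i)" for Z :: "nat \<Rightarrow> 'a \<Rightarrow> real"
    using that by (intro measurable_PiM_single') auto
  have intX: "integrable M (X i)" for i
  proof -
    have "integrable (distr M borel (X i)) (\<lambda>x. x)"
      unfolding eq[of i] using int by (subst integrable_distr_eq) auto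
    then show ?thesis by (subst (asm) integrable_distr_eq) auto
  qed
  let ?A = "{\<omega>\<in>space M. 0 < max_partial_sum (Suc m) (\<lambda>i. X i \<omega>)}"
  let ?S = "\<lambda>n \<omega>. max_partial_sum n (\<lambda>i. X i \<omega>)" and ?T = "\<lambda>n \<omega>. max_partial_sum n (\<lambda>i. X (Suc i) \<omega>)"
  have meas[measurable]: "?S n \<in> borel_measurable M" for n
    by (rule measurable_compose[OF rvP max_partial_sum_measurable]) simp
  have [measurable]: "?A \<in> sets M"
    using meas[of "Suc m"] by measurable
  have X': "indep_vars (\<lambda>_. borel) (\<lambda>i. X (Suc i)) UNIV"
    by (rule indep_vars_reindex[OF X]) auto
  have "(\<integral>\<omega>. ?T m \<omega> \<partial>M) = (\<integral>x. max_partial_sum m x \<partial>distr M (PiM UNIV (\<lambda>_. borel)) (\<lambda>\<omega> i. X (Suc i) \<omega>))"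
    by (rule integral_distr[symmetric, OF rvP]) auto
  also have "distr M (PiM UNIV (\<lambda>_. borel)) (\<lambda>\<omega> i. X (Suc i) \<omega>) = distr M (PiM UNIV (\<lambda>_. borel)) (\<lambda>\<omega> i. X i \<omega>)"
    by (rule distr_PiM_iid_cong[OF X' X]) (metis eq)
  also have "(\<integral>x. max_partial_sum m x \<partial>\<dots>) = (\<integral>\<omega>. ?S m \<omega> \<partial>M)"
    by (rule integral_distr[OF rvP]) auto
  finally have shift: "(\<integral>\<omega>. ?T m \<omega> \<partial>M) = (\<integral>\<omega>. ?S m \<omega> \<partial>M)" .
  have intS: "integrable M (?S n)" "integrable M (?T n)" for n
    using integrable_max_partial_sum[of X] integrable_max_partial_sum[of "\<lambda>i. X (Suc i)"] intX by auto
  have "0 \<le> (\<integral>\<omega>. ?S (Suc m) \<omega> - ?S m \<omega> \<partial>M)"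
    by (rule integral_nonneg_AE) (use max_partial_sum_le_Suc in \<open>auto simp del: max_partial_sum.simps\<close>)
  also have "\<dots> = (\<integral>\<omega>. ?S (Suc m) \<omega> - ?T m \<omega> \<partial>M)"
    using intS shift by (simp del: max_partial_sum.simps)
  also have "\<dots> \<le> (\<integral>\<omega>. indicator ?A \<omega> * X 0 \<omega> \<partial>M)"
  proof (rule integral_mono)
    show "integrable M (\<lambda>\<omega>. ?S (Suc m) \<omega> - ?T m \<omega>)"
      by (intro Bochner_Integration.integrable_diff intS)
    show "integrable M (\<lambda>\<omega>. indicator ?A \<omega> * X 0 \<omega>)"
      by (intro integrable_real_mult_indicator[where f="X 0", simplified mult.commute] int) auto
    \<comment> \<open>On \<open>?A\<close> the recursion gives
      \<open>?S (Suc m) = X 0 + ?T m\<close>, so equality holds; off \<open>?A\<close> the left side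
      is \<open>0 - ?T m\<close>, which is at most 0.\<close>
    show "?S (Suc m) \<omega> - ?T m \<omega> \<le> indicator ?A \<omega> * X 0 \<omega>" if "\<omega> \<in> space M" for \<omega>
      using that max_partial_sum_nonneg[of m "\<lambda>i. X (Suc i) \<omega>"]
      by (auto simp: indicator_def max_def split: if_splits)
  qed
  finally show ?thesis using Suc by simp
qed simp

text \<open>The events that one of the first \<open>n\<close> partial sums is positive grow to an
  almost sure event; dominated convergence with majorant \<open>\<bar>X 0\<bar>\<close> removes the
  indicator from Garsia's inequality.\<close>

lemma (in prob_space) expectation_nonneg_of_positive_partial_sum:
  fixes X :: "nat \<Rightarrow> 'a \<Rightarrow> real"
  assumes X: "indep_vars (\<lambda>_. borel) X UNIV" and eq: "\<And>i. distr M borel (X i) = distr M borel (X 0)"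
    and int: "integrable M (X 0)" and pos: "AE \<omega> in M. \<exists>n. 0 < (\<Sum>i<n. X i \<omega>)"
  shows "0 \<le> expectation (X 0)"
proof -
  have rv[measurable]: "random_variable borel (X i)" for i using X by (auto simp: indep_vars_def2)
  have rvP[measurable]: "(\<lambda>\<omega> i. X i \<omega>) \<in> M \<rightarrow>\<^sub>M PiM UNIV (\<lambda>_. borel)"
    by (intro measurable_PiM_single') auto
  let ?S = "\<lambda>n \<omega>. max_partial_sum n (\<lambda>i. X i \<omega>)"
  have meas[measurable]: "?S n \<in> borel_measurable M" for n
    by (rule measurable_compose[OF rvP max_partial_sum_measurable])
  let ?A = "\<lambda>n. {\<omega>\<in>space M. 0 < ?S n \<omega>}"
  have "(\<lambda>n. \<integral>\<omega>. indicator (?A n) \<omega> * X 0 \<omega> \<partial>M) \<longlonglongrightarrow> expectation (X 0)"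
  proof (rule integral_dominated_convergence[where w="\<lambda>\<omega>. \<bar>X 0 \<omega>\<bar>"])
    show "integrable M (\<lambda>\<omega>. \<bar>X 0 \<omega>\<bar>)" using int by simp
    show "AE \<omega> in M. (\<lambda>n. indicator (?A n) \<omega> * X 0 \<omega>) \<longlonglongrightarrow> X 0 \<omega>"
      using pos AE_space
    proof eventually_elim
      case (elim \<omega>)
      then obtain n where "0 < (\<Sum>i<n. X i \<omega>)" by auto
      then have "0 < ?S m \<omega>" if "m \<ge> n" for m
        using sum_le_max_partial_sum[of "\<lambda>i. X i \<omega>" n] max_partial_sum_mono[OF that, of "\<lambda>i. X i \<omega>"]
        by linarith
      then have "\<forall>\<^sub>F m in sequentially. indicator (?A m) \<omega> * X 0 \<omega> = X 0 \<omega>"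
        using elim by (auto simp: eventually_sequentially intro!: exI[of _ n])
      then show ?case by (rule tendsto_eventually)
    qed
  qed (auto simp: indicator_def)
  then show ?thesis
    by (rule LIMSEQ_le_const) (use expectation_nonneg_of_max_partial_sum[OF X eq int] in auto)
qed

text \<open>Unboundedness above is a tail event: dropping the first \<open>j\<close> terms changes
  all later partial sums by the same amount.\<close>

lemma (in prob_space) partial_sums_bounded_above_0_1:
  fixes X :: "nat \<Rightarrow> 'a \<Rightarrow> real"
  assumes X: "indep_vars (\<lambda>_. borel) X UNIV"
  shows "(AE \<omega> in M. \<exists>B. \<forall>n. (\<Sum>i<n. X i \<omega>) \<le> B) \<or> (AE \<omega> in M. \<forall>B. \<exists>n. B < (\<Sum>i<n. X i \<omega>))"
proof -
  have rv[measurable]: "random_variable borel (X i)" for i using X by (auto simp: indep_vars_def2)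
  let ?A = "\<lambda>i. sigma_sets (space M) {X i -` B \<inter> space M | B. B \<in> sets borel}"
  have indep: "indep_sets ?A UNIV" using X by (auto simp: indep_vars_def)
  \<comment> \<open>Natural thresholds keep the event a countable intersection of countable unions,
    hence measurable.\<close>
  let ?U = "{\<omega>\<in>space M. \<forall>B::nat. \<exists>n. real B < (\<Sum>i<n. X i \<omega>)}"
  have U[measurable]: "?U \<in> sets M" by measurable
  have U_iff: "\<omega> \<in> ?U \<longleftrightarrow> \<omega> \<in> space M \<and> (\<forall>B. \<exists>n. B < (\<Sum>i<n. X i \<omega>))" for \<omega>
    by (auto, meson less_trans reals_Archimedean2)
  have "?U \<in> tail_events ?A"
    unfolding tail_events_def
  proof safe
    fix j
    define F where "F = sigma (space M) (\<Union> (?A ` {j..}))"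
    have sub: "\<Union> (?A ` {j..}) \<subseteq> Pow (space M)"
      using sigma_sets_into_sp[of "{X i -` B \<inter> space M | B. B \<in> sets borel}" "space M" for i] by blast
    have space: "space F = space M" unfolding F_def by (rule space_measure_of[OF sub])
    have sets: "sets F = sigma_sets (space M) (\<Union> (?A ` {j..}))" unfolding F_def by (rule sets_measure_of[OF sub])
    have F[measurable]: "X i \<in> borel_measurable F" if "j \<le> i" for i
    proof (rule measurableI)
      fix B :: "real set" assume "B \<in> sets borel"
      then have "X i -` B \<inter> space M \<in> ?A i" by auto
      with that show "X i -` B \<inter> space F \<in> sets F"
        unfolding space sets by (intro sigma_sets.Basic) auto
    qed auto
    have [measurable]: "(\<lambda>\<omega>. \<Sum>i\<in>{j..<n}. X i \<omega>) \<in> borel_measurable F" for n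
      by (intro borel_measurable_sum F) auto
    \<comment> \<open>Membership in the sigma-algebra of the variables from \<open>j\<close> on is
      visible only after the first \<open>j\<close> terms have been removed.\<close>
    have "?U = {\<omega>\<in>space F. \<forall>B::nat. \<exists>n. real B < (\<Sum>i\<in>{j..<n}. X i \<omega>)}" (is "_ = ?V")
    proof (intro set_eqI)
      fix \<omega>
      have V_iff: "\<omega> \<in> ?V \<longleftrightarrow> \<omega> \<in> space M \<and> (\<forall>B. \<exists>n. B < (\<Sum>i\<in>{j..<n}. X i \<omega>))"
        unfolding space by (auto, meson less_trans reals_Archimedean2)
      have split: "(\<Sum>i<n. X i \<omega>) = (\<Sum>i<j. X i \<omega>) + (\<Sum>i\<in>{j..<n}. X i \<omega>)" if "j \<le> n" for n
        using that by (metis atLeast0LessThan le0 sum.atLeastLessThan_concat)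
      have "(\<forall>B. \<exists>n. B < (\<Sum>i<n. X i \<omega>)) \<longleftrightarrow> (\<forall>B. \<exists>n. B < (\<Sum>i\<in>{j..<n}. X i \<omega>))"
      proof safe
        fix B assume "\<forall>B. \<exists>n. B < (\<Sum>i<n. X i \<omega>)"
        \<comment> \<open>\<open>C\<close> bounds every partial sum up to index \<open>j\<close>. A
          sum above \<open>\<bar>B\<bar> + C\<close> therefore has \<open>n > j\<close>, and
          removing its first \<open>j\<close> terms, worth at most \<open>C\<close>, leaves more
          than \<open>B\<close>.\<close>
        define C where "C = (\<Sum>i<j. \<bar>X i \<omega>\<bar>)"
        from \<open>\<forall>B. \<exists>n. B < (\<Sum>i<n. X i \<omega>)\<close> obtain n where n: "\<bar>B\<bar> + C < (\<Sum>i<n. X i \<omega>)" by blast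
        have C: "(\<Sum>i<n. X i \<omega>) \<le> C" if "n \<le> j" for n
        proof -
          have "(\<Sum>i<n. X i \<omega>) \<le> (\<Sum>i<n. \<bar>X i \<omega>\<bar>)" by (intro sum_mono) auto
          also have "\<dots> \<le> C" unfolding C_def using that by (intro sum_mono2) auto
          finally show ?thesis .
        qed
        have "j < n" using C[of n] n by (cases "n \<le> j") auto
        then show "\<exists>n. B < (\<Sum>i\<in>{j..<n}. X i \<omega>)"
          using split[of n] n C[of j] by (intro exI[of _ n]) auto
      next
        fix B assume *: "\<forall>B. \<exists>n. B < (\<Sum>i\<in>{j..<n}. X i \<omega>)"
        obtain n where n: "\<bar>B\<bar> + \<bar>\<Sum>i<j. X i \<omega>\<bar> < (\<Sum>i\<in>{j..<n}. X i \<omega>)" using * by blast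
        then have "j < n" by (cases "n \<le> j") auto
        then show "\<exists>n. B < (\<Sum>i<n. X i \<omega>)"
          using split[of n] n by (intro exI[of _ n]) auto
      qed
      then show "\<omega> \<in> ?U \<longleftrightarrow> \<omega> \<in> ?V" unfolding U_iff V_iff by simp
    qed
    also have "?V \<in> sets F" by measurable
    finally show "?U \<in> sigma_sets (space M) (\<Union> (?A ` {j..}))" unfolding sets .
  qed
  then have "prob ?U = 0 \<or> prob ?U = 1"
    by (intro kolmogorov_0_1_law[OF _ indep]) (auto intro: sigma_algebra_sigma_sets)
  then show ?thesis
  proof
    assume "prob ?U = 0"
    then have "AE \<omega> in M. \<omega> \<notin> ?U" using U by (subst (asm) prob_eq_0) auto
    then show ?thesis unfolding U_iff
      by (intro disjI1) (elim AE_mp, intro AE_I2, auto simp: not_less)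
  next
    assume "prob ?U = 1"
    then have "AE \<omega> in M. \<omega> \<in> ?U" using U by (subst (asm) prob_eq_1) auto
    then show ?thesis unfolding U_iff by (intro disjI2) auto
  qed
qed

lemma (in prob_space) partial_sums_bounded_above:
  fixes X :: "nat \<Rightarrow> 'a \<Rightarrow> real"
  assumes X: "indep_vars (\<lambda>_. borel) X UNIV" and eq: "\<And>i. distr M borel (X i) = distr M borel (X 0)"
    and int: "integrable M (X 0)" and neg: "expectation (X 0) < 0"
  shows "AE \<omega> in M. \<exists>B. \<forall>n. (\<Sum>i<n. X i \<omega>) \<le> B"
proof (rule ccontr)
  assume "\<not> ?thesis"
  with partial_sums_bounded_above_0_1[OF X] have "AE \<omega> in M. \<forall>B. \<exists>n. B < (\<Sum>i<n. X i \<omega>)" by blast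
  then have "AE \<omega> in M. \<exists>n. 0 < (\<Sum>i<n. X i \<omega>)" by auto
  from expectation_nonneg_of_positive_partial_sum[OF X eq int this] neg show False by simp
qed

lemma (in prob_space) averages_eventually_less:
  fixes X :: "nat \<Rightarrow> 'a \<Rightarrow> real"
  assumes X: "indep_vars (\<lambda>_. borel) X UNIV" and eq: "\<And>i. distr M borel (X i) = distr M borel (X 0)"
    and int: "integrable M (X 0)"
  shows "AE \<omega> in M. \<forall>e>0. \<forall>\<^sub>F n in sequentially. (\<Sum>i<n. X i \<omega>) / real n < expectation (X 0) + e"
proof -
  have rv[measurable]: "random_variable borel (X i)" for i using X by (auto simp: indep_vars_def2)
  define m where "m = expectation (X 0)"
  \<comment> \<open>Shifts by \<open>inverse (Suc k)\<close> suffice and are countably many, so one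
    null set serves all \<open>e\<close>.\<close>
  have "AE \<omega> in M. \<exists>B. \<forall>n. (\<Sum>i<n. X i \<omega> - (m + inverse (Suc k))) \<le> B" for k :: nat
  proof (rule partial_sums_bounded_above)
    show "indep_vars (\<lambda>_. borel) (\<lambda>i \<omega>. X i \<omega> - (m + inverse (Suc k))) UNIV"
      by (rule indep_vars_compose2[OF X]) auto
    show "distr M borel (\<lambda>\<omega>. X i \<omega> - (m + inverse (Suc k))) = distr M borel (\<lambda>\<omega>. X 0 \<omega> - (m + inverse (Suc k)))" for i
    proof -
      have *: "distr M borel (\<lambda>\<omega>. X i \<omega> - (m + inverse (Suc k))) = distr (distr M borel (X i)) borel (\<lambda>x. x - (m + inverse (Suc k)))" for i
        by (subst distr_distr) (auto simp: comp_def)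
      show ?thesis unfolding * eq[of i] ..
    qed
    show "integrable M (\<lambda>\<omega>. X 0 \<omega> - (m + inverse (Suc k)))" using int by auto
    show "expectation (\<lambda>\<omega>. X 0 \<omega> - (m + inverse (Suc k))) < 0"
      using int by (simp add: m_def prob_space)
  qed
  then have "AE \<omega> in M. \<forall>k. \<exists>B. \<forall>n. (\<Sum>i<n. X i \<omega> - (m + inverse (Suc k))) \<le> B"
    by (simp add: AE_all_countable)
  then show ?thesis
  proof eventually_elim
    case (elim \<omega>)
    show ?case
    proof safe
      fix e :: real assume e: "0 < e"
      \<comment> \<open>Half of \<open>e\<close> absorbs the shift, the other half absorbs
        \<open>B / n\<close> once \<open>n > 2 B / e\<close>.\<close>
      then obtain k where k: "inverse (Suc k) < e / 2" using reals_Archimedean[of "e/2"] by auto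
      from elim obtain B where B: "\<And>n. (\<Sum>i<n. X i \<omega> - (m + inverse (Suc k))) \<le> B" by blast
      have "\<forall>\<^sub>F n in sequentially. B / (e / 2) < real n"
        using filterlim_real_sequentially by (rule filterlim_at_top_dense[THEN iffD1, rule_format])
      then show "\<forall>\<^sub>F n in sequentially. (\<Sum>i<n. X i \<omega>) / real n < expectation (X 0) + e"
        using eventually_gt_at_top[of 0]
      proof eventually_elim
        case (elim n)
        have "(\<Sum>i<n. X i \<omega>) \<le> B + real n * (m + inverse (Suc k))" using B[of n] by (simp add: sum_subtractf)
        also have "B < real n * (e / 2)" using elim e by (simp add: field_simps)
        also have "real n * (m + inverse (Suc k)) \<le> real n * (m + e / 2)"
          using k by (intro mult_left_mono) auto
        finally have "(\<Sum>i<n. X i \<omega>) < real n * (m + e)" by (simp add: algebra_simps)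
        then show ?case using elim by (simp add: m_def field_simps)
      qed
    qed
  qed
qed

theorem (in prob_space) strong_law_of_large_numbers:
  fixes X :: "nat \<Rightarrow> 'a \<Rightarrow> real"
  assumes X: "indep_vars (\<lambda>_. borel) X UNIV" and eq: "\<And>i. distr M borel (X i) = distr M borel (X 0)"
    and int: "integrable M (X 0)"
  shows "AE \<omega> in M. (\<lambda>n. (\<Sum>i<n. X i \<omega>) / real n) \<longlonglongrightarrow> expectation (X 0)"
proof -
  have rv[measurable]: "random_variable borel (X i)" for i using X by (auto simp: indep_vars_def2)
  have "AE \<omega> in M. \<forall>e>0. \<forall>\<^sub>F n in sequentially. (\<Sum>i<n. - X i \<omega>) / real n < expectation (\<lambda>\<omega>. - X 0 \<omega>) + e"
  proof (rule averages_eventually_less)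
    show "indep_vars (\<lambda>_. borel) (\<lambda>i \<omega>. - X i \<omega>) UNIV"
      by (rule indep_vars_compose2[OF X]) auto
    have *: "distr M borel (\<lambda>\<omega>. - X i \<omega>) = distr (distr M borel (X i)) borel uminus" for i
      by (subst distr_distr) (auto simp: comp_def)
    show "distr M borel (\<lambda>\<omega>. - X i \<omega>) = distr M borel (\<lambda>\<omega>. - X 0 \<omega>)" for i
      unfolding * eq[of i] ..
  qed (use int in auto)
  with averages_eventually_less[OF X eq int] show ?thesis
  proof eventually_elim
    case (elim \<omega>)
    show ?case
    proof (rule order_tendstoI)
      fix a assume "a < expectation (X 0)"
      then have "\<forall>\<^sub>F n in sequentially. (\<Sum>i<n. - X i \<omega>) / real n < expectation (\<lambda>\<omega>. - X 0 \<omega>) + (expectation (X 0) - a)"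
        using elim(2)[rule_format, of "expectation (X 0) - a"] by simp
      then show "\<forall>\<^sub>F n in sequentially. a < (\<Sum>i<n. X i \<omega>) / real n"
        by eventually_elim (simp add: sum_negf)
    next
      fix a assume "expectation (X 0) < a"
      then show "\<forall>\<^sub>F n in sequentially. (\<Sum>i<n. X i \<omega>) / real n < a"
        using elim(1)[rule_format, of "a - expectation (X 0)"] by simp
    qed
  qed
qed

section \<open>The rescaled diameter along a fixed path\<close>

lemma walk_diameter_finite:
  "finite {norm (partial_sum \<xi> i \<omega> - partial_sum \<xi> j \<omega>) | i j. i \<le> n \<and> j \<le> n}"
proof -
  have "{norm (partial_sum \<xi> i \<omega> - partial_sum \<xi> j \<omega>) | i j. i \<le> n \<and> j \<le> n} =
      (\<lambda>(i, j). norm (partial_sum \<xi> i \<omega> - partial_sum \<xi> j \<omega>)) ` ({..n} \<times> {..n})"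
    by auto
  then show ?thesis by simp
qed

lemma walk_diameter_ge:
  "i \<le> n \<Longrightarrow> j \<le> n \<Longrightarrow> norm (partial_sum \<xi> i \<omega> - partial_sum \<xi> j \<omega>) \<le> walk_diameter \<xi> n \<omega>"
  unfolding walk_diameter_def by (intro Max_ge walk_diameter_finite) auto

lemma walk_diameter_le:
  assumes "\<And>i j. i \<le> n \<Longrightarrow> j \<le> n \<Longrightarrow> norm (partial_sum \<xi> i \<omega> - partial_sum \<xi> j \<omega>) \<le> B"
  shows "walk_diameter \<xi> n \<omega> \<le> B"
  unfolding walk_diameter_def using assms by (intro Max.boundedI walk_diameter_finite) auto

text \<open>The pair \<open>(n, 0)\<close> alone gives the lower bound. For the upper bound,
  convergence of the averages keeps position \<open>i\<close> within \<open>e n + C\<close> of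
  \<open>i \<mu>\<close> for all \<open>i \<le> n\<close> at once, where \<open>C\<close> pays for
  the finitely many indices at which the average is still off.\<close>

lemma walk_diameter_tendsto:
  fixes \<xi> :: "nat \<Rightarrow> 'a \<Rightarrow> real ^ 'd"
  assumes lim: "(\<lambda>n. partial_sum \<xi> n \<omega> /\<^sub>R real n) \<longlonglongrightarrow> \<mu>"
  shows "(\<lambda>n. walk_diameter \<xi> n \<omega> / real n) \<longlonglongrightarrow> norm \<mu>"
proof (rule order_tendstoI)
  fix a assume "a < norm \<mu>"
  with tendsto_norm[OF lim] have "\<forall>\<^sub>F n in sequentially. a < norm (partial_sum \<xi> n \<omega> /\<^sub>R real n)"
    by (rule order_tendstoD)
  then show "\<forall>\<^sub>F n in sequentially. a < walk_diameter \<xi> n \<omega> / real n"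
  proof eventually_elim
    case (elim n)
    have "norm (partial_sum \<xi> n \<omega>) \<le> walk_diameter \<xi> n \<omega>"
      using walk_diameter_ge[of n n 0 \<xi> \<omega>] by (simp add: partial_sum_def)
    then have "norm (partial_sum \<xi> n \<omega> /\<^sub>R real n) \<le> walk_diameter \<xi> n \<omega> / real n"
      by (simp add: divide_inverse mult.commute mult_left_mono)
    with elim show ?case by simp
  qed
next
  fix a assume a: "norm \<mu> < a"
  define s where "s i = partial_sum \<xi> i \<omega>" for i
  \<comment> \<open>The two deviations cost \<open>2 e n\<close>; the remaining \<open>2 C\<close>
    falls below another \<open>2 e n\<close> when \<open>n > C / e\<close>.\<close>
  define e where "e = (a - norm \<mu>) / 4"
  have e: "0 < e" using a by (simp add: e_def)
  from LIMSEQ_D[OF lim e] obtain n0 where n0: "\<And>i. i \<ge> n0 \<Longrightarrow> norm (s i /\<^sub>R real i - \<mu>) < e"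
    by (auto simp: s_def)
  define C where "C = (\<Sum>i\<le>n0. norm (s i - real i *\<^sub>R \<mu>))"
  have C: "norm (s i - real i *\<^sub>R \<mu>) \<le> e * real n + C" if "i \<le> n" for i n
  proof (cases "i \<le> n0")
    case True
    then have "norm (s i - real i *\<^sub>R \<mu>) \<le> C"
      unfolding C_def by (intro member_le_sum[where f="\<lambda>i. norm (s i - real i *\<^sub>R \<mu>)"]) auto
    moreover have "0 \<le> e * real n" using e by simp
    ultimately show ?thesis by linarith
  next
    case False
    then have i: "0 < i" "n0 \<le> i" by auto
    have "s i - real i *\<^sub>R \<mu> = real i *\<^sub>R (s i /\<^sub>R real i - \<mu>)"
      using i by (simp add: algebra_simps)
    then have "norm (s i - real i *\<^sub>R \<mu>) = real i * norm (s i /\<^sub>R real i - \<mu>)"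
      by simp
    also have "\<dots> \<le> real n * e"
      using n0[OF i(2)] that by (intro mult_mono) auto
    moreover have "0 \<le> C" by (simp add: C_def sum_nonneg)
    ultimately show ?thesis by (simp add: mult.commute)
  qed
  have D: "walk_diameter \<xi> n \<omega> \<le> real n * norm \<mu> + 2 * (e * real n + C)" for n
  proof (rule walk_diameter_le)
    fix i j assume ij: "i \<le> n" "j \<le> n"
    have "s i - s j = (s i - real i *\<^sub>R \<mu>) + ((real i - real j) *\<^sub>R \<mu> - (s j - real j *\<^sub>R \<mu>))"
      by (simp add: algebra_simps)
    moreover have "norm (x + (y - z)) \<le> norm x + (norm y + norm z)" for x y z :: "real ^ 'd"
      by (rule order_trans[OF norm_triangle_ineq]) (intro add_left_mono norm_triangle_ineq4)
    ultimately have "norm (s i - s j) \<le> norm (s i - real i *\<^sub>R \<mu>) + (norm ((real i - real j) *\<^sub>R \<mu>) + norm (s j - real j *\<^sub>R \<mu>))"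
      by (simp only:)
    also have "norm ((real i - real j) *\<^sub>R \<mu>) \<le> real n * norm \<mu>"
      using ij by (auto intro!: mult_right_mono)
    finally show "norm (partial_sum \<xi> i \<omega> - partial_sum \<xi> j \<omega>) \<le> real n * norm \<mu> + 2 * (e * real n + C)"
      using C[OF ij(1)] C[OF ij(2)] by (simp add: s_def)
  qed
  have "\<forall>\<^sub>F n in sequentially. C / e < real n"
    using filterlim_real_sequentially by (rule filterlim_at_top_dense[THEN iffD1, rule_format])
  then show "\<forall>\<^sub>F n in sequentially. walk_diameter \<xi> n \<omega> / real n < a"
    using eventually_gt_at_top[of 0]
  proof eventually_elim
    case (elim n)
    have "walk_diameter \<xi> n \<omega> \<le> real n * norm \<mu> + 2 * (e * real n + C)" by (rule D)
    also have "\<dots> < real n * norm \<mu> + 4 * e * real n"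
      using elim e by (simp add: field_simps)
    also have "\<dots> = (norm \<mu> + 4 * e) * real n" by (simp add: algebra_simps)
    also have "norm \<mu> + 4 * e = a" by (simp add: e_def field_simps)
    finally show ?case using elim by (simp add: field_simps)
  qed
qed

text \<open>Convergence is checked coordinate by coordinate, discarding finitely many null sets. The
  variable \<open>X\<close> only represents the common law, so integrability and mean reach the
  steps through their distributions.\<close>

lemma (in prob_space) partial_sum_average_tendsto:
  fixes \<xi> :: "nat \<Rightarrow> 'a \<Rightarrow> real ^ 'd"
  assumes indep: "indep_vars (\<lambda>_. borel) \<xi> {1..}"
    and eq: "\<And>i. i \<ge> 1 \<Longrightarrow> distr M borel (\<xi> i) = distr M borel X"
    and int: "integrable M X"
  shows "AE \<omega> in M. (\<lambda>n. partial_sum \<xi> n \<omega> /\<^sub>R real n) \<longlonglongrightarrow> expectation X"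
proof -
  have rvX: "random_variable borel X" using int by auto
  have rv[measurable]: "random_variable borel (\<xi> i)" if "i \<ge> 1" for i
    using indep that by (auto simp: indep_vars_def2)
  have rvS: "random_variable borel (\<xi> (Suc i))" for i by (rule rv) simp
  have nth: "(\<lambda>x :: real ^ 'd. x $ k) \<in> borel_measurable borel" for k
    by (intro borel_measurable_continuous_onI continuous_intros)
  note [measurable] = rvS rvX measurable_compose[OF rvS nth] measurable_compose[OF rvX nth]
  have "AE \<omega> in M. (\<lambda>n. (\<Sum>i<n. \<xi> (Suc i) \<omega> $ k) / real n) \<longlonglongrightarrow> expectation X $ k" for k
  proof -
    have d: "distr M borel (\<lambda>\<omega>. \<xi> (Suc i) \<omega> $ k) = distr M borel (\<lambda>\<omega>. X \<omega> $ k)" for i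
    proof -
      have "distr M borel (\<lambda>\<omega>. \<xi> (Suc i) \<omega> $ k) = distr (distr M borel (\<xi> (Suc i))) borel (\<lambda>x. x $ k)"
        by (subst distr_distr) (auto simp: comp_def)
      also have "\<dots> = distr M borel (\<lambda>\<omega>. X \<omega> $ k)"
        unfolding eq[of "Suc i", simplified] by (subst distr_distr) (auto simp: comp_def)
      finally show ?thesis .
    qed
    have iX: "integrable M (\<lambda>\<omega>. X \<omega> $ k)"
      using int by (rule integrable_bounded_linear[OF bounded_linear_vec_nth])
    have "integrable (distr M borel (\<lambda>\<omega>. \<xi> (Suc 0) \<omega> $ k)) (\<lambda>x. x)"
      unfolding d using iX by (subst integrable_distr_eq) auto
    then have i0: "integrable M (\<lambda>\<omega>. \<xi> (Suc 0) \<omega> $ k)" by (subst (asm) integrable_distr_eq) auto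
    have "indep_vars (\<lambda>_. borel) (\<lambda>i. \<xi> (Suc i)) UNIV"
      by (rule indep_vars_reindex[OF indep]) auto
    then have "indep_vars (\<lambda>_. borel) (\<lambda>i \<omega>. \<xi> (Suc i) \<omega> $ k) UNIV"
      by (rule indep_vars_compose2) auto
    from strong_law_of_large_numbers[OF this]
    have "AE \<omega> in M. (\<lambda>n. (\<Sum>i<n. \<xi> (Suc i) \<omega> $ k) / real n) \<longlonglongrightarrow> expectation (\<lambda>\<omega>. \<xi> (Suc 0) \<omega> $ k)"
      using d i0 by simp
    also have "expectation (\<lambda>\<omega>. \<xi> (Suc 0) \<omega> $ k) = (\<integral>x. x \<partial>distr M borel (\<lambda>\<omega>. \<xi> (Suc 0) \<omega> $ k))"
      by (subst integral_distr) auto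
    also have "\<dots> = expectation (\<lambda>\<omega>. X \<omega> $ k)"
      unfolding d by (subst integral_distr) auto
    also have "\<dots> = expectation X $ k"
      by (rule integral_bounded_linear[OF bounded_linear_vec_nth int])
    finally show ?thesis .
  qed
  then have "AE \<omega> in M. \<forall>k. (\<lambda>n. (\<Sum>i<n. \<xi> (Suc i) \<omega> $ k) / real n) \<longlonglongrightarrow> expectation X $ k"
    by (intro AE_finite_allI[of UNIV, simplified]) auto
  then show ?thesis
  proof eventually_elim
    case (elim \<omega>)
    have "partial_sum \<xi> n \<omega> = (\<Sum>i<n. \<xi> (Suc i) \<omega>)" for n
      unfolding partial_sum_def by (simp add: sum.atLeast1_atMost_eq)
    with elim show ?case
      by (intro vec_tendstoI) (simp add: divide_inverse mult.commute)
  qed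
qed

section \<open>Square roots of nonnegative-definite matrices\<close>

text \<open>A maximizer of the Rayleigh quotient over the unit sphere of \<open>S\<close> is an
  eigenvector, by first-order optimality in the directions of \<open>S\<close>.\<close>

lemma self_adjoint_max_eigenvector:
  fixes f :: "'a::euclidean_space \<Rightarrow> 'a"
  assumes f: "linear f" and sym: "\<And>x y. f x \<bullet> y = x \<bullet> f y"
    and S: "subspace S" "f ` S \<subseteq> S" "S \<noteq> {0}"
  obtains v c where "v \<in> S" "norm v = 1" "f v = c *\<^sub>R v"
proof -
  have contf: "continuous_on A f" for A
    using f by (simp add: linear_continuous_on linear_conv_bounded_linear)
  obtain u where u: "u \<in> S" "u \<noteq> 0" using S subspace_0 by blast
  have "u /\<^sub>R norm u \<in> S \<inter> sphere 0 1" using u S(1) by (simp add: subspace_scale)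
  moreover have "compact (S \<inter> sphere 0 1)"
    by (intro closed_Int_compact closed_subspace S compact_sphere)
  ultimately obtain v where v: "v \<in> S" "norm v = 1"
    and vmax: "\<And>x. x \<in> S \<Longrightarrow> norm x = 1 \<Longrightarrow> x \<bullet> f x \<le> v \<bullet> f v"
    using continuous_attains_sup[of "S \<inter> sphere 0 1" "\<lambda>x. x \<bullet> f x"] contf
    by (force intro!: continuous_intros)
  define c where "c = v \<bullet> f v"
  have q: "x \<bullet> f x \<le> c * (x \<bullet> x)" if "x \<in> S" for x
  proof (cases "x = 0")
    case False
    have "(x /\<^sub>R norm x) \<bullet> f (x /\<^sub>R norm x) \<le> c"
      unfolding c_def using that False S(1) by (intro vmax) (auto simp: subspace_scale)
    then have "(x \<bullet> f x) / (norm x)\<^sup>2 \<le> c"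
      using f by (simp add: linear_scale power2_eq_square divide_inverse mult.commute mult.left_commute)
    with False show ?thesis by (simp add: field_simps power2_norm_eq_inner)
  qed simp
  \<comment> \<open>Comparing \<open>v + t w\<close> with \<open>v\<close> gives
    \<open>0 \<le> 2 t p + t^2 r\<close> for all real \<open>t\<close>, which forces the linear
    coefficient to vanish.\<close>
  have orth: "(c *\<^sub>R v - f v) \<bullet> w = 0" if w: "w \<in> S" for w
  proof -
    define p r where "p = (c *\<^sub>R v - f v) \<bullet> w" and "r = c * (w \<bullet> w) - w \<bullet> f w"
    have r: "0 \<le> r" using q[OF w] by (simp add: r_def)
    have main: "0 \<le> 2 * t * p + t\<^sup>2 * r" for t
    proof -
      have "v + t *\<^sub>R w \<in> S" using v w S(1) by (simp add: subspace_add subspace_scale)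
      from q[OF this] have "(v + t *\<^sub>R w) \<bullet> f (v + t *\<^sub>R w) \<le> c * ((v + t *\<^sub>R w) \<bullet> (v + t *\<^sub>R w))" .
      moreover have "f (v + t *\<^sub>R w) = f v + t *\<^sub>R f w" using f by (simp add: linear_add linear_scale)
      moreover have "v \<bullet> v = 1" using v by (simp add: norm_eq_1)
      moreover have "v \<bullet> f w = f v \<bullet> w" using sym by simp
      ultimately show ?thesis
        by (simp add: p_def r_def inner_add_left inner_add_right inner_diff_left algebra_simps
            inner_commute[of w v] inner_commute[of w "f v"] power2_eq_square c_def)
    qed
    show "p = 0"
    proof (rule ccontr)
      assume p: "p \<noteq> 0"
      \<comment> \<open>At \<open>t = - u\<close> the quadratic equals \<open>- u^2 (r + 2)\<close>;
        dividing by \<open>r + 1\<close> instead of \<open>r\<close> covers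
        \<open>r = 0\<close>.\<close>
      define u where "u = p / (r + 1)"
      have pu: "p = u * (r + 1)" using r by (simp add: u_def)
      have "2 * (- u) * p + (- u)\<^sup>2 * r = - (u\<^sup>2 * (r + 2))"
        unfolding pu by (simp add: algebra_simps power2_eq_square)
      also have "\<dots> < 0" using p r by (simp add: pu)
      finally show False using main[of "- u"] by simp
    qed
  qed
  \<comment> \<open>The residual lies in \<open>S\<close>, so it is orthogonal to itself.\<close>
  have "c *\<^sub>R v - f v \<in> S" using v S by (auto simp: subspace_diff subspace_scale)
  from orth[OF this] have "f v = c *\<^sub>R v" by simp
  with v show ?thesis by (intro that)
qed

text \<open>Induction on the dimension, for which the statement has to range over invariant
  subspaces: by symmetry of \<open>f\<close>, the vectors of \<open>S\<close> orthogonal to an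
  eigenvector form an invariant subspace of smaller dimension.\<close>

theorem self_adjoint_orthonormal_eigenbasis:
  fixes f :: "'a::euclidean_space \<Rightarrow> 'a"
  assumes f: "linear f" and sym: "\<And>x y. f x \<bullet> y = x \<bullet> f y"
    and S: "subspace S" "f ` S \<subseteq> S"
  obtains B where "finite B" "pairwise orthogonal B" "\<And>v. v \<in> B \<Longrightarrow> norm v = 1"
    "\<And>v. v \<in> B \<Longrightarrow> \<exists>c. f v = c *\<^sub>R v" "span B = S"
  using S
proof (induction "dim S" arbitrary: S thesis rule: less_induct)
  case less
  show ?case
  proof (cases "S = {0}")
    case True
    then show ?thesis by (intro less.prems(1)[of "{}"]) auto
  next
    case False
    obtain v c where v: "v \<in> S" "norm v = 1" "f v = c *\<^sub>R v"
      by (rule self_adjoint_max_eigenvector[OF f sym less.prems(2,3) False])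
    have vv: "v \<bullet> v = 1" using v by (simp add: norm_eq_1)
    define T where "T = S \<inter> {x. v \<bullet> x = 0}"
    have T: "subspace T" unfolding T_def
      by (intro subspace_inter less.prems subspace_hyperplane)
    have fT: "f ` T \<subseteq> T"
    proof safe
      fix x assume "x \<in> T"
      then have "x \<in> S" "v \<bullet> x = 0" by (auto simp: T_def)
      then show "f x \<in> T"
        using less.prems(3) sym[of v x] v(3) by (auto simp: T_def)
    qed
    have "v \<notin> T" using vv by (simp add: T_def)
    moreover have "T \<subseteq> S" by (auto simp: T_def)
    ultimately have "T \<subset> S" using v by blast
    then have "dim T < dim S"
      using dim_psubset[of T S] T less.prems(2) by (simp add: span_eq_iff[THEN iffD2])
    from less.hyps[OF this _ T fT] obtain B where
      B: "finite B" "pairwise orthogonal B" "\<And>v. v \<in> B \<Longrightarrow> norm v = 1"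
        "\<And>v. v \<in> B \<Longrightarrow> \<exists>c. f v = c *\<^sub>R v" "span B = T"
      by metis
    have BT: "B \<subseteq> T" using B(5) span_superset by blast
    show ?thesis
    proof (rule less.prems(1)[of "insert v B"])
      show "pairwise orthogonal (insert v B)"
        using B(2) BT by (auto simp: pairwise_insert orthogonal_def T_def inner_commute)
      show "span (insert v B) = S"
      proof
        show "span (insert v B) \<subseteq> S"
          using v BT less.prems(2) by (intro span_minimal) (auto simp: T_def)
        show "S \<subseteq> span (insert v B)"
        proof
          fix x assume x: "x \<in> S"
          have "x - (v \<bullet> x) *\<^sub>R v \<in> span B"
            using x v vv less.prems(2) unfolding B(5) T_def
            by (auto simp: subspace_diff subspace_scale inner_diff_right)
          then show "x \<in> span (insert v B)" by (auto simp: span_insert)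
        qed
      qed
    qed (use B v in auto)
  qed
qed

lemma inner_matrix_vector_transpose: "(A *v x) \<bullet> y = x \<bullet> (transpose A *v y)" for A :: "real ^ 'n ^ 'm"
  by (metis dot_lmul_matrix inner_commute transpose_matrix_vector)

lemma symmetric_matrix_eigenbasis:
  fixes A :: "real ^ 'd ^ 'd"
  assumes "transpose A = A"
  obtains B where "finite B" "pairwise orthogonal B" "\<And>v. v \<in> B \<Longrightarrow> norm v = 1"
    "\<And>v. v \<in> B \<Longrightarrow> \<exists>c. A *v v = c *\<^sub>R v" "span B = UNIV"
proof (rule self_adjoint_orthonormal_eigenbasis[of "(*v) A" UNIV])
  show "(A *v x) \<bullet> y = x \<bullet> (A *v y)" for x y
    using inner_matrix_vector_transpose[of A x y] assms by (simp only:)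
qed (use that in auto)

lemma nonneg_definite_sqrt_exists:
  fixes A :: "real ^ 'd ^ 'd"
  assumes A: "transpose A = A" "nonneg_definite A"
  shows "\<exists>R. transpose R = R \<and> nonneg_definite R \<and> R ** R = A"
proof -
  obtain B where B: "finite B" "pairwise orthogonal B" "\<And>v. v \<in> B \<Longrightarrow> norm v = 1"
    "\<And>v. v \<in> B \<Longrightarrow> \<exists>c. A *v v = c *\<^sub>R v" "span B = UNIV"
    using symmetric_matrix_eigenbasis[OF A(1)] by metis
  from B(4) obtain c where c: "\<And>v. v \<in> B \<Longrightarrow> A *v v = c v *\<^sub>R v" by metis
  have one: "v \<bullet> v = 1" if "v \<in> B" for v using B(3)[OF that] by (simp add: norm_eq_1)
  have c0: "0 \<le> c v" if "v \<in> B" for v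
    using A(2) c[OF that] one[OF that] by (metis inner_scaleR_right mult.right_neutral nonneg_definite_def)
  \<comment> \<open>The spectral square root, \<open>sqrt (c v)\<close> times the projection onto
    \<open>v\<close>, summed. Symmetry and nonnegativity are visible from this form, and the square
    needs checking only on the spanning set \<open>B\<close>.\<close>
  define g where "g x = (\<Sum>v\<in>B. (sqrt (c v) * (v \<bullet> x)) *\<^sub>R v)" for x
  have g: "linear g"
    unfolding g_def by (intro linear_compose_sum ballI linearI)
      (auto simp: inner_add_right algebra_simps)
  have gv: "g w = sqrt (c w) *\<^sub>R w" if w: "w \<in> B" for w
  proof -
    have "g w = (\<Sum>v\<in>B. if v = w then sqrt (c w) *\<^sub>R w else 0)"
      unfolding g_def using B(2) w one[OF w] by (intro sum.cong) (auto simp: pairwise_def orthogonal_def)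
    with w B(1) show ?thesis by simp
  qed
  have gx: "matrix g *v x = g x" for x using g by (simp add: matrix_works)
  have gsym: "g x \<bullet> y = x \<bullet> g y" for x y
    unfolding g_def by (simp add: inner_sum_left inner_sum_right mult_ac inner_commute)
  have "transpose (matrix g) = matrix g"
  proof -
    have "transpose (matrix g) *v y = matrix g *v y" for y
      by (metis gsym gx inner_matrix_vector_transpose vector_eq_ldot)
    then show ?thesis by (simp add: matrix_eq)
  qed
  moreover have "nonneg_definite (matrix g)"
  proof -
    have "x \<bullet> g x = (\<Sum>v\<in>B. sqrt (c v) * (x \<bullet> v)\<^sup>2)" for x
      unfolding g_def by (simp add: inner_sum_right mult_ac inner_commute power2_eq_square)
    with c0 show ?thesis
      unfolding nonneg_definite_def gx by (auto intro!: sum_nonneg)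
  qed
  moreover have "matrix g ** matrix g = A"
  proof -
    have "(matrix g ** matrix g) *v v = A *v v" if "v \<in> B" for v
      using that c0[OF that] g by (simp add: matrix_vector_mul_assoc[symmetric] gx gv c linear_scale)
    then have "(matrix g ** matrix g) *v x = A *v x" for x
      using linear_eq_on_span[of "(*v) (matrix g ** matrix g)" "(*v) A" B x] B(5) by simp
    then show ?thesis by (simp add: matrix_eq)
  qed
  ultimately show ?thesis by blast
qed

text \<open>On a unit eigenvector \<open>v\<close> of \<open>R - S\<close> with eigenvalue
  \<open>c\<close>, equality of the squares gives \<open>c (2 (v \<bullet> S v) + c) = 0\<close>. If
  \<open>c \<noteq> 0\<close>, the nonnegative numbers \<open>v \<bullet> S v\<close> and
  \<open>v \<bullet> R v = v \<bullet> S v + c\<close> sum to 0, so both vanish and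
  \<open>c = 0\<close> after all. This avoids a simultaneous diagonalization of \<open>R\<close> and
  \<open>S\<close>.\<close>

lemma nonneg_definite_sqrt_unique:
  fixes R S :: "real ^ 'd ^ 'd"
  assumes R: "transpose R = R" "nonneg_definite R" and S: "transpose S = S" "nonneg_definite S"
    and eq: "R ** R = S ** S"
  shows "R = S"
proof -
  define D where "D = R - S"
  have "transpose D = D" using R(1) S(1) by (simp add: D_def transpose_def vec_eq_iff)
  then obtain B where B: "\<And>v. v \<in> B \<Longrightarrow> norm v = 1" "\<And>v. v \<in> B \<Longrightarrow> \<exists>c. D *v v = c *\<^sub>R v" "span B = UNIV"
    using symmetric_matrix_eigenbasis[of D] by metis
  have D0: "D *v v = 0" if v: "v \<in> B" for v
  proof -
    obtain c where c: "D *v v = c *\<^sub>R v" using B(2)[OF v] by blast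
    have vv: "v \<bullet> v = 1" using B(1)[OF v] by (simp add: norm_eq_1)
    have RS: "R *v v = S *v v + c *\<^sub>R v"
      using c by (simp add: D_def matrix_vector_mult_diff_rdistrib algebra_simps)
    have "v \<bullet> (R *v (R *v v)) = v \<bullet> (S *v (S *v v))"
      using eq by (simp add: matrix_vector_mul_assoc)
    then have "(R *v v) \<bullet> (R *v v) = (S *v v) \<bullet> (S *v v)"
      using R(1) S(1) by (simp add: inner_matrix_vector_transpose)
    then have *: "c * (2 * (v \<bullet> (S *v v)) + c) = 0"
      by (simp add: RS inner_add_left inner_add_right vv inner_commute[of "S *v v" v] algebra_simps)
    have "0 \<le> v \<bullet> (R *v v)" "0 \<le> v \<bullet> (S *v v)"
      using R(2) S(2) by (auto simp: nonneg_definite_def)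
    then have "0 \<le> v \<bullet> (S *v v) + c" "0 \<le> v \<bullet> (S *v v)"
      by (auto simp: RS inner_add_right vv)
    with * have "c = 0" by auto
    with c show ?thesis by simp
  qed
  have "D *v x = 0 *v x" for x
    using linear_eq_on_span[of "(*v) D" "(*v) 0" B x] D0 B(3) by simp
  then have "D = 0" by (simp only: matrix_eq) simp
  then show ?thesis by (simp add: D_def)
qed

lemma matrix_sqrt_props:
  fixes A :: "real ^ 'd ^ 'd"
  assumes A: "transpose A = A" "nonneg_definite A"
  shows "transpose (matrix_sqrt A) = matrix_sqrt A" "matrix_sqrt A ** matrix_sqrt A = A"
proof -
  have "\<exists>!R. transpose R = R \<and> nonneg_definite R \<and> R ** R = A"
    using nonneg_definite_sqrt_exists[OF A] nonneg_definite_sqrt_unique by blast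
  from theI'[OF this] show "transpose (matrix_sqrt A) = matrix_sqrt A" "matrix_sqrt A ** matrix_sqrt A = A"
    unfolding matrix_sqrt_def by auto
qed

section \<open>Weak convergence from characteristic functions\<close>

text \<open>Finite sums of cosines of linear forms, with the phase \<open>c\<close> free so that
  sines and, by the product-to-sum formula, products stay in the class. It is an algebra, as
  Stone-Weierstrass asks, and consists of functions whose expectation is read off the characteristic
  function.\<close>

inductive trig_poly :: "'i set \<Rightarrow> (('i \<Rightarrow> real) \<Rightarrow> real) \<Rightarrow> bool" for I where
  cos: "trig_poly I (\<lambda>x. a * cos ((\<Sum>i\<in>I. t i * x i) + c))"
| add: "trig_poly I f \<Longrightarrow> trig_poly I g \<Longrightarrow> trig_poly I (\<lambda>x. f x + g x)"

lemma trig_poly_const: "trig_poly I (\<lambda>x. c)"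
  using trig_poly.cos[of I c "\<lambda>_. 0" 0] by simp

lemma trig_poly_cos_mult:
  assumes "trig_poly I g"
  shows "trig_poly I (\<lambda>x. (a * cos ((\<Sum>i\<in>I. t i * x i) + c)) * g x)"
  using assms
proof induction
  case (cos a' t' c')
  have "(\<lambda>x. (a * cos ((\<Sum>i\<in>I. t i * x i) + c)) * (a' * cos ((\<Sum>i\<in>I. t' i * x i) + c'))) =
    (\<lambda>x. (a * a' / 2) * cos ((\<Sum>i\<in>I. (t i - t' i) * x i) + (c - c')) +
      (a * a' / 2) * cos ((\<Sum>i\<in>I. (t i + t' i) * x i) + (c + c')))"
  proof
    fix x
    define p q where "p = (\<Sum>i\<in>I. t i * x i) + c" and "q = (\<Sum>i\<in>I. t' i * x i) + c'"
    have "(\<Sum>i\<in>I. (t i - t' i) * x i) + (c - c') = p - q" "(\<Sum>i\<in>I. (t i + t' i) * x i) + (c + c') = p + q"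
      by (simp_all add: p_def q_def algebra_simps sum.distrib sum_subtractf)
    moreover have "(a * cos p) * (a' * cos q) = (a * a' / 2) * cos (p - q) + (a * a' / 2) * cos (p + q)"
      by (simp add: cos_add cos_diff field_simps)
    ultimately show "(a * cos ((\<Sum>i\<in>I. t i * x i) + c)) * (a' * cos ((\<Sum>i\<in>I. t' i * x i) + c')) =
      (a * a' / 2) * cos ((\<Sum>i\<in>I. (t i - t' i) * x i) + (c - c')) +
      (a * a' / 2) * cos ((\<Sum>i\<in>I. (t i + t' i) * x i) + (c + c'))"
      unfolding p_def[symmetric] q_def[symmetric] by simp
  qed
  then show ?case
    by (simp only:) (intro trig_poly.intros)
next
  case (add f g)
  then show ?case
    by (simp only: distrib_left) (intro trig_poly.add)
qed

lemma trig_poly_mult: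
  assumes "trig_poly I f" "trig_poly I g"
  shows "trig_poly I (\<lambda>x. f x * g x)"
  using assms(1)
proof induction
  case (cos a t c)
  show ?case by (rule trig_poly_cos_mult[OF assms(2)])
next
  case (add f1 f2)
  then show ?case
    by (simp only: distrib_right) (intro trig_poly.add)
qed

lemma trig_poly_sin:
  assumes "finite I" "i \<in> I"
  shows "trig_poly I (\<lambda>x. sin (x i / L))"
proof -
  have "(\<Sum>j\<in>I. (if j = i then 1 / L else 0) * x j) = x i / L" for x :: "'a \<Rightarrow> real"
  proof -
    have "(\<Sum>j\<in>I. (if j = i then 1 / L else 0) * x j) = (\<Sum>j\<in>I. if j = i then x j / L else 0)"
      by (intro sum.cong) auto
    with assms show ?thesis by simp
  qed
  then have "sin (x i / L) = 1 * cos ((\<Sum>j\<in>I. (if j = i then 1 / L else 0) * x j) + (- pi / 2))" for x :: "'a \<Rightarrow> real"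
    by (simp add: sin_cos_eq cos_minus[symmetric, of "x i / L - pi/2"])
  then show ?thesis
    by (simp only:) (rule trig_poly.cos)
qed

lemma trig_poly_integrable:
  assumes "prob_space M" "trig_poly I f" "\<And>i. i \<in> I \<Longrightarrow> (\<lambda>\<omega>. W \<omega> i) \<in> borel_measurable M"
  shows "integrable M (\<lambda>\<omega>. f (W \<omega>))"
  using assms(2)
proof induction
  case (cos a t c)
  interpret prob_space M by fact
  have [measurable]: "(\<lambda>\<omega>. (\<Sum>i\<in>I. t i * W \<omega> i)) \<in> borel_measurable M"
    using assms(3) by (intro borel_measurable_sum borel_measurable_times) auto
  have "\<bar>a\<bar> * \<bar>cos r\<bar> \<le> \<bar>a\<bar>" for r
    using mult_left_mono[of "\<bar>cos r\<bar>" 1 "\<bar>a\<bar>"] abs_cos_le_one[of r] by simp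
  then show ?case
    by (intro integrable_const_bound[where B="\<bar>a\<bar>"]) (auto simp: abs_mult)
qed (intro Bochner_Integration.integrable_add)

text \<open>Each cosine is \<open>Re (iexp c * iexp \<theta>)\<close> with \<open>\<theta>\<close>
  the linear form, so its expectation depends continuously on one value of the characteristic
  function.\<close>

lemma trig_poly_expectation_tendsto:
  fixes W :: "nat \<Rightarrow> 'a \<Rightarrow> 'i \<Rightarrow> real" and Z :: "'b \<Rightarrow> 'i \<Rightarrow> real"
  assumes "prob_space M" "prob_space N" "trig_poly I f"
    and W: "\<And>n i. i \<in> I \<Longrightarrow> (\<lambda>\<omega>. W n \<omega> i) \<in> borel_measurable M"
    and Z: "\<And>i. i \<in> I \<Longrightarrow> (\<lambda>\<omega>. Z \<omega> i) \<in> borel_measurable N"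
    and char: "\<And>t. (\<lambda>n. CLINT \<omega>|M. iexp (\<Sum>i\<in>I. t i * W n \<omega> i)) \<longlonglongrightarrow> (CLINT \<omega>|N. iexp (\<Sum>i\<in>I. t i * Z \<omega> i))"
  shows "(\<lambda>n. \<integral>\<omega>. f (W n \<omega>) \<partial>M) \<longlonglongrightarrow> (\<integral>\<omega>. f (Z \<omega>) \<partial>N)"
  using assms(3)
proof induction
  case (cos a t c)
  have *: "(\<integral>\<omega>. a * cos ((\<Sum>i\<in>I. t i * V \<omega> i) + c) \<partial>P) =
      a * Re (iexp c * (CLINT \<omega>|P. iexp (\<Sum>i\<in>I. t i * V \<omega> i)))"
    if P: "prob_space P" and V: "\<And>i. i \<in> I \<Longrightarrow> (\<lambda>\<omega>. V \<omega> i) \<in> borel_measurable P"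
    for P and V :: "'z \<Rightarrow> 'i \<Rightarrow> real"
  proof -
    interpret P: prob_space P by fact
    have [measurable]: "(\<lambda>\<omega>. (\<Sum>i\<in>I. t i * V \<omega> i)) \<in> borel_measurable P"
      using V by (intro borel_measurable_sum borel_measurable_times) auto
    have int: "integrable P (\<lambda>\<omega>. iexp (\<Sum>i\<in>I. t i * V \<omega> i))"
      by (intro P.integrable_iexp) (simp_all del: of_real_sum)
    have int': "integrable P (\<lambda>\<omega>. iexp c * iexp (\<Sum>i\<in>I. t i * V \<omega> i))"
      by (intro integrable_mult_right int)
    have "Re (iexp c * (CLINT \<omega>|P. iexp (\<Sum>i\<in>I. t i * V \<omega> i))) =
      Re (CLINT \<omega>|P. iexp c * iexp (\<Sum>i\<in>I. t i * V \<omega> i))"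
      by (simp only: integral_mult_right_zero)
    also have "\<dots> = (\<integral>\<omega>. Re (iexp c * iexp (\<Sum>i\<in>I. t i * V \<omega> i)) \<partial>P)"
      by (rule integral_Re[symmetric, OF int'])
    also have "\<dots> = (\<integral>\<omega>. cos ((\<Sum>i\<in>I. t i * V \<omega> i) + c) \<partial>P)"
      by (intro Bochner_Integration.integral_cong refl)
        (simp add: Re_exp Im_exp cos_add mult.commute del: of_real_sum)
    finally show ?thesis by simp
  qed
  have "(\<lambda>n. a * Re (iexp c * (CLINT \<omega>|M. iexp (\<Sum>i\<in>I. t i * W n \<omega> i)))) \<longlonglongrightarrow>
      a * Re (iexp c * (CLINT \<omega>|N. iexp (\<Sum>i\<in>I. t i * Z \<omega> i)))"
    by (intro tendsto_intros char)
  moreover have "(\<integral>\<omega>. a * cos ((\<Sum>i\<in>I. t i * W n \<omega> i) + c) \<partial>M) =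
      a * Re (iexp c * (CLINT \<omega>|M. iexp (\<Sum>i\<in>I. t i * W n \<omega> i)))" for n
    by (rule *[OF assms(1) W])
  moreover have "(\<integral>\<omega>. a * cos ((\<Sum>i\<in>I. t i * Z \<omega> i) + c) \<partial>N) =
      a * Re (iexp c * (CLINT \<omega>|N. iexp (\<Sum>i\<in>I. t i * Z \<omega> i)))"
    by (rule *[OF assms(2) Z])
  ultimately show ?case by (simp only:)
next
  case (add f g)
  then show ?case
    using trig_poly_integrable[OF assms(1) add(1), of "W n" for n] W
      trig_poly_integrable[OF assms(1) add(2), of "W n" for n]
      trig_poly_integrable[OF assms(2) add(1), of Z] Z trig_poly_integrable[OF assms(2) add(2), of Z]
    by (simp add: Bochner_Integration.integral_add tendsto_add)
qed

text \<open>Freezing the coordinates outside \<open>I\<close> at 0 makes the set a product of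
  compact sets, and Tychonoff's theorem applies in the full function space.\<close>

lemma compact_cube:
  "compact {v :: 'i \<Rightarrow> real. (\<forall>i\<in>I. \<bar>v i\<bar> \<le> 1) \<and> (\<forall>i. i \<notin> I \<longrightarrow> v i = 0)}" (is "compact ?S")
proof -
  have eq: "?S = PiE UNIV (\<lambda>i. if i \<in> I then {-1..1} else {0})"
    by (auto simp: PiE_def Pi_def abs_le_iff split: if_splits; force)
  have "compactin (product_topology (\<lambda>i. euclidean) UNIV) (PiE UNIV (\<lambda>i. if i \<in> I then {-1..1::real} else {0}))"
    by (subst compactin_PiE) auto
  then show ?thesis
    unfolding eq euclidean_product_topology by simp
qed

lemma tail_prob_tendsto_0:
  assumes "prob_space M" "\<And>i. i \<in> I \<Longrightarrow> (\<lambda>\<omega>. W \<omega> i) \<in> borel_measurable M" "finite I"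
  shows "(\<lambda>k. measure M {\<omega>\<in>space M. \<exists>i\<in>I. real k < \<bar>W \<omega> i\<bar>}) \<longlonglongrightarrow> 0"
proof -
  interpret prob_space M by fact
  have [measurable]: "{\<omega>\<in>space M. \<exists>i\<in>I. real k < \<bar>W \<omega> i\<bar>} \<in> sets M" for k
    using assms by (intro sets.sets_Collect_finite_Ex) auto
  let ?A = "\<lambda>k. {\<omega>\<in>space M. \<exists>i\<in>I. real k < \<bar>W \<omega> i\<bar>}"
  have "(\<lambda>k. measure M (?A k)) \<longlonglongrightarrow> measure M (\<Inter>k. ?A k)"
  proof (rule finite_Lim_measure_decseq)
    show "decseq ?A"
      unfolding decseq_def by (auto intro: le_less_trans[OF of_nat_mono])
  qed auto
  also have "(\<Inter>k. ?A k) = {}"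
  proof (rule ccontr)
    assume "\<not> ?thesis"
    then obtain \<omega> where \<omega>: "\<And>k. \<exists>i\<in>I. real k < \<bar>W \<omega> i\<bar>" by auto
    obtain k :: nat where k: "(\<Sum>i\<in>I. \<bar>W \<omega> i\<bar>) < real k"
      using reals_Archimedean2 by blast
    obtain i where "i \<in> I" "real k < \<bar>W \<omega> i\<bar>" using \<omega> by blast
    moreover have "\<bar>W \<omega> i\<bar> \<le> (\<Sum>i\<in>I. \<bar>W \<omega> i\<bar>)"
      using \<open>i \<in> I\<close> assms(3) by (intro member_le_sum) auto
    ultimately show False using k by simp
  qed
  finally show ?thesis by simp
qed

text \<open>Through \<open>v\<^sub>i = sin (x\<^sub>i / L)\<close> a function of \<open>x\<close> becomes a continuous function
  on a cube, up to the event that some \<open>\<bar>x\<^sub>i\<bar>\<close> exceeds \<open>L\<close>; a polynomial approximating it on the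
  cube is a trigonometric polynomial in \<open>x\<close>, and is bounded globally.\<close>

lemma cramer_wold_expectation_tendsto:
  fixes W :: "nat \<Rightarrow> 'a \<Rightarrow> 'i :: countable \<Rightarrow> real" and Z :: "'b \<Rightarrow> 'i \<Rightarrow> real"
    and f :: "('i \<Rightarrow> real) \<Rightarrow> real"
  assumes "prob_space M" "prob_space N" "finite I"
    and W: "\<And>n i. i \<in> I \<Longrightarrow> (\<lambda>\<omega>. W n \<omega> i) \<in> borel_measurable M"
    and Z: "\<And>i. i \<in> I \<Longrightarrow> (\<lambda>\<omega>. Z \<omega> i) \<in> borel_measurable N"
    and W0: "\<And>n i \<omega>. i \<notin> I \<Longrightarrow> W n \<omega> i = 0" and Z0: "\<And>i \<omega>. i \<notin> I \<Longrightarrow> Z \<omega> i = 0"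
    and char: "\<And>t. (\<lambda>n. CLINT \<omega>|M. iexp (\<Sum>i\<in>I. t i * W n \<omega> i)) \<longlonglongrightarrow> (CLINT \<omega>|N. iexp (\<Sum>i\<in>I. t i * Z \<omega> i))"
    and tight: "\<And>e. 0 < e \<Longrightarrow> \<exists>K. \<forall>n. measure M {\<omega>\<in>space M. \<exists>i\<in>I. K < \<bar>W n \<omega> i\<bar>} \<le> e"
    and f: "continuous_on UNIV f" "\<And>x. \<bar>f x\<bar> \<le> C"
    and fW[measurable]: "\<And>n. (\<lambda>\<omega>. f (W n \<omega>)) \<in> borel_measurable M"
    and fZ[measurable]: "(\<lambda>\<omega>. f (Z \<omega>)) \<in> borel_measurable N"
  shows "(\<lambda>n. \<integral>\<omega>. f (W n \<omega>) \<partial>M) \<longlonglongrightarrow> (\<integral>\<omega>. f (Z \<omega>) \<partial>N)"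
proof (rule LIMSEQ_I)
  fix r :: real assume r: "0 < r"
  have C: "0 \<le> C" using f(2)[of "\<lambda>_. 0"] abs_ge_zero[of "f (\<lambda>_. 0)"] by (rule order_trans[rotated])
  \<comment> \<open>Replacing \<open>f\<close> by a trigonometric polynomial costs
    \<open>(1 + 2 C) e\<close> for \<open>W\<close> and again for \<open>Z\<close>, the convergence
    for the polynomial another \<open>e\<close>; together \<open>r\<close>.\<close>
  define e where "e = r / (2 * (1 + 2 * C) + 1)"
  have e: "0 < e" using r C by (simp add: e_def)
  obtain K where K: "\<And>n. measure M {\<omega>\<in>space M. \<exists>i\<in>I. K < \<bar>W n \<omega> i\<bar>} \<le> e"
    using tight[OF e] by blast
  have "\<forall>\<^sub>F k in sequentially. measure N {\<omega>\<in>space N. \<exists>i\<in>I. real k < \<bar>Z \<omega> i\<bar>} < e"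
    using order_tendstoD(2)[OF tail_prob_tendsto_0[OF assms(2) Z assms(3)] e] by simp
  moreover have "\<forall>\<^sub>F k in sequentially. K < real k"
    using filterlim_real_sequentially by (rule filterlim_at_top_dense[THEN iffD1, rule_format])
  moreover have "\<forall>\<^sub>F k in sequentially. 0 < k" by (rule eventually_gt_at_top)
  ultimately have "\<forall>\<^sub>F k in sequentially. measure N {\<omega>\<in>space N. \<exists>i\<in>I. real k < \<bar>Z \<omega> i\<bar>} < e \<and> K < real k \<and> 0 < k"
    by eventually_elim auto
  then obtain k :: nat where k: "measure N {\<omega>\<in>space N. \<exists>i\<in>I. real k < \<bar>Z \<omega> i\<bar>} < e" "K < real k" "0 < k"
    by (auto simp: eventually_sequentially)
  \<comment> \<open>\<open>L\<close> exceeds the tightness bound \<open>K\<close>, which is common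
    to all \<open>n\<close>, and is large enough for the tail of \<open>Z\<close>.\<close>
  define L where "L = real k"
  have L: "0 < L" "K < L" using k by (auto simp: L_def)
  define S where "S = {v :: 'i \<Rightarrow> real. (\<forall>i\<in>I. \<bar>v i\<bar> \<le> 1) \<and> (\<forall>i. i \<notin> I \<longrightarrow> v i = 0)}"
  \<comment> \<open>\<open>L * arcsin\<close> undoes \<open>sin (x / L)\<close> as long as
    \<open>x / L\<close> stays within \<open>pi / 2\<close>, in particular for
    \<open>\<bar>x\<bar> \<le> L\<close>.\<close>
  define G where "G v = f (\<lambda>i. L * arcsin (v i))" for v
  define R where "R = {g. continuous_on S g \<and> trig_poly I (\<lambda>x. g (\<lambda>i. if i \<in> I then sin (x i / L) else 0))}"
  interpret function_ring_on R S
  proof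
    show "compact S" unfolding S_def by (rule compact_cube)
    show "f \<in> R \<Longrightarrow> continuous_on S f" for f by (simp add: R_def)
    show "f \<in> R \<Longrightarrow> g \<in> R \<Longrightarrow> (\<lambda>x. f x + g x) \<in> R" for f g
      by (auto simp: R_def intro: continuous_on_add trig_poly.add)
    show "f \<in> R \<Longrightarrow> g \<in> R \<Longrightarrow> (\<lambda>x. f x * g x) \<in> R" for f g
      by (auto simp: R_def intro: continuous_on_mult trig_poly_mult)
    show "(\<lambda>_. c) \<in> R" for c by (simp add: R_def trig_poly_const)
    \<comment> \<open>Points of \<open>S\<close> can differ only in a coordinate of
      \<open>I\<close>, and such a coordinate pulls back to \<open>sin (x i / L)\<close>, a cosine
      with phase \<open>- pi / 2\<close>.\<close>
    fix x y assume xy: "x \<in> S" "y \<in> S" "x \<noteq> y"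
    then obtain i where i: "x i \<noteq> y i" by auto
    then have "i \<in> I" using xy by (auto simp: S_def)
    then have "(\<lambda>v. v i) \<in> R"
      using trig_poly_sin[OF assms(3) \<open>i \<in> I\<close>, of L]
      by (auto simp: R_def intro: continuous_on_product_coordinates continuous_on_subset)
    with i show "\<exists>f\<in>R. f x \<noteq> f y" by (intro bexI[where x="\<lambda>v. v i"])
  qed
  have "continuous_on S (\<lambda>v. L * arcsin (v i))" for i
  proof (cases "i \<in> I")
    case True
    then have "\<forall>v\<in>S. -1 \<le> v i \<and> v i \<le> 1" by (auto simp: S_def abs_le_iff)
    then show ?thesis
      by (intro continuous_on_mult continuous_on_const continuous_on_arcsin
            continuous_on_subset[OF continuous_on_product_coordinates]) auto
  next
    case False
    then have "continuous_on S (\<lambda>v. L * arcsin (v i)) \<longleftrightarrow> continuous_on S (\<lambda>v. 0 :: real)"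
      by (intro continuous_on_cong) (auto simp: S_def)
    then show ?thesis by simp
  qed
  then have "continuous_on S (\<lambda>v i. L * arcsin (v i))"
    by (rule continuous_on_coordinatewise_then_product)
  then have "continuous_on S G"
    unfolding G_def by (rule continuous_on_compose2[OF f(1)]) auto
  from Stone_Weierstrass_basic[OF this e]
  obtain g where g: "g \<in> R" "\<And>x. x \<in> S \<Longrightarrow> \<bar>G x - g x\<bar> < e" by blast
  define h where "h x = g (\<lambda>i. if i \<in> I then sin (x i / L) else 0)" for x
  have h: "trig_poly I h" using g(1) by (simp add: R_def h_def[abs_def])
  have inS: "(\<lambda>i. if i \<in> I then sin (x i / L) else 0) \<in> S" for x :: "'i \<Rightarrow> real"
    by (simp add: S_def abs_sin_le_one)
  have fh: "\<bar>(\<integral>\<omega>. f (V \<omega>) \<partial>P) - (\<integral>\<omega>. h (V \<omega>) \<partial>P)\<bar> \<le> (1 + 2 * C) * e"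
    if P: "prob_space P" and V: "\<And>i. i \<in> I \<Longrightarrow> (\<lambda>\<omega>. V \<omega> i) \<in> borel_measurable P"
      and V0: "\<And>i \<omega>. i \<notin> I \<Longrightarrow> V \<omega> i = 0"
      and fV[measurable]: "(\<lambda>\<omega>. f (V \<omega>)) \<in> borel_measurable P"
      and tail: "measure P {\<omega>\<in>space P. \<exists>i\<in>I. L < \<bar>V \<omega> i\<bar>} \<le> e"
    for P and V :: "'z \<Rightarrow> 'i \<Rightarrow> real"
  proof -
    interpret P: prob_space P by fact
    have [measurable]: "{\<omega>\<in>space P. \<exists>i\<in>I. L < \<bar>V \<omega> i\<bar>} \<in> sets P" (is "?A \<in> _")
      using assms(3) V by (intro sets.sets_Collect_finite_Ex) auto
    have intf: "integrable P (\<lambda>\<omega>. f (V \<omega>))"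
      using f(2) by (intro P.integrable_const_bound[where B=C]) auto
    have inth: "integrable P (\<lambda>\<omega>. h (V \<omega>))"
      using trig_poly_integrable[OF P h V] by simp
    \<comment> \<open>Off the tail event \<open>G v\<close> equals \<open>f (V \<omega>)\<close>,
      and only the approximation error remains. On it \<open>f (V \<omega>)\<close> and
      \<open>G v\<close> are both bounded by \<open>C\<close>; the bound on \<open>G\<close> over
      the whole cube is what controls \<open>h\<close> there.\<close>
    have bound: "\<bar>f (V \<omega>) - h (V \<omega>)\<bar> \<le> e + 2 * C * indicator ?A \<omega>" if "\<omega> \<in> space P" for \<omega>
    proof -
      define v where "v = (\<lambda>i. if i \<in> I then sin (V \<omega> i / L) else 0)"
      have 1: "\<bar>G v - h (V \<omega>)\<bar> < e"
        using g(2)[OF inS, of "V \<omega>"] by (simp add: h_def v_def)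
      show ?thesis
      proof (cases "\<omega> \<in> ?A")
        case True
        have "\<bar>f (V \<omega>)\<bar> \<le> C" "\<bar>G v\<bar> \<le> C" using f(2) by (auto simp: G_def)
        with 1 True show ?thesis by simp
      next
        case False
        have "L * arcsin (v i) = V \<omega> i" for i
        proof (cases "i \<in> I")
          case True
          with False that have "\<bar>V \<omega> i\<bar> \<le> L" by auto
          then have "\<bar>V \<omega> i / L\<bar> \<le> 1" using L by (simp add: abs_divide)
          moreover have "1 \<le> pi / 2" using pi_ge_two by simp
          ultimately have "- (pi / 2) \<le> V \<omega> i / L" "V \<omega> i / L \<le> pi / 2" by linarith+
          then have "arcsin (sin (V \<omega> i / L)) = V \<omega> i / L" by (rule arcsin_sin)
          with True L show ?thesis by (simp add: v_def)
        qed (simp add: v_def V0)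
        then have "G v = f (V \<omega>)" by (simp add: G_def)
        with 1 False show ?thesis by simp
      qed
    qed
    have "\<bar>(\<integral>\<omega>. f (V \<omega>) \<partial>P) - (\<integral>\<omega>. h (V \<omega>) \<partial>P)\<bar> = \<bar>\<integral>\<omega>. f (V \<omega>) - h (V \<omega>) \<partial>P\<bar>"
      using intf inth by simp
    also have "\<dots> \<le> (\<integral>\<omega>. \<bar>f (V \<omega>) - h (V \<omega>)\<bar> \<partial>P)"
      by (rule integral_abs_bound)
    also have "\<dots> \<le> (\<integral>\<omega>. e + 2 * C * indicator ?A \<omega> \<partial>P)"
      using intf inth bound
      by (intro integral_mono) (auto intro!: Bochner_Integration.integrable_add integrable_mult_right simp: P.emeasure_eq_measure)
    also have "\<dots> = e + 2 * C * measure P ?A"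
      by (subst Bochner_Integration.integral_add) (auto simp: P.prob_space P.emeasure_eq_measure)
    also have "\<dots> \<le> e + 2 * C * e"
      using tail C by (intro add_left_mono mult_left_mono) auto
    finally show ?thesis by (simp add: algebra_simps)
  qed
  have fhW: "\<bar>(\<integral>\<omega>. f (W n \<omega>) \<partial>M) - (\<integral>\<omega>. h (W n \<omega>) \<partial>M)\<bar> \<le> (1 + 2 * C) * e" for n
  proof (rule fh[OF assms(1) W W0 fW])
    interpret M: prob_space M by fact
    have "measure M {\<omega>\<in>space M. \<exists>i\<in>I. L < \<bar>W n \<omega> i\<bar>} \<le> measure M {\<omega>\<in>space M. \<exists>i\<in>I. K < \<bar>W n \<omega> i\<bar>}"
      using assms(3) W L
      by (intro M.finite_measure_mono sets.sets_Collect_finite_Ex) (auto intro: less_trans)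
    with K show "measure M {\<omega>\<in>space M. \<exists>i\<in>I. L < \<bar>W n \<omega> i\<bar>} \<le> e"
      by (meson order_trans)
  qed
  have fhZ: "\<bar>(\<integral>\<omega>. f (Z \<omega>) \<partial>N) - (\<integral>\<omega>. h (Z \<omega>) \<partial>N)\<bar> \<le> (1 + 2 * C) * e"
    using k(1) by (intro fh[OF assms(2) Z Z0 fZ]) (auto simp: L_def)
  have "(\<lambda>n. \<integral>\<omega>. h (W n \<omega>) \<partial>M) \<longlonglongrightarrow> (\<integral>\<omega>. h (Z \<omega>) \<partial>N)"
    by (rule trig_poly_expectation_tendsto[OF assms(1,2) h W Z char])
  from LIMSEQ_D[OF this e] obtain n0 where
    n0: "\<And>n. n \<ge> n0 \<Longrightarrow> \<bar>(\<integral>\<omega>. h (W n \<omega>) \<partial>M) - (\<integral>\<omega>. h (Z \<omega>) \<partial>N)\<bar> < e" by auto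
  have "\<bar>(\<integral>\<omega>. f (W n \<omega>) \<partial>M) - (\<integral>\<omega>. f (Z \<omega>) \<partial>N)\<bar> < r" if "n \<ge> n0" for n
  proof -
    have "\<bar>(\<integral>\<omega>. f (W n \<omega>) \<partial>M) - (\<integral>\<omega>. f (Z \<omega>) \<partial>N)\<bar> < (1 + 2 * C) * e + (1 + 2 * C) * e + e"
      using fhW[of n] fhZ n0[OF that] by linarith
    also have "\<dots> = (2 * (1 + 2 * C) + 1) * e" by (simp add: algebra_simps)
    also have "\<dots> = r" using C by (simp add: e_def)
    finally show ?thesis .
  qed
  then show "\<exists>no. \<forall>n\<ge>no. norm ((\<integral>\<omega>. f (W n \<omega>) \<partial>M) - (\<integral>\<omega>. f (Z \<omega>) \<partial>N)) < r"
    by auto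
qed

section \<open>Characteristic functions of Gaussian vectors and of normalized sums\<close>

lemma normal_characteristic_function:
  assumes s: "0 < s"
  shows "(CLINT y|lborel. normal_density 0 s y * iexp (v * y)) = complex_of_real (exp (- (s\<^sup>2 * v\<^sup>2) / 2))"
    and "integrable lborel (\<lambda>y. complex_of_real (normal_density 0 s y) * iexp (v * y))"
proof -
  have d: "s * normal_density 0 s (s * y) = std_normal_density y" for y
    using s by (simp add: normal_density_def real_sqrt_mult power_mult_distrib)
  have "(CLINT y|lborel. normal_density 0 s y * iexp (v * y)) =
      s *\<^sub>R (CLINT y|lborel. normal_density 0 s (s * y) * iexp (v * (s * y)))"
    using lborel_integral_real_affine[of s "\<lambda>y. complex_of_real (normal_density 0 s y) * iexp (v * y)" 0] s
    by simp
  also have "\<dots> = (CLINT y|lborel. s *\<^sub>R (complex_of_real (normal_density 0 s (s * y)) * iexp (v * (s * y))))"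
    by simp
  also have "\<dots> = (CLINT y|lborel. std_normal_density y *\<^sub>R iexp ((v * s) * y))"
    unfolding d[symmetric] by (simp add: scaleR_conv_of_real mult_ac)
  also have "\<dots> = char std_normal_distribution (v * s)"
    unfolding char_def by (subst integral_density) (auto simp: normal_density_nonneg)
  also have "\<dots> = complex_of_real (exp (- (s\<^sup>2 * v\<^sup>2) / 2))"
    unfolding char_std_normal_distribution by (simp add: power_mult_distrib mult.commute)
  finally show "(CLINT y|lborel. normal_density 0 s y * iexp (v * y)) = complex_of_real (exp (- (s\<^sup>2 * v\<^sup>2) / 2))" .
  have "integrable lborel (normal_density 0 s)"
    using s by simp
  then show "integrable lborel (\<lambda>y. complex_of_real (normal_density 0 s y) * iexp (v * y))"
    by (rule Bochner_Integration.integrable_bound) (auto simp: norm_mult normal_density_nonneg)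
qed

lemma lborel_integral_prod_Basis:
  fixes h :: "'a::euclidean_space \<Rightarrow> real \<Rightarrow> complex"
  assumes h: "\<And>b. b \<in> Basis \<Longrightarrow> integrable lborel (h b)"
  shows "(\<integral>x. (\<Prod>b\<in>Basis. h b (x \<bullet> b)) \<partial>lborel) = (\<Prod>b\<in>Basis. \<integral>y. h b y \<partial>lborel)"
proof -
  interpret product_sigma_finite "\<lambda>_. lborel :: real measure" ..
  have [measurable]: "h b \<in> borel_measurable borel" if "b \<in> Basis" for b
    using h[OF that] by auto
  have "(\<integral>x. (\<Prod>b\<in>Basis. h b (x \<bullet> b)) \<partial>lborel) =
    (\<integral>f. (\<Prod>b\<in>Basis. h b ((\<Sum>b\<in>Basis. f b *\<^sub>R b) \<bullet> b)) \<partial>(\<Pi>\<^sub>M b\<in>(Basis :: 'a set). lborel))"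
    unfolding lborel_eq[where 'a='a] by (subst integral_distr) auto
  also have "\<dots> = (\<integral>f. (\<Prod>b\<in>Basis. h b (f b)) \<partial>(\<Pi>\<^sub>M b\<in>(Basis :: 'a set). lborel))"
    by (intro Bochner_Integration.integral_cong prod.cong refl) simp
  also have "\<dots> = (\<Prod>b\<in>Basis. \<integral>y. h b y \<partial>lborel)"
    by (rule product_integral_prod) (use h in auto)
  finally show ?thesis .
qed

text \<open>Density and exponential both factor over the coordinates, so Fubini reduces the integral
  to one-dimensional ones; the exponents add up to the squared norm of \<open>u\<close>.\<close>

lemma (in prob_space) gaussian_vector_characteristic_function:
  fixes Z :: "'a \<Rightarrow> real ^ 'd"
  assumes Z: "distributed M lborel Z (\<lambda>x. ennreal (\<Prod>i\<in>UNIV. normal_density 0 s (x $ i)))" and s: "0 < s"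
  shows "(CLINT \<omega>|M. iexp (u \<bullet> Z \<omega>)) = complex_of_real (exp (- (s\<^sup>2 * (norm u)\<^sup>2) / 2))"
proof -
  have prod_Basis: "(\<Prod>i\<in>UNIV. g (axis i 1)) = (\<Prod>b\<in>Basis. g b)" for g :: "real ^ 'd \<Rightarrow> 'c :: comm_monoid_mult"
  proof -
    have "bij_betw (\<lambda>i. axis i 1) (UNIV :: 'd set) (Basis :: (real ^ 'd) set)"
      by (auto simp: bij_betw_def inj_on_def Basis_vec_def axis_eq_axis)
    then show ?thesis by (rule prod.reindex_bij_betw)
  qed
  have [measurable]: "random_variable borel Z" using Z by (auto simp: distributed_def)
  let ?f = "\<lambda>x :: real ^ 'd. \<Prod>i\<in>UNIV. normal_density 0 s (x $ i)"
  have f0: "0 \<le> ?f x" for x by (intro prod_nonneg) (simp add: normal_density_nonneg)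
  have "(CLINT \<omega>|M. iexp (u \<bullet> Z \<omega>)) = (CLINT x|distr M lborel Z. iexp (u \<bullet> x))"
    by (subst integral_distr) auto
  also have "distr M lborel Z = density lborel (\<lambda>x. ennreal (?f x))"
    using Z by (rule distributed_distr_eq_density)
  also have "(CLINT x|\<dots>. iexp (u \<bullet> x)) = (CLINT x|lborel. ?f x *\<^sub>R iexp (u \<bullet> x))"
    using f0 by (intro integral_density) auto
  also have "\<dots> = (CLINT x|lborel. \<Prod>b\<in>Basis. normal_density 0 s (x \<bullet> b) * iexp ((u \<bullet> b) * (x \<bullet> b)))"
  proof (intro Bochner_Integration.integral_cong refl)
    fix x :: "real ^ 'd"
    have "?f x = (\<Prod>b\<in>Basis. normal_density 0 s (x \<bullet> b))"
      using prod_Basis[of "\<lambda>b. normal_density 0 s (x \<bullet> b)"] by (simp add: inner_axis)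
    moreover have "iexp (u \<bullet> x) = (\<Prod>b\<in>Basis. iexp ((u \<bullet> b) * (x \<bullet> b)))"
      by (subst euclidean_inner) (simp add: exp_sum sum_distrib_left)
    ultimately show "?f x *\<^sub>R iexp (u \<bullet> x) = (\<Prod>b\<in>Basis. normal_density 0 s (x \<bullet> b) * iexp ((u \<bullet> b) * (x \<bullet> b)))"
      by (simp add: prod.distrib scaleR_conv_of_real)
  qed
  also have "\<dots> = (\<Prod>b\<in>Basis. CLINT y|lborel. normal_density 0 s y * iexp ((u \<bullet> b) * y))"
    by (rule lborel_integral_prod_Basis) (rule normal_characteristic_function[OF s])
  also have "\<dots> = (\<Prod>b\<in>Basis. complex_of_real (exp (- (s\<^sup>2 * (u \<bullet> b)\<^sup>2) / 2)))"
    by (intro prod.cong refl normal_characteristic_function[OF s])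
  also have "\<dots> = complex_of_real (exp (\<Sum>b\<in>Basis. - (s\<^sup>2 * (u \<bullet> b)\<^sup>2) / 2))"
    by (simp only: exp_sum[OF finite_Basis] of_real_prod)
  also have "(\<Sum>b\<in>Basis. - (s\<^sup>2 * (u \<bullet> b)\<^sup>2) / 2) = - (s\<^sup>2 * (norm u)\<^sup>2) / 2"
    unfolding power2_norm_eq_inner
    by (subst euclidean_inner) (simp add: sum_distrib_left sum_negf sum_divide_distrib power2_eq_square)
  finally show ?thesis .
qed

text \<open>The second-order expansion of the characteristic function at \<open>1 / sqrt n\<close>,
  raised to a power that is only asymptotically \<open>r n\<close>, because blocks have rounded
  lengths.\<close>

lemma (in prob_space) char_power_tendsto:
  assumes [measurable]: "random_variable borel Y"
    and Y: "integrable M Y" "integrable M (\<lambda>\<omega>. (Y \<omega>)\<^sup>2)" "expectation Y = 0"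
    and l: "(\<lambda>n. real (l n) / real n) \<longlonglongrightarrow> r"
  shows "(\<lambda>n. char (distr M borel Y) (1 / sqrt (real n)) ^ l n) \<longlonglongrightarrow>
    exp (- r * expectation (\<lambda>\<omega>. (Y \<omega>)\<^sup>2) / 2)"
proof -
  define v where "v = expectation (\<lambda>\<omega>. (Y \<omega>)\<^sup>2)"
  let ?c = "\<lambda>n. char (distr M borel Y) (1 / sqrt (real n))"
  interpret D: real_distribution "distr M borel Y" by simp
  have v0: "0 \<le> v" unfolding v_def by simp
  \<comment> \<open>The remainder of the expansion is at most \<open>d n / (6 n)\<close>. Capping
    the cubic term by \<open>6 Y^2\<close> gives an integrable majorant, so that \<open>d n\<close>
    tends to 0 although third moments may be infinite.\<close>
  define d where "d n = expectation (\<lambda>\<omega>. min (6 * (Y \<omega>)\<^sup>2) (\<bar>1 / sqrt (real n)\<bar> * \<bar>Y \<omega>\<bar> ^ 3))" for n :: nat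
  have "d \<longlonglongrightarrow> (\<integral>\<omega>. 0 \<partial>M)"
    unfolding d_def
  proof (rule integral_dominated_convergence[where w="\<lambda>\<omega>. 6 * (Y \<omega>)\<^sup>2"])
    show "AE \<omega> in M. (\<lambda>n. min (6 * (Y \<omega>)\<^sup>2) (\<bar>1 / sqrt (real n)\<bar> * \<bar>Y \<omega>\<bar> ^ 3)) \<longlonglongrightarrow> 0"
    proof (intro AE_I2)
      fix \<omega>
      have "(\<lambda>n. \<bar>1 / sqrt (real n)\<bar> * \<bar>Y \<omega>\<bar> ^ 3) \<longlonglongrightarrow> \<bar>0\<bar> * \<bar>Y \<omega>\<bar> ^ 3"
        by (intro tendsto_intros tendsto_divide_0[OF tendsto_const] filterlim_at_top_imp_at_infinity
            filterlim_compose[OF sqrt_at_top filterlim_real_sequentially])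
      then have "(\<lambda>n. min (6 * (Y \<omega>)\<^sup>2) (\<bar>1 / sqrt (real n)\<bar> * \<bar>Y \<omega>\<bar> ^ 3)) \<longlonglongrightarrow> min (6 * (Y \<omega>)\<^sup>2) 0"
        by (intro tendsto_min tendsto_const) simp
      then show "(\<lambda>n. min (6 * (Y \<omega>)\<^sup>2) (\<bar>1 / sqrt (real n)\<bar> * \<bar>Y \<omega>\<bar> ^ 3)) \<longlonglongrightarrow> 0"
        using zero_le_power2[of "Y \<omega>"] by (simp only: min_absorb2 mult_nonneg_nonneg zero_le_numeral)
    qed
  qed (use Y in auto)
  then have d: "d \<longlonglongrightarrow> 0" by simp
  have base: "(\<lambda>n. (1 + (- v / 2) / real n) ^ l n) \<longlonglongrightarrow> exp (r * (- v / 2))"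
  proof -
    \<comment> \<open>The power \<open>l n\<close> is the power \<open>n\<close> followed by the
      real power \<open>l n / n\<close>; the latter requires a positive base, hence
      \<open>v < n\<close> below.\<close>
    have "(\<lambda>n. ((1 + (- v / 2) / real n) ^ n) powr (real (l n) / real n)) \<longlonglongrightarrow> exp (- v / 2) powr r"
      by (intro tendsto_powr tendsto_exp_limit_sequentially l) simp
    moreover have "exp (- v / 2) powr r = exp (r * (- v / 2))" by (simp add: powr_def)
    moreover have "\<forall>\<^sub>F n in sequentially. v < real n"
      using filterlim_real_sequentially by (rule filterlim_at_top_dense[THEN iffD1, rule_format])
    then have "\<forall>\<^sub>F n in sequentially. ((1 + (- v / 2) / real n) ^ n) powr (real (l n) / real n) = (1 + (- v / 2) / real n) ^ l n"
      using eventually_gt_at_top[of 0]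
    proof eventually_elim
      case (elim n)
      then have "0 < 1 + (- v / 2) / real n" using v0 by (simp add: field_simps)
      then show ?case using elim
        by (simp add: powr_realpow[symmetric] powr_powr)
    qed
    ultimately show ?thesis by (simp add: tendsto_cong)
  qed
  have "(\<lambda>n. ?c n ^ l n - complex_of_real ((1 + (- v / 2) / real n) ^ l n)) \<longlonglongrightarrow> 0"
  proof (rule Lim_null_comparison)
    have "(\<lambda>n. (real (l n) / real n) * (d n / 6)) \<longlonglongrightarrow> r * (0 / 6)"
      by (intro tendsto_intros l d) simp
    then show "(\<lambda>n. (real (l n) / real n) * (d n / 6)) \<longlonglongrightarrow> 0" by simp
    have "\<forall>\<^sub>F n in sequentially. v < real n"
      using filterlim_real_sequentially by (rule filterlim_at_top_dense[THEN iffD1, rule_format])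
    then show "\<forall>\<^sub>F n in sequentially. norm (?c n ^ l n - complex_of_real ((1 + (- v / 2) / real n) ^ l n)) \<le> (real (l n) / real n) * (d n / 6)"
      using eventually_gt_at_top[of 0]
    proof eventually_elim
      case (elim n)
      have "\<bar>1 + (- v / 2) / real n\<bar> \<le> 1" using v0 elim by (auto simp: abs_le_iff field_simps)
      \<comment> \<open>For \<open>a\<close>, \<open>b\<close> of modulus at most 1, the powers
        \<open>a^l\<close> and \<open>b^l\<close> differ by at most \<open>l\<close> times the
        distance of \<open>a\<close> and \<open>b\<close>. With \<open>l n\<close> of order
        \<open>n\<close>, an error of order \<open>d n / n\<close> is just good enough.\<close>
      then have "norm (?c n ^ l n - complex_of_real (1 + (- v / 2) / real n) ^ l n) \<le>
          l n * norm (?c n - complex_of_real (1 + (- v / 2) / real n))"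
        by (intro norm_power_diff D.cmod_char_le_1) (simp only: norm_of_real)
      also have "norm (?c n - complex_of_real (1 + (- v / 2) / real n)) \<le> ((1 / sqrt (real n))\<^sup>2 / 6) * d n"
      proof -
        have "norm (?c n - (1 - (1 / sqrt (real n))\<^sup>2 * v / 2)) \<le> ((1 / sqrt (real n))\<^sup>2 / 6) * d n"
          unfolding d_def using Y by (intro char_approx3') (auto simp: v_def)
        moreover have "1 - (1 / sqrt (real n))\<^sup>2 * v / 2 = 1 + (- v / 2) / real n"
          using elim by (simp add: power_divide)
        ultimately show ?thesis by (metis of_real_1 of_real_diff of_real_eq_iff)
      qed
      also have "real (l n) * (((1 / sqrt (real n))\<^sup>2 / 6) * d n) = (real (l n) / real n) * (d n / 6)"
        using elim by (simp add: power_divide)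
      finally show ?case by (simp add: mult_left_mono)
    qed
  qed
  from tendsto_add[OF this tendsto_of_real[OF base]] show ?thesis
    by (simp add: v_def)
qed

text \<open>Rounding down is off by at most 1, which the division by \<open>n\<close> makes
  negligible.\<close>

lemma nat_div_real_tendsto:
  assumes "0 < m"
  shows "(\<lambda>n. real (n * j div m) / real n) \<longlonglongrightarrow> real j / real m"
proof (rule LIM_zero_cancel, rule Lim_null_comparison)
  show "(\<lambda>n. 1 / real n) \<longlonglongrightarrow> 0" by (rule lim_1_over_n)
  show "\<forall>\<^sub>F n in sequentially. norm (real (n * j div m) / real n - real j / real m) \<le> 1 / real n"
    using eventually_gt_at_top[of 0]
  proof eventually_elim
    case (elim n)
    have "real (n * j) < real (m + m * (n * j div m))"
      using dividend_less_times_div[OF assms, of "n * j"] by (simp only: of_nat_less_iff)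
    then have "real (n * j) / real m \<le> real (n * j div m) + 1"
      using assms by (simp add: field_simps)
    moreover have "real (n * j div m) \<le> real (n * j) / real m"
      by (rule of_nat_div_le_of_nat)
    ultimately have "real (n * j div m) \<le> real n * (real j / real m)" "real n * (real j / real m) \<le> real (n * j div m) + 1"
      by simp_all
    then have "\<bar>real (n * j div m) - real n * (real j / real m)\<bar> \<le> 1" by (auto simp: abs_le_iff)
    then have "\<bar>real (n * j div m) - real n * (real j / real m)\<bar> / real n \<le> 1 / real n"
      using elim by (intro divide_right_mono) auto
    also have "\<bar>real (n * j div m) - real n * (real j / real m)\<bar> / real n = norm (real (n * j div m) / real n - real j / real m)"
    proof -
      have "(real (n * j div m) - real n * (real j / real m)) / real n = real (n * j div m) / real n - real j / real m"
        using elim by (simp add: diff_divide_distrib)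
      then show ?thesis using elim by (metis abs_divide abs_of_nat real_norm_def)
    qed
    finally show ?case .
  qed
qed

section \<open>Walks with centred square-integrable steps\<close>

lemma (in prob_space) expectation_square_sum_indep:
  fixes Y :: "nat \<Rightarrow> 'a \<Rightarrow> real"
  assumes "finite J" "indep_vars (\<lambda>_. borel) Y J"
    and "\<And>i. i \<in> J \<Longrightarrow> integrable M (Y i)" "\<And>i. i \<in> J \<Longrightarrow> integrable M (\<lambda>\<omega>. (Y i \<omega>)\<^sup>2)"
    and "\<And>i. i \<in> J \<Longrightarrow> expectation (Y i) = 0"
  shows "integrable M (\<lambda>\<omega>. (\<Sum>i\<in>J. Y i \<omega>)\<^sup>2) \<and>
    expectation (\<lambda>\<omega>. (\<Sum>i\<in>J. Y i \<omega>)\<^sup>2) = (\<Sum>i\<in>J. expectation (\<lambda>\<omega>. (Y i \<omega>)\<^sup>2))"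
  using assms
proof (induction J)
  case (insert i J)
  have IH: "integrable M (\<lambda>\<omega>. (\<Sum>i\<in>J. Y i \<omega>)\<^sup>2)"
      "expectation (\<lambda>\<omega>. (\<Sum>i\<in>J. Y i \<omega>)\<^sup>2) = (\<Sum>i\<in>J. expectation (\<lambda>\<omega>. (Y i \<omega>)\<^sup>2))"
    using insert.IH insert.prems indep_vars_subset[OF insert.prems(1), of J] by auto
  have ind: "indep_var borel (Y i) borel (\<lambda>\<omega>. \<Sum>i\<in>J. Y i \<omega>)"
    by (rule indep_vars_sum[OF insert.hyps(1,2) insert.prems(1)])
  have int: "integrable M (Y i)" "integrable M (\<lambda>\<omega>. \<Sum>i\<in>J. Y i \<omega>)" using insert.prems by auto
  have sq: "(\<Sum>j\<in>insert i J. Y j \<omega>)\<^sup>2 = (Y i \<omega>)\<^sup>2 + (\<Sum>j\<in>J. Y j \<omega>)\<^sup>2 + 2 * (Y i \<omega> * (\<Sum>j\<in>J. Y j \<omega>))" for \<omega>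
    using insert.hyps by (simp add: power2_sum)
  show ?case
    unfolding sq using indep_var_integrable[OF ind int] indep_var_lebesgue_integral[OF ind int] IH insert
    by simp
qed simp

locale centered_random_walk = prob_space M
  for M :: "'a measure" and \<xi> :: "nat \<Rightarrow> 'a \<Rightarrow> real ^ 'd" and X :: "'a \<Rightarrow> real ^ 'd" +
  assumes indep: "indep_vars (\<lambda>_. borel) \<xi> {1..}"
    and identical: "\<And>i. i \<ge> 1 \<Longrightarrow> distr M borel (\<xi> i) = distr M borel X"
    and integrable_X: "integrable M X" and mean_X: "expectation X = 0"
    and square_integrable_X: "integrable M (\<lambda>\<omega>. (norm (X \<omega>))\<^sup>2)"
begin

lemma measurable_X [measurable]: "X \<in> borel_measurable M"
  using integrable_X by auto

lemma measurable_step: "i \<ge> 1 \<Longrightarrow> \<xi> i \<in> borel_measurable M"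
  using indep by (auto simp: indep_vars_def2)

lemma measurable_partial_sum [measurable]: "partial_sum \<xi> n \<in> borel_measurable M"
  unfolding partial_sum_def[abs_def] by (intro borel_measurable_sum measurable_step) auto

lemma integrable_inner_X: "integrable M (\<lambda>\<omega>. c \<bullet> X \<omega>)"
  using integrable_X by (rule integrable_inner_right)

lemma square_integrable_inner_X: "integrable M (\<lambda>\<omega>. (c \<bullet> X \<omega>)\<^sup>2)"
proof (rule Bochner_Integration.integrable_bound)
  show "integrable M (\<lambda>\<omega>. (norm c)\<^sup>2 * (norm (X \<omega>))\<^sup>2)" using square_integrable_X by simp
  have "(c \<bullet> x)\<^sup>2 \<le> (norm c)\<^sup>2 * (norm x)\<^sup>2" for x
    using Cauchy_Schwarz_ineq[of c x] by (simp add: power2_norm_eq_inner)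
  then show "AE \<omega> in M. norm ((c \<bullet> X \<omega>)\<^sup>2) \<le> norm ((norm c)\<^sup>2 * (norm (X \<omega>))\<^sup>2)" by simp
qed simp

lemma mean_inner_X: "expectation (\<lambda>\<omega>. c \<bullet> X \<omega>) = 0"
  using integral_inner_right[OF integrable_X, of c] mean_X by simp

lemma integrable_step_iff:
  fixes g :: "real ^ 'd \<Rightarrow> 'c :: {banach, second_countable_topology}"
  assumes [measurable]: "g \<in> borel_measurable borel" and i: "i \<ge> 1"
  shows "integrable M (\<lambda>\<omega>. g (\<xi> i \<omega>)) \<longleftrightarrow> integrable M (\<lambda>\<omega>. g (X \<omega>))"
  using integrable_distr_eq[OF measurable_step[OF i], of g] integrable_distr_eq[of X M borel g] identical[OF i] by simp

lemma expectation_step: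
  fixes g :: "real ^ 'd \<Rightarrow> 'c :: {banach, second_countable_topology}"
  assumes [measurable]: "g \<in> borel_measurable borel" and i: "i \<ge> 1"
  shows "expectation (\<lambda>\<omega>. g (\<xi> i \<omega>)) = expectation (\<lambda>\<omega>. g (X \<omega>))"
  using integral_distr[OF measurable_step[OF i], of g] integral_distr[of X M borel g] identical[OF i] by simp

lemma partial_sum_diff: "p \<le> q \<Longrightarrow> partial_sum \<xi> q \<omega> - partial_sum \<xi> p \<omega> = (\<Sum>i\<in>{p<..q}. \<xi> i \<omega>)"
proof -
  assume "p \<le> q"
  then have "{1..q} = {1..p} \<union> {p<..q}" by auto
  then show ?thesis unfolding partial_sum_def by (simp add: sum.union_disjoint ivl_disj_int)
qed

lemma expectation_square_increment:
  assumes "p \<le> q"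
  shows "integrable M (\<lambda>\<omega>. (norm (partial_sum \<xi> q \<omega> - partial_sum \<xi> p \<omega>))\<^sup>2)"
    and "expectation (\<lambda>\<omega>. (norm (partial_sum \<xi> q \<omega> - partial_sum \<xi> p \<omega>))\<^sup>2) =
      real (q - p) * expectation (\<lambda>\<omega>. (norm (X \<omega>))\<^sup>2)"
proof -
  have coord: "integrable M (\<lambda>\<omega>. (\<Sum>i\<in>{p<..q}. b \<bullet> \<xi> i \<omega>)\<^sup>2) \<and>
      expectation (\<lambda>\<omega>. (\<Sum>i\<in>{p<..q}. b \<bullet> \<xi> i \<omega>)\<^sup>2) = real (q - p) * expectation (\<lambda>\<omega>. (b \<bullet> X \<omega>)\<^sup>2)" for b
  proof -
    have "indep_vars (\<lambda>_. borel) (\<lambda>i \<omega>. b \<bullet> \<xi> i \<omega>) {p<..q}"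
      by (rule indep_vars_compose2[OF indep_vars_subset[OF indep]]) auto
    from expectation_square_sum_indep[OF _ this]
    have "integrable M (\<lambda>\<omega>. (\<Sum>i\<in>{p<..q}. b \<bullet> \<xi> i \<omega>)\<^sup>2) \<and>
      expectation (\<lambda>\<omega>. (\<Sum>i\<in>{p<..q}. b \<bullet> \<xi> i \<omega>)\<^sup>2) = (\<Sum>i\<in>{p<..q}. expectation (\<lambda>\<omega>. (b \<bullet> \<xi> i \<omega>)\<^sup>2))"
      using integrable_inner_X[of b] square_integrable_inner_X[of b] mean_inner_X[of b]
      by (simp add: integrable_step_iff[of "\<lambda>x. b \<bullet> x"] integrable_step_iff[of "\<lambda>x. (b \<bullet> x)\<^sup>2"] expectation_step[of "\<lambda>x. b \<bullet> x"])
    then show ?thesis by (simp add: expectation_step[of "\<lambda>x. (b \<bullet> x)\<^sup>2"])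
  qed
  have norm_eq: "(norm x)\<^sup>2 = (\<Sum>b\<in>Basis. (b \<bullet> x)\<^sup>2)" for x :: "real ^ 'd"
    unfolding power2_norm_eq_inner by (subst euclidean_inner) (simp add: power2_eq_square inner_commute)
  have eq: "(norm (partial_sum \<xi> q \<omega> - partial_sum \<xi> p \<omega>))\<^sup>2 = (\<Sum>b\<in>Basis. (\<Sum>i\<in>{p<..q}. b \<bullet> \<xi> i \<omega>)\<^sup>2)" for \<omega>
    unfolding norm_eq partial_sum_diff[OF assms] inner_sum_right ..
  show "integrable M (\<lambda>\<omega>. (norm (partial_sum \<xi> q \<omega> - partial_sum \<xi> p \<omega>))\<^sup>2)"
    unfolding eq using coord by auto
  show "expectation (\<lambda>\<omega>. (norm (partial_sum \<xi> q \<omega> - partial_sum \<xi> p \<omega>))\<^sup>2) =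
      real (q - p) * expectation (\<lambda>\<omega>. (norm (X \<omega>))\<^sup>2)"
    unfolding eq unfolding norm_eq using coord square_integrable_inner_X
    by (simp add: Bochner_Integration.integral_sum sum_distrib_left)
qed

text \<open>Chebyshev; the second moment of an increment is linear in the number of steps, since the
  cross terms vanish in each coordinate.\<close>

lemma prob_increment_gt:
  assumes "p \<le> q" "0 < l"
  shows "prob {\<omega>\<in>space M. l < norm (partial_sum \<xi> q \<omega> - partial_sum \<xi> p \<omega>)} \<le>
    real (q - p) * expectation (\<lambda>\<omega>. (norm (X \<omega>))\<^sup>2) / l\<^sup>2"
proof -
  have "prob {\<omega>\<in>space M. l < norm (partial_sum \<xi> q \<omega> - partial_sum \<xi> p \<omega>)} \<le>
      prob {\<omega>\<in>space M. l\<^sup>2 \<le> (norm (partial_sum \<xi> q \<omega> - partial_sum \<xi> p \<omega>))\<^sup>2}"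
    using assms(2) by (intro finite_measure_mono) (auto intro!: power_mono)
  also have "\<dots> \<le> expectation (\<lambda>\<omega>. (norm (partial_sum \<xi> q \<omega> - partial_sum \<xi> p \<omega>))\<^sup>2) / l\<^sup>2"
    using assms by (intro integral_Markov_inequality_measure[where A="{}"] expectation_square_increment) auto
  finally show ?thesis using expectation_square_increment(2)[OF assms(1)] by simp
qed

text \<open>The block ends are \<open>n j / m\<close> rounded down, so that for \<open>m > 0\<close>
  exactly \<open>m\<close> blocks fill the indices from 1 to \<open>n\<close> without remainder, at
  the price of lengths that may differ by one.\<close>

definition block_sum :: "nat \<Rightarrow> nat \<Rightarrow> nat \<Rightarrow> 'a \<Rightarrow> real ^ 'd" where
  "block_sum n m j \<omega> = (partial_sum \<xi> (n * Suc j div m) \<omega> - partial_sum \<xi> (n * j div m) \<omega>) /\<^sub>R sqrt (real n)"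

lemma measurable_block_sum [measurable]: "block_sum n m j \<in> borel_measurable M"
  unfolding block_sum_def[abs_def]
  by (intro borel_measurable_scaleR borel_measurable_diff measurable_partial_sum borel_measurable_const)

lemma div_mono_block: "n * j div m \<le> n * Suc j div m"
  by (intro div_le_mono) simp

text \<open>Indexing steps by pairs of a block and a step in it turns the double sum into a single
  sum over an independent family, since disjoint blocks make \<open>snd\<close> injective on the
  pairs.\<close>

lemma block_characteristic_function:
  "(CLINT \<omega>|M. iexp (\<Sum>j<m. c j \<bullet> block_sum n m j \<omega>)) =
    (\<Prod>j<m. char (distr M borel (\<lambda>\<omega>. c j \<bullet> X \<omega>)) (1 / sqrt (real n)) ^ (n * Suc j div m - n * j div m))"
proof -
  let ?J = "\<lambda>j. {n * j div m<..n * Suc j div m}"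
  let ?K = "SIGMA j:{..<m}. ?J j"
  have inj: "inj_on snd ?K"
  proof (rule inj_onI, clarsimp)
    fix j i j' assume "n * j div m < i" "i \<le> (n + n * j) div m" "n * j' div m < i" "i \<le> (n + n * j') div m"
    moreover have "(n + n * j) div m \<le> n * j' div m" if "j < j'" for j j'
      using that div_le_mono[of "n + n * j" "n * j'" m] mult_le_mono2[of "Suc j" "j'" n] by (simp add: Suc_leI)
    ultimately show "j = j'" by (meson leD le_trans linorder_neqE_nat)
  qed
  have "indep_vars (\<lambda>_. borel) (\<lambda>p. \<xi> (snd p)) ?K"
    by (rule indep_vars_reindex[OF indep inj]) auto
  then have ind: "indep_vars (\<lambda>_. borel) (\<lambda>p \<omega>. iexp (1 / sqrt (real n) * (c (fst p) \<bullet> \<xi> (snd p) \<omega>))) ?K"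
    by (rule indep_vars_compose2[where Y="\<lambda>p x. iexp (1 / sqrt (real n) * (c (fst p) \<bullet> x))"])
      (simp del: of_real_mult)
  have pos: "i \<ge> 1" if "(j, i) \<in> ?K" for i j using that by auto
  have "(\<Sum>j<m. c j \<bullet> block_sum n m j \<omega>) = (\<Sum>(j, i)\<in>?K. 1 / sqrt (real n) * (c j \<bullet> \<xi> i \<omega>))" for \<omega>
    unfolding block_sum_def partial_sum_diff[OF div_mono_block]
    by (simp add: sum.Sigma[symmetric] inner_sum_right sum_distrib_left divide_inverse)
  then have "iexp (\<Sum>j<m. c j \<bullet> block_sum n m j \<omega>) = (\<Prod>p\<in>?K. iexp (1 / sqrt (real n) * (c (fst p) \<bullet> \<xi> (snd p) \<omega>)))" for \<omega>
    by (simp add: case_prod_beta sum_distrib_left exp_sum)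
  then have "(CLINT \<omega>|M. iexp (\<Sum>j<m. c j \<bullet> block_sum n m j \<omega>)) =
      (CLINT \<omega>|M. (\<Prod>p\<in>?K. iexp (1 / sqrt (real n) * (c (fst p) \<bullet> \<xi> (snd p) \<omega>))))"
    by (simp only:)
  also have "\<dots> = (\<Prod>p\<in>?K. CLINT \<omega>|M. iexp (1 / sqrt (real n) * (c (fst p) \<bullet> \<xi> (snd p) \<omega>)))"
  proof (rule indep_vars_lebesgue_integral[OF _ ind])
    fix p assume "p \<in> ?K"
    then have [measurable]: "\<xi> (snd p) \<in> borel_measurable M" by (intro measurable_step) auto
    show "integrable M (\<lambda>\<omega>. iexp (1 / sqrt (real n) * (c (fst p) \<bullet> \<xi> (snd p) \<omega>)))"
      by (intro integrable_iexp) (auto simp del: of_real_mult)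
  qed auto
  also have "\<dots> = (\<Prod>p\<in>?K. char (distr M borel (\<lambda>\<omega>. c (fst p) \<bullet> X \<omega>)) (1 / sqrt (real n)))"
  proof (rule prod.cong[OF refl])
    fix p assume p: "p \<in> ?K"
    have "(CLINT \<omega>|M. iexp (1 / sqrt (real n) * (c (fst p) \<bullet> \<xi> (snd p) \<omega>))) =
        (CLINT \<omega>|M. iexp (1 / sqrt (real n) * (c (fst p) \<bullet> X \<omega>)))"
      using p by (intro expectation_step[of "\<lambda>x. iexp (1 / sqrt (real n) * (c (fst p) \<bullet> x))"]) auto
    also have "\<dots> = char (distr M borel (\<lambda>\<omega>. c (fst p) \<bullet> X \<omega>)) (1 / sqrt (real n))"
      unfolding char_def by (subst integral_distr) auto
    finally show "(CLINT \<omega>|M. iexp (1 / sqrt (real n) * (c (fst p) \<bullet> \<xi> (snd p) \<omega>))) =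
       char (distr M borel (\<lambda>\<omega>. c (fst p) \<bullet> X \<omega>)) (1 / sqrt (real n))" .
  qed
  also have "\<dots> = (\<Prod>j<m. \<Prod>i\<in>?J j. char (distr M borel (\<lambda>\<omega>. c j \<bullet> X \<omega>)) (1 / sqrt (real n)))"
    by (subst prod.Sigma) (auto simp: case_prod_beta)
  finally show ?thesis by simp
qed

lemma block_characteristic_function_tendsto:
  assumes "0 < m"
  shows "(\<lambda>n. CLINT \<omega>|M. iexp (\<Sum>j<m. c j \<bullet> block_sum n m j \<omega>)) \<longlonglongrightarrow>
    (\<Prod>j<m. complex_of_real (exp (- (1 / real m) * expectation (\<lambda>\<omega>. (c j \<bullet> X \<omega>)\<^sup>2) / 2)))"
  unfolding block_characteristic_function
proof (intro tendsto_prod char_power_tendsto)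
  fix j
  have "(\<lambda>n. real (n * Suc j div m) / real n - real (n * j div m) / real n) \<longlonglongrightarrow> real (Suc j) / real m - real j / real m"
    by (intro tendsto_diff nat_div_real_tendsto assms)
  then show "(\<lambda>n. real (n * Suc j div m - n * j div m) / real n) \<longlonglongrightarrow> 1 / real m"
    using div_mono_block[of _ j m]
    by (simp add: of_nat_diff diff_divide_distrib add_divide_distrib del: mult_Suc_right)
qed (use integrable_inner_X square_integrable_inner_X mean_inner_X in auto)

lemma second_moment_matrix_inner:
  "c \<bullet> (second_moment_matrix M X *v c) = expectation (\<lambda>\<omega>. (c \<bullet> X \<omega>)\<^sup>2)"
proof -
  have int: "integrable M (\<lambda>\<omega>. X \<omega> $ i * X \<omega> $ j)" for i j
  proof (rule Bochner_Integration.integrable_bound[OF square_integrable_X])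
    show "AE \<omega> in M. norm (X \<omega> $ i * X \<omega> $ j) \<le> norm ((norm (X \<omega>))\<^sup>2)"
      by (auto simp: abs_mult power2_eq_square component_le_norm_cart intro!: mult_mono)
    have "(\<lambda>x :: real ^ 'd. x $ i * x $ j) \<in> borel_measurable borel"
      by (intro borel_measurable_continuous_onI continuous_intros)
    then show "(\<lambda>\<omega>. X \<omega> $ i * X \<omega> $ j) \<in> borel_measurable M"
      by (rule measurable_compose[OF measurable_X])
  qed
  have "(c \<bullet> X \<omega>)\<^sup>2 = (\<Sum>i\<in>UNIV. \<Sum>j\<in>UNIV. (c $ i * c $ j) * (X \<omega> $ i * X \<omega> $ j))" for \<omega>
    by (simp add: inner_vec_def power2_eq_square sum_product mult_ac)
  then have "expectation (\<lambda>\<omega>. (c \<bullet> X \<omega>)\<^sup>2) = (\<Sum>i\<in>UNIV. \<Sum>j\<in>UNIV. (c $ i * c $ j) * expectation (\<lambda>\<omega>. X \<omega> $ i * X \<omega> $ j))"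
    using int by (simp add: Bochner_Integration.integral_sum)
  also have "\<dots> = c \<bullet> (second_moment_matrix M X *v c)"
    by (simp add: second_moment_matrix_def inner_vec_def matrix_vector_mult_def sum_distrib_left mult_ac)
  finally show ?thesis by simp
qed

text \<open>By symmetry of the root \<open>R\<close>, the squared norm of \<open>R c\<close> is
  \<open>c \<bullet> R R c\<close>, the variance of \<open>c \<bullet> X\<close>. This is what
  matches the characteristic exponents of walk and Brownian motion.\<close>

lemma sqrt_second_moment_matrix:
  shows "transpose (matrix_sqrt (second_moment_matrix M X)) = matrix_sqrt (second_moment_matrix M X)"
    and "(norm (matrix_sqrt (second_moment_matrix M X) *v c))\<^sup>2 = expectation (\<lambda>\<omega>. (c \<bullet> X \<omega>)\<^sup>2)"
proof -
  let ?R = "matrix_sqrt (second_moment_matrix M X)"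
  have "transpose (second_moment_matrix M X) = second_moment_matrix M X"
    by (simp add: second_moment_matrix_def transpose_def vec_eq_iff mult.commute)
  moreover have "nonneg_definite (second_moment_matrix M X)"
    unfolding nonneg_definite_def second_moment_matrix_inner by simp
  ultimately have R: "transpose ?R = ?R" "?R ** ?R = second_moment_matrix M X"
    by (rule matrix_sqrt_props)+
  then show "transpose ?R = ?R" by simp
  have "(norm (?R *v c))\<^sup>2 = c \<bullet> (transpose ?R *v (?R *v c))"
    unfolding power2_norm_eq_inner by (rule inner_matrix_vector_transpose)
  also have "\<dots> = c \<bullet> (second_moment_matrix M X *v c)"
    unfolding R(1) by (simp add: matrix_vector_mul_assoc R(2))
  finally show "(norm (?R *v c))\<^sup>2 = expectation (\<lambda>\<omega>. (c \<bullet> X \<omega>)\<^sup>2)"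
    unfolding second_moment_matrix_inner .
qed

end

text \<open>Symmetry moves \<open>R\<close> from the increments to the test vectors
  \<open>c j\<close>, leaving independent Gaussian increments of variance \<open>1 / m\<close> per
  coordinate.\<close>

lemma brownian_characteristic_function:
  fixes R :: "real ^ 'd ^ 'd"
  assumes b: "standard_brownian_motion N b" and R: "transpose R = R" and m: "0 < m"
  shows "(CLINT \<omega>|N. iexp (\<Sum>j<m. c j \<bullet> (R *v (b (real (Suc j) / real m) \<omega> - b (real j / real m) \<omega>)))) =
    (\<Prod>j<m. complex_of_real (exp (- (1 / real m) * (norm (R *v c j))\<^sup>2 / 2)))"
proof -
  interpret N: prob_space N using b by (simp add: standard_brownian_motion_def)
  let ?Z = "\<lambda>j \<omega>. b (real (Suc j) / real m) \<omega> - b (real j / real m) \<omega>"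
  have ind: "N.indep_vars (\<lambda>_. borel) ?Z {..<m}"
    using b m unfolding standard_brownian_motion_def
    by (elim conjE allE[where x=m] allE[where x="\<lambda>i. real i / real m"])
      (simp add: divide_strict_right_mono del: of_nat_Suc)
  have dist: "distributed N lborel (?Z j) (\<lambda>x. ennreal (\<Prod>i\<in>UNIV. normal_density 0 (sqrt (1 / real m)) (x $ i)))" for j
  proof -
    have "distributed N lborel (\<lambda>\<omega>. b t \<omega> - b s \<omega>) (\<lambda>x. ennreal (\<Prod>i\<in>UNIV. normal_density 0 (sqrt (t - s)) (x $ i)))"
      if "0 \<le> s" "s < t" for s t
      using b that unfolding standard_brownian_motion_def by blast
    from this[of "real j / real m" "real (Suc j) / real m"] show ?thesis
      using m by (simp add: divide_strict_right_mono diff_divide_distrib[symmetric])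
  qed
  have adj: "c j \<bullet> (R *v z) = (R *v c j) \<bullet> z" for j z
    using inner_matrix_vector_transpose[of R "c j" z] R by (simp only:)
  have "(CLINT \<omega>|N. iexp (\<Sum>j<m. c j \<bullet> (R *v ?Z j \<omega>))) = (CLINT \<omega>|N. (\<Prod>j<m. iexp ((R *v c j) \<bullet> ?Z j \<omega>)))"
    unfolding adj by (simp add: sum_distrib_left exp_sum)
  also have "\<dots> = (\<Prod>j<m. CLINT \<omega>|N. iexp ((R *v c j) \<bullet> ?Z j \<omega>))"
  proof (rule N.indep_vars_lebesgue_integral)
    show "N.indep_vars (\<lambda>_. borel) (\<lambda>j \<omega>. iexp ((R *v c j) \<bullet> ?Z j \<omega>)) {..<m}"
      by (rule N.indep_vars_compose2[OF ind, where Y="\<lambda>j z. iexp ((R *v c j) \<bullet> z)"]) simp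
    show "integrable N (\<lambda>\<omega>. iexp ((R *v c j) \<bullet> ?Z j \<omega>))" if "j \<in> {..<m}" for j
    proof -
      have [measurable]: "?Z j \<in> borel_measurable N" using ind that by (auto simp: N.indep_vars_def2)
      show ?thesis by (intro N.integrable_iexp) (auto simp del: of_nat_Suc)
    qed
  qed simp
  also have "\<dots> = (\<Prod>j<m. complex_of_real (exp (- (1 / real m) * (norm (R *v c j))\<^sup>2 / 2)))"
    using N.gaussian_vector_characteristic_function[OF dist] m by simp
  finally show ?thesis .
qed

context centered_random_walk
begin

text \<open>Only tightness for fixed \<open>m\<close> is at stake, so the block length is crudely
  bounded by \<open>n\<close>.\<close>

lemma prob_block_sum_gt:
  assumes "j < m" "0 < l"
  shows "prob {\<omega>\<in>space M. l < norm (block_sum n m j \<omega>)} \<le> expectation (\<lambda>\<omega>. (norm (X \<omega>))\<^sup>2) / l\<^sup>2"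
proof (cases "n = 0")
  case True
  then have "block_sum n m j \<omega> = 0" for \<omega> by (simp add: block_sum_def)
  with assms show ?thesis by simp
next
  case False
  let ?v = "expectation (\<lambda>\<omega>. (norm (X \<omega>))\<^sup>2)"
  have v: "0 \<le> ?v" by simp
  have "n * Suc j div m \<le> n"
    using assms(1) by (metis Suc_leI div_le_mono mult_le_mono2 nonzero_mult_div_cancel_right not_less0)
  have "prob {\<omega>\<in>space M. l < norm (block_sum n m j \<omega>)} =
      prob {\<omega>\<in>space M. l * sqrt (real n) < norm (partial_sum \<xi> (n * Suc j div m) \<omega> - partial_sum \<xi> (n * j div m) \<omega>)}"
  proof -
    have "norm (block_sum n m j \<omega>) = norm (partial_sum \<xi> (n * Suc j div m) \<omega> - partial_sum \<xi> (n * j div m) \<omega>) / sqrt (real n)" for \<omega>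
      by (simp add: block_sum_def divide_inverse mult.commute del: mult_Suc_right)
    then show ?thesis using False by (simp add: pos_less_divide_eq del: mult_Suc_right)
  qed
  also have "\<dots> \<le> real (n * Suc j div m - n * j div m) * ?v / (l * sqrt (real n))\<^sup>2"
    using assms False by (intro prob_increment_gt div_mono_block) auto
  also have "\<dots> \<le> real n * ?v / (l * sqrt (real n))\<^sup>2"
    using \<open>n * Suc j div m \<le> n\<close> v by (intro divide_right_mono mult_right_mono) auto
  also have "\<dots> = ?v / l\<^sup>2" using False by (simp add: power_mult_distrib)
  finally show ?thesis .
qed

lemma block_expectation_tendsto:
  fixes f :: "(nat \<Rightarrow> real ^ 'd) \<Rightarrow> real"
  assumes b: "standard_brownian_motion N b" and m: "0 < m"
    and f: "continuous_on UNIV f" "\<And>x. \<bar>f x\<bar> \<le> C"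
  defines "R \<equiv> matrix_sqrt (second_moment_matrix M X)"
  shows "(\<lambda>n. \<integral>\<omega>. f (\<lambda>j. if j < m then block_sum n m j \<omega> else 0) \<partial>M) \<longlonglongrightarrow>
    (\<integral>\<omega>. f (\<lambda>j. if j < m then R *v (b (real (Suc j) / real m) \<omega> - b (real j / real m) \<omega>) else 0) \<partial>N)"
proof -
  interpret N: prob_space N using b by (simp add: standard_brownian_motion_def)
  have R: "transpose R = R" "\<And>c. (norm (R *v c))\<^sup>2 = expectation (\<lambda>\<omega>. (c \<bullet> X \<omega>)\<^sup>2)"
    unfolding R_def by (rule sqrt_second_moment_matrix)+
  have bm[measurable]: "b t \<in> borel_measurable N" if "0 \<le> t" for t
    using b that by (simp add: standard_brownian_motion_def)
  let ?Z = "\<lambda>j \<omega>. R *v (b (real (Suc j) / real m) \<omega> - b (real j / real m) \<omega>)"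
  have Rm: "(*v) R \<in> borel_measurable borel"
    by (intro borel_measurable_continuous_onI matrix_vector_mult_linear_continuous_on)
  have Zm: "?Z j \<in> borel_measurable N" for j
    by (rule measurable_compose[OF _ Rm]) (intro borel_measurable_diff bm, auto)
  have fm: "f \<in> borel_measurable borel" using f(1) by (rule borel_measurable_continuous_onI)
  have nth: "(\<lambda>x :: real ^ 'd. x $ k) \<in> borel_measurable borel" for k
    by (intro borel_measurable_continuous_onI continuous_intros)
  have fcomp: "(\<lambda>\<omega>. f (\<lambda>j. if j < m then V j \<omega> else 0)) \<in> borel_measurable P"
    if "\<And>j. V j \<in> borel_measurable P" for V :: "nat \<Rightarrow> 'z \<Rightarrow> real ^ 'd" and P
  proof (rule measurable_compose[OF _ fm], rule measurable_coordinatewise_then_product)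
    show "(\<lambda>\<omega>. if j < m then V j \<omega> else 0) \<in> borel_measurable P" for j
      using that by (cases "j < m") auto
  qed
  let ?I = "{..<m} \<times> (UNIV :: 'd set)"
  \<comment> \<open>The \<open>m\<close> vectors are flattened into scalar coordinates indexed by
    block and component, the form in which convergence from characteristic functions was
    proved.\<close>
  define F where "F x = f (\<lambda>j. \<chi> k. x (j, k))" for x :: "nat \<times> 'd \<Rightarrow> real"
  define W where "W n \<omega> p = (if fst p < m then block_sum n m (fst p) \<omega> $ snd p else 0)" for n \<omega> p
  define Y where "Y \<omega> p = (if fst p < m then ?Z (fst p) \<omega> $ snd p else 0)" for \<omega> p
  have FW: "F (W n \<omega>) = f (\<lambda>j. if j < m then block_sum n m j \<omega> else 0)" for n \<omega>
    unfolding F_def W_def by (intro arg_cong[where f=f]) (auto simp: vec_eq_iff fun_eq_iff)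
  have FY: "F (Y \<omega>) = f (\<lambda>j. if j < m then ?Z j \<omega> else 0)" for \<omega>
    unfolding F_def Y_def by (intro arg_cong[where f=f]) (auto simp: vec_eq_iff fun_eq_iff)
  have lin: "(\<Sum>p\<in>?I. t p * (if fst p < m then V (fst p) $ snd p else 0)) = (\<Sum>j<m. (\<chi> k. t (j, k)) \<bullet> V j)"
    for t :: "nat \<times> 'd \<Rightarrow> real" and V :: "nat \<Rightarrow> real ^ 'd"
  proof -
    have "(\<Sum>p\<in>?I. t p * (if fst p < m then V (fst p) $ snd p else 0)) = (\<Sum>p\<in>?I. t p * V (fst p) $ snd p)"
      by (intro sum.cong) auto
    then show ?thesis unfolding inner_vec_def by (simp add: sum.cartesian_product case_prod_beta)
  qed
  have "(\<lambda>n. \<integral>\<omega>. F (W n \<omega>) \<partial>M) \<longlonglongrightarrow> (\<integral>\<omega>. F (Y \<omega>) \<partial>N)"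
  proof (rule cramer_wold_expectation_tendsto[where I="?I" and C=C and f=F and W=W and Z=Y])
    show "prob_space M" "prob_space N" by unfold_locales
    show "finite ?I" by simp
    show "(\<lambda>\<omega>. W n \<omega> p) \<in> borel_measurable M" if "p \<in> ?I" for n p
      using that measurable_compose[OF measurable_block_sum nth] by (auto simp: W_def)
    show "(\<lambda>\<omega>. Y \<omega> p) \<in> borel_measurable N" if "p \<in> ?I" for p
      using that measurable_compose[OF Zm nth] by (auto simp: Y_def)
    show "W n \<omega> p = 0" if "p \<notin> ?I" for n \<omega> p using that by (cases p) (auto simp: W_def)
    show "Y \<omega> p = 0" if "p \<notin> ?I" for \<omega> p using that by (cases p) (auto simp: Y_def)
    show "\<bar>F x\<bar> \<le> C" for x unfolding F_def by (rule f(2))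
    show "continuous_on UNIV F"
      unfolding F_def[abs_def]
      by (rule continuous_on_compose2[OF f(1)])
        (auto intro!: continuous_on_coordinatewise_then_product continuous_on_vec_lambda continuous_on_product_coordinates)
    show "(\<lambda>\<omega>. F (W n \<omega>)) \<in> borel_measurable M" for n
      unfolding FW by (intro fcomp measurable_block_sum)
    show "(\<lambda>\<omega>. F (Y \<omega>)) \<in> borel_measurable N"
      unfolding FY by (intro fcomp Zm)
    show "(\<lambda>n. CLINT \<omega>|M. iexp (\<Sum>p\<in>?I. t p * W n \<omega> p)) \<longlonglongrightarrow> (CLINT \<omega>|N. iexp (\<Sum>p\<in>?I. t p * Y \<omega> p))" for t
    proof -
      have "(\<Sum>p\<in>?I. t p * W n \<omega> p) = (\<Sum>j<m. (\<chi> k. t (j, k)) \<bullet> block_sum n m j \<omega>)" for n \<omega>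
        unfolding W_def by (rule lin[of t "\<lambda>j. block_sum n m j \<omega>"])
      moreover have "(\<Sum>p\<in>?I. t p * Y \<omega> p) = (\<Sum>j<m. (\<chi> k. t (j, k)) \<bullet> ?Z j \<omega>)" for \<omega>
        unfolding Y_def by (rule lin[of t "\<lambda>j. ?Z j \<omega>"])
      ultimately show ?thesis
        using block_characteristic_function_tendsto[OF m, of "\<lambda>j. \<chi> k. t (j, k)"]
        by (simp only: brownian_characteristic_function[OF b R(1) m] R(2))
    qed
    show "\<exists>K. \<forall>n. prob {\<omega>\<in>space M. \<exists>p\<in>?I. K < \<bar>W n \<omega> p\<bar>} \<le> e" if e: "0 < e" for e
    proof -
      define v where "v = expectation (\<lambda>\<omega>. (norm (X \<omega>))\<^sup>2)"
      have v: "0 \<le> v" by (simp add: v_def)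
      \<comment> \<open>The union bound over the \<open>m\<close> blocks costs
        \<open>m v / K^2\<close>, which this \<open>K\<close> brings down to \<open>e\<close>; the
        summand 1 keeps \<open>K\<close> positive when \<open>v = 0\<close>.\<close>
      define K where "K = sqrt (real m * v / e) + 1"
      have K: "0 < K" using v e by (simp add: K_def add_nonneg_pos)
      have "real m * v / e = (sqrt (real m * v / e))\<^sup>2" using v e by simp
      also have "\<dots> \<le> K\<^sup>2" using v e by (intro power_mono) (auto simp: K_def)
      finally have Ke: "real m * (v / K\<^sup>2) \<le> e" using K e by (simp add: field_simps)
      have "prob {\<omega>\<in>space M. \<exists>p\<in>?I. K < \<bar>W n \<omega> p\<bar>} \<le> e" for n
      proof -
        have "prob {\<omega>\<in>space M. \<exists>p\<in>?I. K < \<bar>W n \<omega> p\<bar>} \<le> prob (\<Union>j<m. {\<omega>\<in>space M. K < norm (block_sum n m j \<omega>)})"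
        proof (rule finite_measure_mono)
          show "{\<omega>\<in>space M. \<exists>p\<in>?I. K < \<bar>W n \<omega> p\<bar>} \<subseteq> (\<Union>j<m. {\<omega>\<in>space M. K < norm (block_sum n m j \<omega>)})"
            unfolding W_def by (auto intro: less_le_trans component_le_norm_cart)
        qed auto
        also have "\<dots> \<le> (\<Sum>j<m. prob {\<omega>\<in>space M. K < norm (block_sum n m j \<omega>)})"
          by (intro finite_measure_subadditive_finite) auto
        also have "\<dots> \<le> (\<Sum>j<m. v / K\<^sup>2)"
          unfolding v_def using K by (intro sum_mono prob_block_sum_gt) auto
        also have "\<dots> \<le> e" using Ke by simp
        finally show ?thesis .
      qed
      then show ?thesis by blast
    qed
  qed
  then show ?thesis unfolding FW FY .
qed

section \<open>Ottaviani's inequality with moving anchors\<close>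

lemma prob_indep_past_future:
  assumes [measurable]: "A \<in> sets (PiM {1..k} (\<lambda>_. borel))" "B \<in> sets (PiM {Suc k..q} (\<lambda>_. borel))"
  shows "prob {\<omega>\<in>space M. (\<lambda>i\<in>{1..k}. \<xi> i \<omega>) \<in> A \<and> (\<lambda>i\<in>{Suc k..q}. \<xi> i \<omega>) \<in> B} =
    prob {\<omega>\<in>space M. (\<lambda>i\<in>{1..k}. \<xi> i \<omega>) \<in> A} * prob {\<omega>\<in>space M. (\<lambda>i\<in>{Suc k..q}. \<xi> i \<omega>) \<in> B}"
proof -
  have "indep_var (PiM {1..k} (\<lambda>_. borel)) (\<lambda>\<omega>. \<lambda>i\<in>{1..k}. \<xi> i \<omega>) (PiM {Suc k..q} (\<lambda>_. borel)) (\<lambda>\<omega>. \<lambda>i\<in>{Suc k..q}. \<xi> i \<omega>)"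
    by (rule indep_var_restrict[OF indep]) auto
  from indep_varD[OF this assms] show ?thesis
    by (simp add: vimage_def Int_def conj_commute)
qed

text \<open>Ottaviani's argument at the first time \<open>k\<close> when the walk is far from its position at the
  anchor \<open>s k\<close>: by independence it is, with probability at least one half, still far from it
  at the later time \<open>e k\<close>.\<close>

lemma ottaviani_anchored:
  assumes se: "\<And>k. k \<le> n \<Longrightarrow> s k \<le> k \<and> k \<le> e k"
    and half: "\<And>k. k \<le> n \<Longrightarrow> prob {\<omega>\<in>space M. l < norm (partial_sum \<xi> (e k) \<omega> - partial_sum \<xi> k \<omega>)} \<le> 1 / 2"
  shows "prob {\<omega>\<in>space M. \<exists>k\<le>n. 2 * l < norm (partial_sum \<xi> k \<omega> - partial_sum \<xi> (s k) \<omega>)} \<le>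
    2 * prob {\<omega>\<in>space M. \<exists>k\<le>n. l < norm (partial_sum \<xi> (e k) \<omega> - partial_sum \<xi> (s k) \<omega>)}"
    (is "prob ?A \<le> 2 * prob ?C")
proof -
  \<comment> \<open>\<open>A k\<close> says that \<open>k\<close> is the first passage time, so
    these events are disjoint; \<open>B k\<close> concerns only what happens after
    \<open>k\<close>.\<close>
  define A where "A k = {\<omega>\<in>space M. 2 * l < norm (partial_sum \<xi> k \<omega> - partial_sum \<xi> (s k) \<omega>) \<and>
    (\<forall>i<k. norm (partial_sum \<xi> i \<omega> - partial_sum \<xi> (s i) \<omega>) \<le> 2 * l)}" for k
  define B where "B k = {\<omega>\<in>space M. norm (partial_sum \<xi> (e k) \<omega> - partial_sum \<xi> k \<omega>) \<le> l}" for k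
  have [measurable]: "A k \<in> sets M" "B k \<in> sets M" for k
    unfolding A_def B_def by measurable
  have AUN: "?A = (\<Union>k\<le>n. A k)"
  proof (intro set_eqI iffI)
    fix \<omega> assume "\<omega> \<in> ?A"
    then have \<omega>: "\<omega> \<in> space M" and ex: "\<exists>k. k \<le> n \<and> 2 * l < norm (partial_sum \<xi> k \<omega> - partial_sum \<xi> (s k) \<omega>)" by auto
    define k where "k = (LEAST k. k \<le> n \<and> 2 * l < norm (partial_sum \<xi> k \<omega> - partial_sum \<xi> (s k) \<omega>))"
    have k: "k \<le> n" "2 * l < norm (partial_sum \<xi> k \<omega> - partial_sum \<xi> (s k) \<omega>)"
      using LeastI_ex[OF ex] unfolding k_def by auto
    have "norm (partial_sum \<xi> i \<omega> - partial_sum \<xi> (s i) \<omega>) \<le> 2 * l" if "i < k" for i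
      using not_less_Least[of i, OF that[unfolded k_def]] that k by auto
    with k \<omega> show "\<omega> \<in> (\<Union>k\<le>n. A k)" by (auto simp: A_def)
  qed (auto simp: A_def)
  have "A i \<inter> A j = {}" if "i < j" for i j
    using that by (force simp: A_def)
  then have disj: "disjoint_family_on A {..n}"
    unfolding disjoint_family_on_def by (metis Int_commute linorder_neqE_nat)
  have AB: "prob (A k \<inter> B k) = prob (A k) * prob (B k)" if k: "k \<le> n" for k
  proof -
    let ?P = "PiM {1..k} (\<lambda>_. borel :: (real ^ 'd) measure)" and ?Q = "PiM {Suc k..e k} (\<lambda>_. borel :: (real ^ 'd) measure)"
    define T where "T f i = (\<Sum>r = 1..i. f r)" for f :: "nat \<Rightarrow> real ^ 'd" and i
    have Tm[measurable]: "(\<lambda>f. T f i) \<in> borel_measurable ?P" if "i \<le> k" for i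
      unfolding T_def using that by (intro borel_measurable_sum measurable_component_singleton) auto
    have T: "T (\<lambda>i\<in>{1..k}. \<xi> i \<omega>) i = partial_sum \<xi> i \<omega>" if "i \<le> k" for i \<omega>
      unfolding T_def partial_sum_def using that by (intro sum.cong) auto
    \<comment> \<open>Because anchors do not lie ahead of their times, \<open>A k\<close> involves
      no step after \<open>k\<close>; this makes it independent of \<open>B k\<close>.\<close>
    have sk: "s i \<le> k" if "i \<le> k" for i using se[of i] that k by auto
    define A' where "A' = {f\<in>space ?P. 2 * l < norm (T f k - T f (s k)) \<and> (\<forall>i\<in>{..<k}. norm (T f i - T f (s i)) \<le> 2 * l)}"
    define B' where "B' = {f\<in>space ?Q. norm (\<Sum>i\<in>{Suc k..e k}. f i) \<le> l}"
    have sA: "A' \<in> sets ?P"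
      unfolding A'_def using Tm[OF sk] Tm by (intro sets.sets_Collect_conj sets.sets_Collect_finite_All) auto
    have sB: "B' \<in> sets ?Q"
      unfolding B'_def by measurable
    have Aeq: "A k = {\<omega>\<in>space M. (\<lambda>i\<in>{1..k}. \<xi> i \<omega>) \<in> A'}"
      unfolding A_def A'_def using sk by (auto simp: T[unfolded One_nat_def] space_PiM)
    have "partial_sum \<xi> (e k) \<omega> - partial_sum \<xi> k \<omega> = (\<Sum>i\<in>{Suc k..e k}. \<xi> i \<omega>)" for \<omega>
      using partial_sum_diff[of k "e k" \<omega>] se[OF k] by (simp add: atLeastSucAtMost_greaterThanAtMost)
    then have Beq: "B k = {\<omega>\<in>space M. (\<lambda>i\<in>{Suc k..e k}. \<xi> i \<omega>) \<in> B'}"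
      unfolding B_def B'_def by (auto simp: space_PiM)
    have "A k \<inter> B k = {\<omega>\<in>space M. (\<lambda>i\<in>{1..k}. \<xi> i \<omega>) \<in> A' \<and> (\<lambda>i\<in>{Suc k..e k}. \<xi> i \<omega>) \<in> B'}"
      unfolding Aeq Beq by auto
    then show ?thesis using prob_indep_past_future[OF sA sB] unfolding Aeq Beq by simp
  qed
  have B: "1 / 2 \<le> prob (B k)" if k: "k \<le> n" for k
  proof -
    have "space M - B k = {\<omega>\<in>space M. l < norm (partial_sum \<xi> (e k) \<omega> - partial_sum \<xi> k \<omega>)}"
      unfolding B_def by auto
    then have "prob (space M - B k) \<le> 1 / 2" using half[OF k] by simp
    then show ?thesis by (simp add: prob_compl)
  qed
  have sub: "(\<Union>k\<le>n. A k \<inter> B k) \<subseteq> ?C"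
  proof safe
    fix k \<omega> assume k: "k \<le> n" "\<omega> \<in> A k" "\<omega> \<in> B k"
    let ?s = "partial_sum \<xi> (s k) \<omega>" and ?k = "partial_sum \<xi> k \<omega>" and ?e = "partial_sum \<xi> (e k) \<omega>"
    \<comment> \<open>From a distance above \<open>2 l\<close>, a move of at most \<open>l\<close>
      leaves a distance above \<open>l\<close>.\<close>
    have "norm (?k - ?s) \<le> norm (?e - ?s) + norm (?e - ?k)"
      using norm_triangle_ineq4[of "?e - ?s" "?e - ?k"] by simp
    then have "l < norm (?e - ?s)" using k by (auto simp: A_def B_def)
    with k show "\<exists>k\<le>n. l < norm (partial_sum \<xi> (e k) \<omega> - partial_sum \<xi> (s k) \<omega>)" by blast
    show "\<omega> \<in> space M" using k by (simp add: A_def)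
  qed
  \<comment> \<open>The factor 2 is the reciprocal of the lower bound on
    \<open>prob (B k)\<close>.\<close>
  have "prob (A k) \<le> 2 * prob (A k \<inter> B k)" if "k \<le> n" for k
    using mult_left_mono[of 1 "2 * prob (B k)" "prob (A k)"] B[OF that] AB[OF that] by simp
  then have "(\<Sum>k\<le>n. prob (A k)) \<le> (\<Sum>k\<le>n. 2 * prob (A k \<inter> B k))"
    by (intro sum_mono) simp
  moreover have "prob ?A = (\<Sum>k\<le>n. prob (A k))"
    unfolding AUN using disj by (intro finite_measure_finite_Union) auto
  ultimately have "prob ?A \<le> (\<Sum>k\<le>n. 2 * prob (A k \<inter> B k))" by simp
  also have "\<dots> = 2 * (\<Sum>k\<le>n. prob (A k \<inter> B k))" by (simp add: sum_distrib_left)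
  also have "(\<Sum>k\<le>n. prob (A k \<inter> B k)) = prob (\<Union>k\<le>n. A k \<inter> B k)"
    using disj by (intro finite_measure_finite_Union[symmetric]) (auto simp: disjoint_family_on_def)
  also have "\<dots> \<le> prob ?C"
    by (intro finite_measure_mono sub) measurable
  finally show ?thesis by simp
qed

end

section \<open>Diameters along grids\<close>

text \<open>Written in terms of increments \<open>v\<close>, with positions as their sums from the
  origin, because it is the vector of block increments whose convergence is known.\<close>

definition grid_diameter :: "nat \<Rightarrow> (nat \<Rightarrow> 'v::real_normed_vector) \<Rightarrow> real" where
  "grid_diameter m v = Max ((\<lambda>p. norm (sum v {..<fst p} - sum v {..<snd p})) ` ({..m} \<times> {..m}))"

definition grid_mesh :: "nat \<Rightarrow> (nat \<Rightarrow> 'v::real_normed_vector) \<Rightarrow> real" where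
  "grid_mesh m v = Max ((\<lambda>j. norm (v j)) ` {..<m})"

lemma grid_diameter_le_iff:
  "grid_diameter m v \<le> B \<longleftrightarrow> (\<forall>i\<le>m. \<forall>j\<le>m. norm (sum v {..<i} - sum v {..<j}) \<le> B)"
  unfolding grid_diameter_def by (subst Max_le_iff) auto

lemma grid_diameter_ge:
  "i \<le> m \<Longrightarrow> j \<le> m \<Longrightarrow> norm (sum v {..<i} - sum v {..<j}) \<le> grid_diameter m v"
  using grid_diameter_le_iff[of m v "grid_diameter m v"] by simp

lemma grid_mesh_le_iff: "0 < m \<Longrightarrow> grid_mesh m v \<le> B \<longleftrightarrow> (\<forall>j<m. norm (v j) \<le> B)"
  unfolding grid_mesh_def by (subst Max_le_iff) auto

lemma continuous_on_Max_image:
  fixes f :: "'i \<Rightarrow> 'a::topological_space \<Rightarrow> real"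
  assumes "finite I" "I \<noteq> {}" "\<And>i. i \<in> I \<Longrightarrow> continuous_on S (f i)"
  shows "continuous_on S (\<lambda>x. Max ((\<lambda>i. f i x) ` I))"
  using assms
proof (induction I rule: finite_ne_induct)
  case (insert i I)
  then have "continuous_on S (\<lambda>x. max (f i x) (Max ((\<lambda>i. f i x) ` I)))"
    by (intro continuous_on_max) auto
  with insert.hyps show ?case by simp
qed simp

lemma continuous_on_sum_coordinates:
  "continuous_on UNIV (\<lambda>v :: nat \<Rightarrow> 'v::real_normed_vector. sum v J)"
  by (intro continuous_on_sum continuous_on_product_coordinates)

lemma continuous_on_grid_diameter: "continuous_on UNIV (grid_diameter m :: (nat \<Rightarrow> 'v::real_normed_vector) \<Rightarrow> real)"
  unfolding grid_diameter_def[abs_def]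
  by (intro continuous_on_Max_image continuous_on_norm continuous_on_diff continuous_on_sum_coordinates) auto

lemma continuous_on_grid_mesh: "0 < m \<Longrightarrow> continuous_on UNIV (grid_mesh m :: (nat \<Rightarrow> 'v::real_normed_vector) \<Rightarrow> real)"
  unfolding grid_mesh_def[abs_def]
  by (intro continuous_on_Max_image continuous_on_norm continuous_on_product_coordinates) auto

text \<open>\<open>cts_step x y\<close> falls linearly from 1 at \<open>x\<close> to 0 at
  \<open>y\<close>. Such functions suffice to test weak convergence on the line, and the slope
  \<open>1 / (y - x)\<close> turns an error in the diameter into one in the expectation.\<close>

lemma cts_step_range: "x < y \<Longrightarrow> 0 \<le> cts_step x y a" "x < y \<Longrightarrow> cts_step x y a \<le> 1"
  by (auto simp: cts_step_def divide_simps)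

lemma cts_step_lipschitz: "x < y \<Longrightarrow> \<bar>cts_step x y a - cts_step x y b\<bar> \<le> \<bar>a - b\<bar> / (y - x)"
  by (auto simp: cts_step_def divide_simps abs_if)

lemma continuous_on_cts_step: "x < y \<Longrightarrow> continuous_on S (cts_step x y)"
  by (rule continuous_on_subset[OF uniformly_continuous_imp_continuous[OF cts_step_uniformly_continuous]]) auto

lemma sum_increments:
  fixes q :: "nat \<Rightarrow> 'v::ab_group_add"
  assumes "i \<le> m"
  shows "(\<Sum>k<i. if k < m then q (Suc k) - q k else 0) = q i - q 0"
proof -
  have "(\<Sum>k<i. if k < m then q (Suc k) - q k else 0) = (\<Sum>k<i. q (Suc k) - q k)"
    using assms by (intro sum.cong) auto
  then show ?thesis by (simp add: sum_lessThan_telescope)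
qed

lemma path_grid_approximation:
  fixes q :: "real \<Rightarrow> 'v::euclidean_space"
  assumes q: "continuous_on {0..1} q"
  defines "v \<equiv> \<lambda>m j. if j < m then q (real (Suc j) / real m) - q (real j / real m) else 0"
  shows "(\<lambda>m. grid_diameter m (v m)) \<longlonglongrightarrow> diameter (q ` {0..1})"
    and "(\<lambda>m. grid_mesh m (v m)) \<longlonglongrightarrow> 0"
proof -
  have bdd: "bounded (q ` {0..1})"
    by (intro compact_imp_bounded compact_continuous_image q compact_Icc)
  have sumv: "sum (v m) {..<i} = q (real i / real m) - q 0" if "i \<le> m" for i m
    using sum_increments[OF that, of "\<lambda>i. q (real i / real m)"] by (simp add: v_def)
  have diffv: "sum (v m) {..<i} - sum (v m) {..<j} = q (real i / real m) - q (real j / real m)"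
    if "i \<le> m" "j \<le> m" for i j m
    using sumv that by simp
  have upper: "grid_diameter m (v m) \<le> diameter (q ` {0..1})" if "0 < m" for m
    unfolding grid_diameter_le_iff
  proof (intro allI impI)
    fix i j assume ij: "i \<le> m" "j \<le> m"
    then have "real i / real m \<in> {0..1}" "real j / real m \<in> {0..1}" using that by auto
    then show "norm (sum (v m) {..<i} - sum (v m) {..<j}) \<le> diameter (q ` {0..1})"
      unfolding diffv[OF ij] dist_norm[symmetric] by (intro diameter_bounded_bound[OF bdd] imageI)
  qed
  have main: "\<exists>m0>0. \<forall>m\<ge>m0. diameter (q ` {0..1}) \<le> grid_diameter m (v m) + 2 * e \<and> grid_mesh m (v m) \<le> e"
    if e: "0 < e" for e
  proof -
    have "uniformly_continuous_on {0..1} q"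
      by (intro compact_uniformly_continuous q compact_Icc)
    then obtain d where d: "0 < d" "\<And>s t. s \<in> {0..1} \<Longrightarrow> t \<in> {0..1} \<Longrightarrow> dist t s < d \<Longrightarrow> dist (q t) (q s) < e"
      using e unfolding uniformly_continuous_on_def by metis
    obtain m0 :: nat where m0: "1 / d < real m0" using reals_Archimedean2 by blast
    have m0pos: "0 < m0" using m0 d(1) by (metis gr0I less_asym of_nat_0 zero_less_divide_1_iff)
    have "diameter (q ` {0..1}) \<le> grid_diameter m (v m) + 2 * e \<and> grid_mesh m (v m) \<le> e" if m: "m \<ge> m0" for m
    proof
      have "1 / d < real m" using m0 m by linarith
      then have m': "0 < m" "1 / real m < d"
        using m m0pos d(1) by (auto simp: field_simps)
      have near: "\<exists>i\<le>m. norm (q t - q (real i / real m)) < e" if t: "t \<in> {0..1}" for t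
      proof (intro exI conjI)
        let ?i = "nat \<lfloor>real m * t\<rfloor>"
        have mt: "0 \<le> real m * t" "real m * t \<le> real m" using t m' by (auto simp: mult_left_le)
        then have 1: "real ?i \<le> real m * t" "real m * t < real ?i + 1" by linarith+
        with mt show "?i \<le> m" by linarith
        then have im: "real ?i / real m \<in> {0..1}" using m' by auto
        have "real ?i / real m \<le> t" using 1(1) m' by (simp add: divide_le_eq mult.commute)
        moreover have "t < real ?i / real m + 1 / real m"
          using 1(2) m' by (simp add: add_divide_distrib[symmetric] less_divide_eq mult.commute)
        ultimately have "dist t (real ?i / real m) < d" using m'(2) by (simp add: dist_real_def)
        from d(2)[OF im t this] show "norm (q t - q (real ?i / real m)) < e" by (simp add: dist_norm)
      qed
      show "diameter (q ` {0..1}) \<le> grid_diameter m (v m) + 2 * e"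
      proof (rule diameter_le)
        show "q ` {0..1} \<noteq> {} \<or> 0 \<le> grid_diameter m (v m) + 2 * e" by simp
        fix x y assume "x \<in> q ` {0..1}" "y \<in> q ` {0..1}"
        then obtain s t where st: "s \<in> {0..1}" "t \<in> {0..1}" "x = q s" "y = q t" by auto
        obtain i where i: "i \<le> m" "norm (q s - q (real i / real m)) < e" using near[OF st(1)] by blast
        obtain j where j: "j \<le> m" "norm (q t - q (real j / real m)) < e" using near[OF st(2)] by blast
        have "norm (q (real i / real m) - q (real j / real m)) \<le> grid_diameter m (v m)"
          using grid_diameter_ge[OF i(1) j(1), of "v m"] diffv[OF i(1) j(1)] by simp
        moreover have "norm (q s - q t) \<le> norm (q s - q (real i / real m)) + norm (q (real i / real m) - q (real j / real m)) + norm (q t - q (real j / real m))"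
          by norm
        ultimately show "norm (x - y) \<le> grid_diameter m (v m) + 2 * e" using i j st by simp
      qed
      show "grid_mesh m (v m) \<le> e"
        unfolding grid_mesh_le_iff[OF m'(1)]
      proof (intro allI impI)
        fix j assume j: "j < m"
        have "real (Suc j) / real m \<in> {0..1}" "real j / real m \<in> {0..1}" using j m'(1) by auto
        moreover have "dist (real (Suc j) / real m) (real j / real m) < d"
          using m' by (simp add: dist_real_def diff_divide_distrib[symmetric])
        ultimately have "dist (q (real (Suc j) / real m)) (q (real j / real m)) < e" by (intro d(2))
        with j show "norm (v m j) \<le> e" by (simp add: v_def dist_norm)
      qed
    qed
    with m0pos show ?thesis by blast
  qed
  show "(\<lambda>m. grid_diameter m (v m)) \<longlonglongrightarrow> diameter (q ` {0..1})"
  proof (rule LIMSEQ_I)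
    fix r :: real assume "0 < r"
    then obtain m0 where m0: "0 < m0" "\<And>m. m \<ge> m0 \<Longrightarrow> diameter (q ` {0..1}) \<le> grid_diameter m (v m) + 2 * (r / 3)"
      using main[of "r / 3"] by auto
    have "norm (grid_diameter m (v m) - diameter (q ` {0..1})) < r" if "m \<ge> m0" for m
      using m0(2)[OF that] upper[of m] m0(1) that \<open>0 < r\<close> by (auto simp: abs_less_iff)
    then show "\<exists>no. \<forall>m\<ge>no. norm (grid_diameter m (v m) - diameter (q ` {0..1})) < r" by blast
  qed
  show "(\<lambda>m. grid_mesh m (v m)) \<longlonglongrightarrow> 0"
  proof (rule LIMSEQ_I)
    fix r :: real assume "0 < r"
    then obtain m0 where m0: "0 < m0" "\<And>m. m \<ge> m0 \<Longrightarrow> grid_mesh m (v m) \<le> r / 2"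
      using main[of "r / 2"] by auto
    have "norm (grid_mesh m (v m) - 0) < r" if "m \<ge> m0" for m
    proof -
      have "norm (v m 0) \<le> grid_mesh m (v m)"
        using grid_mesh_le_iff[of m "v m" "grid_mesh m (v m)"] m0(1) that by auto
      then have "0 \<le> grid_mesh m (v m)" by (rule order_trans[OF norm_ge_zero])
      with m0(2)[OF that] \<open>0 < r\<close> show ?thesis by simp
    qed
    then show "\<exists>no. \<forall>m\<ge>no. norm (grid_mesh m (v m) - 0) < r" by blast
  qed
qed

lemma block_containing:
  fixes k n m :: nat
  assumes "0 < m" "k \<le> n"
  shows "\<exists>j<m. n * j div m \<le> k \<and> k \<le> n * Suc j div m"
proof -
  \<comment> \<open>The least block whose right end reaches \<open>k\<close>: the right end of the
    block before it, which is its own left end, is then smaller than \<open>k\<close>.\<close>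
  define j where "j = (LEAST j. k \<le> n * Suc j div m)"
  have ex: "k \<le> n * Suc (m - 1) div m" using assms by simp
  then have "k \<le> n * Suc j div m" unfolding j_def by (rule LeastI)
  moreover have "j \<le> m - 1" unfolding j_def using ex by (rule Least_le)
  moreover have "n * j div m \<le> k"
  proof (cases j)
    case (Suc i)
    then have "i < (LEAST j. k \<le> n * Suc j div m)" by (simp add: j_def)
    then have "\<not> k \<le> n * Suc i div m" by (rule not_less_Least)
    with Suc show ?thesis by simp
  qed simp
  ultimately show ?thesis using assms(1) by (intro exI[of _ j]) auto
qed

section \<open>Comparison of the walk with its grid skeleton\<close>

context centered_random_walk
begin

lemma sum_block_sum:
  assumes "i \<le> m"
  shows "(\<Sum>k<i. if k < m then block_sum n m k \<omega> else 0) = partial_sum \<xi> (n * i div m) \<omega> /\<^sub>R sqrt (real n)"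
  using sum_increments[OF assms, of "\<lambda>k. partial_sum \<xi> (n * k div m) \<omega> /\<^sub>R sqrt (real n)"]
  by (simp add: block_sum_def scaleR_diff_right partial_sum_def[of _ 0] cong: if_cong del: mult_Suc_right)

lemma grid_diameter_block_sum_le:
  assumes "0 < m"
  shows "grid_diameter m (\<lambda>j. if j < m then block_sum n m j \<omega> else 0) \<le> walk_diameter \<xi> n \<omega> / sqrt (real n)"
  unfolding grid_diameter_le_iff
proof (intro allI impI)
  fix i j assume ij: "i \<le> m" "j \<le> m"
  have le: "n * i div m \<le> n" if "i \<le> m" for i
    using that assms div_le_mono[of "n * i" "n * m" m] by simp
  have "norm (partial_sum \<xi> (n * i div m) \<omega> - partial_sum \<xi> (n * j div m) \<omega>) \<le> walk_diameter \<xi> n \<omega>"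
    using ij by (intro walk_diameter_ge le)
  then have "norm (partial_sum \<xi> (n * i div m) \<omega> - partial_sum \<xi> (n * j div m) \<omega>) / sqrt (real n) \<le> walk_diameter \<xi> n \<omega> / sqrt (real n)"
    by (intro divide_right_mono) auto
  then show "norm ((\<Sum>k<i. if k < m then block_sum n m k \<omega> else 0) - (\<Sum>k<j. if k < m then block_sum n m k \<omega> else 0)) \<le> walk_diameter \<xi> n \<omega> / sqrt (real n)"
    unfolding sum_block_sum[OF ij(1)] sum_block_sum[OF ij(2)] scaleR_diff_right[symmetric]
    by (simp add: divide_inverse mult.commute)
qed

text \<open>Moving both end points of a pair to the grid costs \<open>2 l sqrt n\<close>
  each.\<close>

lemma walk_diameter_le_grid_diameter:
  assumes m: "0 < m" and n: "0 < n"
    and near: "\<And>k. k \<le> n \<Longrightarrow> \<exists>j\<le>m. norm (partial_sum \<xi> k \<omega> - partial_sum \<xi> (n * j div m) \<omega>) \<le> 2 * (l * sqrt (real n))"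
  shows "walk_diameter \<xi> n \<omega> / sqrt (real n) \<le> grid_diameter m (\<lambda>j. if j < m then block_sum n m j \<omega> else 0) + 4 * l"
proof -
  let ?g = "grid_diameter m (\<lambda>j. if j < m then block_sum n m j \<omega> else 0)"
  have "walk_diameter \<xi> n \<omega> \<le> sqrt (real n) * ?g + 4 * (l * sqrt (real n))"
  proof (rule walk_diameter_le)
    fix i j assume ij: "i \<le> n" "j \<le> n"
    obtain i' where i': "i' \<le> m" "norm (partial_sum \<xi> i \<omega> - partial_sum \<xi> (n * i' div m) \<omega>) \<le> 2 * (l * sqrt (real n))"
      using near[OF ij(1)] by blast
    obtain j' where j': "j' \<le> m" "norm (partial_sum \<xi> j \<omega> - partial_sum \<xi> (n * j' div m) \<omega>) \<le> 2 * (l * sqrt (real n))"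
      using near[OF ij(2)] by blast
    have "norm (partial_sum \<xi> (n * i' div m) \<omega> /\<^sub>R sqrt (real n) - partial_sum \<xi> (n * j' div m) \<omega> /\<^sub>R sqrt (real n)) \<le> ?g"
      using grid_diameter_ge[OF i'(1) j'(1), of "\<lambda>j. if j < m then block_sum n m j \<omega> else 0"]
      unfolding sum_block_sum[OF i'(1)] sum_block_sum[OF j'(1)] .
    then have "norm (partial_sum \<xi> (n * i' div m) \<omega> - partial_sum \<xi> (n * j' div m) \<omega>) / sqrt (real n) \<le> ?g"
      unfolding scaleR_diff_right[symmetric] by (simp add: divide_inverse mult.commute)
    then have "norm (partial_sum \<xi> (n * i' div m) \<omega> - partial_sum \<xi> (n * j' div m) \<omega>) \<le> sqrt (real n) * ?g"
      using n by (simp add: field_simps)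
    moreover have "norm (x - y) \<le> norm (x - x') + norm (x' - y') + norm (y - y')" for x y x' y' :: "real ^ 'd"
      by norm
    from this[of "partial_sum \<xi> i \<omega>" "partial_sum \<xi> j \<omega>" "partial_sum \<xi> (n * i' div m) \<omega>" "partial_sum \<xi> (n * j' div m) \<omega>"]
    have "norm (partial_sum \<xi> i \<omega> - partial_sum \<xi> j \<omega>) \<le> norm (partial_sum \<xi> i \<omega> - partial_sum \<xi> (n * i' div m) \<omega>) +
        norm (partial_sum \<xi> (n * i' div m) \<omega> - partial_sum \<xi> (n * j' div m) \<omega>) + norm (partial_sum \<xi> j \<omega> - partial_sum \<xi> (n * j' div m) \<omega>)" .
    ultimately show "norm (partial_sum \<xi> i \<omega> - partial_sum \<xi> j \<omega>) \<le> sqrt (real n) * ?g + 4 * (l * sqrt (real n))"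
      using i' j' by linarith
  qed
  then show ?thesis using n by (simp add: field_simps)
qed

lemma measurable_walk_diameter [measurable]: "walk_diameter \<xi> n \<in> borel_measurable M"
proof -
  have "walk_diameter \<xi> n \<omega> = Max ((\<lambda>p. norm (partial_sum \<xi> (fst p) \<omega> - partial_sum \<xi> (snd p) \<omega>)) ` ({..n} \<times> {..n}))" for \<omega>
    unfolding walk_diameter_def by (intro arg_cong[where f=Max]) force
  then have "walk_diameter \<xi> n = (\<lambda>\<omega>. Max ((\<lambda>p. norm (partial_sum \<xi> (fst p) \<omega> - partial_sum \<xi> (snd p) \<omega>)) ` ({..n} \<times> {..n})))"
    by (rule ext)
  moreover have "(\<lambda>\<omega>. norm (partial_sum \<xi> (fst p) \<omega> - partial_sum \<xi> (snd p) \<omega>)) \<in> borel_measurable M" for p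
    by measurable
  ultimately show ?thesis
    by (simp only:) (intro borel_measurable_Max finite_cartesian_product finite_atMost)
qed

text \<open>Ottaviani's bound, with the two ends of a block containing \<open>k\<close> as anchor
  \<open>s k\<close> and later time \<open>e k\<close>. The two largeness assumptions make
  Chebyshev's bound for the rest of that block at most 1/2.\<close>

lemma prob_oscillation_le:
  assumes m: "0 < m" and n: "0 < n" and l: "0 < l"
    and m_large: "4 * expectation (\<lambda>\<omega>. (norm (X \<omega>))\<^sup>2) \<le> l\<^sup>2 * real m"
    and n_large: "4 * expectation (\<lambda>\<omega>. (norm (X \<omega>))\<^sup>2) \<le> l\<^sup>2 * real n"
  obtains A where "A \<in> sets M" "prob A \<le> 2 * prob {\<omega>\<in>space M. \<exists>j<m. l < norm (block_sum n m j \<omega>)}"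
    "\<And>\<omega> k. \<omega> \<in> space M \<Longrightarrow> \<omega> \<notin> A \<Longrightarrow> k \<le> n \<Longrightarrow>
      \<exists>j\<le>m. norm (partial_sum \<xi> k \<omega> - partial_sum \<xi> (n * j div m) \<omega>) \<le> 2 * (l * sqrt (real n))"
proof -
  define v where "v = expectation (\<lambda>\<omega>. (norm (X \<omega>))\<^sup>2)"
  have v: "0 \<le> v" by (simp add: v_def)
  have "\<forall>k\<in>{..n}. \<exists>j. j < m \<and> n * j div m \<le> k \<and> k \<le> n * Suc j div m"
    using block_containing[OF m] by auto
  then obtain J where J: "\<And>k. k \<le> n \<Longrightarrow> J k < m \<and> n * J k div m \<le> k \<and> k \<le> n * Suc (J k) div m"
    by (metis atMost_iff)
  define s e where "s k = n * J k div m" and "e k = n * Suc (J k) div m" for k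
  let ?l = "l * sqrt (real n)"
  have l': "0 < ?l" using l n by simp
  let ?A = "{\<omega>\<in>space M. \<exists>k\<le>n. 2 * ?l < norm (partial_sum \<xi> k \<omega> - partial_sum \<xi> (s k) \<omega>)}"
  have half: "prob {\<omega>\<in>space M. ?l < norm (partial_sum \<xi> (e k) \<omega> - partial_sum \<xi> k \<omega>)} \<le> 1 / 2" if k: "k \<le> n" for k
  proof -
    have "real (e k) \<le> real (n * Suc (J k)) / real m" unfolding e_def by (rule of_nat_div_le_of_nat)
    moreover have "real (n * J k) < real (m + m * (s k))"
      using dividend_less_times_div[OF m, of "n * J k"] unfolding s_def by (simp only: of_nat_less_iff)
    then have "real (n * J k) / real m < 1 + real (s k)"
      using m by (simp add: field_simps)
    moreover have "real (n * Suc (J k)) / real m = real (n * J k) / real m + real n / real m"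
      by (simp add: add_divide_distrib)
    moreover have "s k \<le> k" "k \<le> e k" using J[OF k] by (auto simp: s_def e_def)
    \<comment> \<open>The rest of a block has at most \<open>n / m + 1\<close> steps, the 1 coming
      from rounding.\<close>
    ultimately have ek: "real (e k - k) \<le> real n / real m + 1" by (simp add: of_nat_diff)
    have "prob {\<omega>\<in>space M. ?l < norm (partial_sum \<xi> (e k) \<omega> - partial_sum \<xi> k \<omega>)} \<le> real (e k - k) * v / ?l\<^sup>2"
      unfolding v_def using J[OF k] l' by (intro prob_increment_gt) (auto simp: e_def)
    also have "\<dots> \<le> (real n / real m + 1) * v / ?l\<^sup>2"
      using ek v by (intro divide_right_mono mult_right_mono) auto
    \<comment> \<open>After division by \<open>l^2 n\<close> the two summands are at most 1/4 each,
      one by the assumption on \<open>m\<close>, the other by that on \<open>n\<close>.\<close>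
    also have "\<dots> \<le> 1 / 2"
    proof -
      have "v / real m \<le> l\<^sup>2 / 4" using m_large m by (simp add: v_def field_simps)
      then have "real n * (v / real m) \<le> real n * (l\<^sup>2 / 4)" by (intro mult_left_mono) auto
      moreover have "v \<le> real n * (l\<^sup>2 / 4)" using n_large by (simp add: v_def mult.commute)
      moreover have "(real n / real m + 1) * v = real n * (v / real m) + v" by (simp add: algebra_simps)
      ultimately have "(real n / real m + 1) * v \<le> real n * l\<^sup>2 / 2" by simp
      moreover have "?l\<^sup>2 = real n * l\<^sup>2" by (simp add: power_mult_distrib mult.commute)
      ultimately show ?thesis using l n by (simp add: divide_le_eq)
    qed
    finally show ?thesis .
  qed
  have "prob ?A \<le> 2 * prob {\<omega>\<in>space M. \<exists>k\<le>n. ?l < norm (partial_sum \<xi> (e k) \<omega> - partial_sum \<xi> (s k) \<omega>)}"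
    using l' J half by (intro ottaviani_anchored) (auto simp: s_def e_def)
  also have "\<dots> \<le> 2 * prob {\<omega>\<in>space M. \<exists>j<m. l < norm (block_sum n m j \<omega>)}"
  proof (intro mult_left_mono finite_measure_mono subsetI)
    fix \<omega> assume "\<omega> \<in> {\<omega>\<in>space M. \<exists>k\<le>n. ?l < norm (partial_sum \<xi> (e k) \<omega> - partial_sum \<xi> (s k) \<omega>)}"
    then obtain k where k: "\<omega> \<in> space M" "k \<le> n" "?l < norm (partial_sum \<xi> (e k) \<omega> - partial_sum \<xi> (s k) \<omega>)" by auto
    then have "l < norm (partial_sum \<xi> (e k) \<omega> - partial_sum \<xi> (s k) \<omega>) / sqrt (real n)"
      using n by (simp add: less_divide_eq)
    also have "\<dots> = norm (block_sum n m (J k) \<omega>)"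
      by (simp add: block_sum_def e_def s_def divide_inverse mult.commute del: mult_Suc_right)
    finally show "\<omega> \<in> {\<omega>\<in>space M. \<exists>j<m. l < norm (block_sum n m j \<omega>)}" using k J[OF k(2)] by auto
  qed auto
  finally have "prob ?A \<le> 2 * prob {\<omega>\<in>space M. \<exists>j<m. l < norm (block_sum n m j \<omega>)}" .
  moreover have "?A \<in> sets M" by measurable
  moreover have "\<exists>j\<le>m. norm (partial_sum \<xi> k \<omega> - partial_sum \<xi> (n * j div m) \<omega>) \<le> 2 * ?l"
    if "\<omega> \<in> space M" "\<omega> \<notin> ?A" "k \<le> n" for \<omega> k
    using that J[OF that(3)] by (intro exI[of _ "J k"]) (auto simp: s_def not_less)
  ultimately show ?thesis by (intro that)
qed

end

section \<open>Convergence in distribution of the rescaled diameter\<close>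

context centered_random_walk
begin

text \<open>Off the oscillation event \<open>A\<close> the two diameters differ by at most
  \<open>4 l\<close>, and the slope of \<open>cts_step\<close> gives the first term. On
  \<open>A\<close> the test values differ by at most 1, which costs \<open>prob A\<close>. This
  probability is passed on through the continuous majorant \<open>1 - cts_step (l / 2) l\<close> of
  the indicator of mesh values above \<open>l\<close>; it still vanishes near 0, and weak
  convergence can be applied to it.\<close>

lemma walk_diameter_test_function_le:
  assumes xy: "x < y" and m: "0 < m" and n: "0 < n" and l: "0 < l"
    and m_large: "4 * expectation (\<lambda>\<omega>. (norm (X \<omega>))\<^sup>2) \<le> l\<^sup>2 * real m"
    and n_large: "4 * expectation (\<lambda>\<omega>. (norm (X \<omega>))\<^sup>2) \<le> l\<^sup>2 * real n"
  defines "B \<equiv> \<lambda>\<omega> j. if j < m then block_sum n m j \<omega> else 0"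
  shows "\<bar>expectation (\<lambda>\<omega>. cts_step x y (walk_diameter \<xi> n \<omega> / sqrt (real n))) -
      expectation (\<lambda>\<omega>. cts_step x y (grid_diameter m (B \<omega>)))\<bar> \<le>
    4 * l / (y - x) + 2 * expectation (\<lambda>\<omega>. 1 - cts_step (l / 2) l (grid_mesh m (B \<omega>)))"
proof -
  obtain A where A[measurable]: "A \<in> sets M"
    and probA: "prob A \<le> 2 * prob {\<omega>\<in>space M. \<exists>j<m. l < norm (block_sum n m j \<omega>)}"
    and near: "\<And>\<omega> k. \<omega> \<in> space M \<Longrightarrow> \<omega> \<notin> A \<Longrightarrow> k \<le> n \<Longrightarrow>
      \<exists>j\<le>m. norm (partial_sum \<xi> k \<omega> - partial_sum \<xi> (n * j div m) \<omega>) \<le> 2 * (l * sqrt (real n))"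
    by (rule prob_oscillation_le[OF m n l m_large n_large]) (rule that)
  have l2: "l / 2 < l" using l by simp
  have Bm: "B \<in> borel_measurable M"
  proof (rule measurable_coordinatewise_then_product)
    show "(\<lambda>\<omega>. B \<omega> j) \<in> borel_measurable M" for j
      by (cases "j < m") (simp_all add: B_def measurable_block_sum)
  qed
  have gd[measurable]: "(\<lambda>\<omega>. grid_diameter m (B \<omega>)) \<in> borel_measurable M"
    by (rule measurable_compose[OF Bm borel_measurable_continuous_onI[OF continuous_on_grid_diameter]])
  have gm[measurable]: "(\<lambda>\<omega>. grid_mesh m (B \<omega>)) \<in> borel_measurable M"
    by (rule measurable_compose[OF Bm borel_measurable_continuous_onI[OF continuous_on_grid_mesh[OF m]]])
  have cm: "cts_step a c \<in> borel_measurable borel" if "a < c" for a c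
    using that by (intro borel_measurable_continuous_onI continuous_on_cts_step)
  note [measurable] = measurable_compose[OF gd cm[OF xy]] measurable_compose[OF gm cm[OF l2]]
  have wm[measurable]: "(\<lambda>\<omega>. walk_diameter \<xi> n \<omega> / sqrt (real n)) \<in> borel_measurable M" by measurable
  note [measurable] = measurable_compose[OF wm cm[OF xy]]
  have int: "integrable M (\<lambda>\<omega>. cts_step x y (walk_diameter \<xi> n \<omega> / sqrt (real n)))"
    "integrable M (\<lambda>\<omega>. cts_step x y (grid_diameter m (B \<omega>)))"
    "integrable M (\<lambda>\<omega>. cts_step (l / 2) l (grid_mesh m (B \<omega>)))"
    using cts_step_range[OF xy] cts_step_range[OF l2]
    by (auto intro!: integrable_const_bound[where B=1])
  have bound: "\<bar>cts_step x y (walk_diameter \<xi> n \<omega> / sqrt (real n)) - cts_step x y (grid_diameter m (B \<omega>))\<bar> \<le>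
      4 * l / (y - x) + indicator A \<omega>" if \<omega>: "\<omega> \<in> space M" for \<omega>
  proof (cases "\<omega> \<in> A")
    case True
    have "\<bar>a - b\<bar> \<le> 1" if "0 \<le> a" "a \<le> 1" "0 \<le> b" "b \<le> 1" for a b :: real using that by auto
    from this[OF cts_step_range[OF xy] cts_step_range[OF xy]] True l xy show ?thesis
      by (simp add: add_increasing)
  next
    case False
    have "grid_diameter m (B \<omega>) \<le> walk_diameter \<xi> n \<omega> / sqrt (real n)"
      unfolding B_def by (rule grid_diameter_block_sum_le[OF m])
    moreover have "walk_diameter \<xi> n \<omega> / sqrt (real n) \<le> grid_diameter m (B \<omega>) + 4 * l"
      unfolding B_def by (rule walk_diameter_le_grid_diameter[OF m n near[OF \<omega> False]])
    ultimately have "\<bar>walk_diameter \<xi> n \<omega> / sqrt (real n) - grid_diameter m (B \<omega>)\<bar> \<le> 4 * l" by simp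
    then have "\<bar>walk_diameter \<xi> n \<omega> / sqrt (real n) - grid_diameter m (B \<omega>)\<bar> / (y - x) \<le> 4 * l / (y - x)"
      using xy by (intro divide_right_mono) auto
    with cts_step_lipschitz[OF xy]
    have "\<bar>cts_step x y (walk_diameter \<xi> n \<omega> / sqrt (real n)) - cts_step x y (grid_diameter m (B \<omega>))\<bar> \<le> 4 * l / (y - x)"
      by (rule order_trans)
    with False show ?thesis by simp
  qed
  have "\<bar>expectation (\<lambda>\<omega>. cts_step x y (walk_diameter \<xi> n \<omega> / sqrt (real n))) -
      expectation (\<lambda>\<omega>. cts_step x y (grid_diameter m (B \<omega>)))\<bar> =
    \<bar>expectation (\<lambda>\<omega>. cts_step x y (walk_diameter \<xi> n \<omega> / sqrt (real n)) - cts_step x y (grid_diameter m (B \<omega>)))\<bar>"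
    using int by simp
  also have "\<dots> \<le> expectation (\<lambda>\<omega>. \<bar>cts_step x y (walk_diameter \<xi> n \<omega> / sqrt (real n)) - cts_step x y (grid_diameter m (B \<omega>))\<bar>)"
    by (rule integral_abs_bound)
  also have "\<dots> \<le> expectation (\<lambda>\<omega>. 4 * l / (y - x) + indicator A \<omega>)"
  proof (rule integral_mono[OF _ _ bound])
    show "integrable M (\<lambda>\<omega>. \<bar>cts_step x y (walk_diameter \<xi> n \<omega> / sqrt (real n)) - cts_step x y (grid_diameter m (B \<omega>))\<bar>)"
      by (intro integrable_abs Bochner_Integration.integrable_diff int)
    show "integrable M (\<lambda>\<omega>. 4 * l / (y - x) + indicator A \<omega>)"
      by (intro Bochner_Integration.integrable_add integrable_const integrable_real_indicator A)
        (simp add: emeasure_eq_measure)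
  qed
  also have "\<dots> = 4 * l / (y - x) + prob A"
    by (subst Bochner_Integration.integral_add) (auto simp: prob_space emeasure_eq_measure)
  also have "prob A \<le> 2 * expectation (\<lambda>\<omega>. 1 - cts_step (l / 2) l (grid_mesh m (B \<omega>)))"
  proof -
    let ?C = "{\<omega>\<in>space M. \<exists>j<m. l < norm (block_sum n m j \<omega>)}"
    have [measurable]: "?C \<in> sets M" by measurable
    have "expectation (indicator ?C) \<le> expectation (\<lambda>\<omega>. 1 - cts_step (l / 2) l (grid_mesh m (B \<omega>)))"
    proof (rule integral_mono)
      show "indicator ?C \<omega> \<le> 1 - cts_step (l / 2) l (grid_mesh m (B \<omega>))" for \<omega>
      proof (cases "\<omega> \<in> ?C")
        case True
        then obtain j where j: "j < m" "l < norm (B \<omega> j)" by (auto simp: B_def)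
        then have "\<not> grid_mesh m (B \<omega>) \<le> l" using grid_mesh_le_iff[OF m] by (meson not_le)
        with l show ?thesis by (simp add: cts_step_def indicator_def)
      qed (use cts_step_range[OF l2] in auto)
    qed (use int in \<open>auto simp: emeasure_eq_measure\<close>)
    with probA show ?thesis by simp
  qed
  finally show ?thesis by simp
qed

text \<open>The order of choices matters: \<open>l\<close> from the target error, then
  \<open>m\<close> from \<open>l\<close>, then \<open>n\<close> from \<open>m\<close>. Letting
  \<open>m\<close> grow is done only on the Brownian side, where continuity of paths settles both
  the grid diameter and the mesh.\<close>

theorem walk_diameter_weak_conv:
  assumes b: "standard_brownian_motion N b"
  defines "R \<equiv> matrix_sqrt (second_moment_matrix M X)"
  shows "weak_conv_m (\<lambda>n. distr M borel (\<lambda>\<omega>. walk_diameter \<xi> n \<omega> / sqrt (real n)))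
    (distr N borel (\<lambda>\<omega>. diameter ((\<lambda>t. R *v b t \<omega>) ` {0..1})))"
proof -
  interpret N: prob_space N using b by (simp add: standard_brownian_motion_def)
  have bm: "b t \<in> borel_measurable N" if "0 \<le> t" for t
    using b that by (simp add: standard_brownian_motion_def)
  define D where "D \<omega> = diameter ((\<lambda>t. R *v b t \<omega>) ` {0..1})" for \<omega>
  define Z where "Z m \<omega> j = (if j < m then R *v (b (real (Suc j) / real m) \<omega> - b (real j / real m) \<omega>) else 0)" for m \<omega> j
  define B where "B n m \<omega> j = (if j < m then block_sum n m j \<omega> else 0)" for n m \<omega> j
  have limits: "(\<lambda>m. grid_diameter m (Z m \<omega>)) \<longlonglongrightarrow> D \<omega>" "(\<lambda>m. grid_mesh m (Z m \<omega>)) \<longlonglongrightarrow> 0"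
    if \<omega>: "\<omega> \<in> space N" for \<omega>
  proof -
    have "continuous_on {0..} (\<lambda>t. b t \<omega>)" using b \<omega> by (simp add: standard_brownian_motion_def)
    then have "continuous_on {0..1} (\<lambda>t. b t \<omega>)" by (rule continuous_on_subset) auto
    then have cont: "continuous_on {0..1} (\<lambda>t. R *v b t \<omega>)"
      by (rule continuous_on_compose2[OF matrix_vector_mult_linear_continuous_on[of UNIV]]) auto
    have Z: "Z m \<omega> = (\<lambda>j. if j < m then R *v b (real (Suc j) / real m) \<omega> - R *v b (real j / real m) \<omega> else 0)" for m
      unfolding Z_def by (simp add: matrix_vector_mult_diff_distrib fun_eq_iff)
    show "(\<lambda>m. grid_diameter m (Z m \<omega>)) \<longlonglongrightarrow> D \<omega>" "(\<lambda>m. grid_mesh m (Z m \<omega>)) \<longlonglongrightarrow> 0"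
      unfolding Z D_def by (rule path_grid_approximation[OF cont])+
  qed
  have Rm: "(*v) R \<in> borel_measurable borel"
    by (intro borel_measurable_continuous_onI matrix_vector_mult_linear_continuous_on)
  have Rb: "(\<lambda>\<omega>. R *v (b (real (Suc j) / real m) \<omega> - b (real j / real m) \<omega>)) \<in> borel_measurable N" for j m
    by (rule measurable_compose[OF _ Rm]) (intro borel_measurable_diff bm, auto)
  have Zm: "Z m \<in> borel_measurable N" for m
  proof (rule measurable_coordinatewise_then_product)
    show "(\<lambda>\<omega>. Z m \<omega> j) \<in> borel_measurable N" for j
      using Rb[of j m] by (cases "j < m") (simp_all add: Z_def del: of_nat_Suc)
  qed
  have gd[measurable]: "(\<lambda>\<omega>. grid_diameter m (Z m \<omega>)) \<in> borel_measurable N" for m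
    by (rule measurable_compose[OF Zm borel_measurable_continuous_onI[OF continuous_on_grid_diameter]])
  have gm: "(\<lambda>\<omega>. grid_mesh m (Z m \<omega>)) \<in> borel_measurable N" if "0 < m" for m
    by (rule measurable_compose[OF Zm borel_measurable_continuous_onI[OF continuous_on_grid_mesh[OF that]]])
  \<comment> \<open>Being a pointwise limit of grid diameters, the diameter of the path is a random
    variable.\<close>
  have D[measurable]: "D \<in> borel_measurable N"
    by (rule borel_measurable_LIMSEQ_real[OF limits(1) gd])
  have cm: "cts_step a c \<in> borel_measurable borel" if "a < c" for a c
    using that by (intro borel_measurable_continuous_onI continuous_on_cts_step)
  have "weak_conv_m (\<lambda>n. distr M borel (\<lambda>\<omega>. walk_diameter \<xi> n \<omega> / sqrt (real n))) (distr N borel D)"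
  proof (rule integral_cts_step_conv_imp_weak_conv)
    show "real_distribution (distr M borel (\<lambda>\<omega>. walk_diameter \<xi> n \<omega> / sqrt (real n)))" for n
      by (rule real_distribution_distr) measurable
    show "real_distribution (distr N borel D)"
      by (rule N.real_distribution_distr) measurable
    fix x y :: real assume xy: "x < y"
    let ?h = "cts_step x y"
    have "(\<lambda>n. expectation (\<lambda>\<omega>. ?h (walk_diameter \<xi> n \<omega> / sqrt (real n)))) \<longlonglongrightarrow> N.expectation (\<lambda>\<omega>. ?h (D \<omega>))"
    proof (rule LIMSEQ_I)
      fix r :: real assume r: "0 < r"
      define v where "v = expectation (\<lambda>\<omega>. (norm (X \<omega>))\<^sup>2)"
      \<comment> \<open>Seven errors \<open>e\<close> add up: one from \<open>l\<close>, four from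
        twice a mesh term below \<open>2 e\<close>, one from the convergence in \<open>n\<close> of
        the grid diameter and one from the grid approximation of the Brownian path.\<close>
      define e where "e = r / 8"
      have e: "0 < e" using r by (simp add: e_def)
      \<comment> \<open>Makes the Lipschitz error \<open>4 l / (y - x)\<close> equal to
        \<open>e\<close>.\<close>
      define l where "l = e * (y - x) / 4"
      have l: "0 < l" and l2: "l / 2 < l" using e xy by (auto simp: l_def)
      have le: "4 * l / (y - x) = e" using xy by (simp add: l_def)
      let ?g = "\<lambda>a. 1 - cts_step (l / 2) l a"
      have "(\<lambda>m. N.expectation (\<lambda>\<omega>. ?h (grid_diameter m (Z m \<omega>)))) \<longlonglongrightarrow> N.expectation (\<lambda>\<omega>. ?h (D \<omega>))"
      proof (rule integral_dominated_convergence[where w="\<lambda>_. 1"])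
        show "(\<lambda>\<omega>. ?h (D \<omega>)) \<in> borel_measurable N" by (rule measurable_compose[OF D cm[OF xy]])
        show "(\<lambda>\<omega>. ?h (grid_diameter m (Z m \<omega>))) \<in> borel_measurable N" for m
          by (rule measurable_compose[OF gd cm[OF xy]])
        show "AE \<omega> in N. (\<lambda>m. ?h (grid_diameter m (Z m \<omega>))) \<longlonglongrightarrow> ?h (D \<omega>)"
          using limits(1) by (intro AE_I2 continuous_on_tendsto_compose[OF continuous_on_cts_step[OF xy, of UNIV]]) auto
      qed (use cts_step_range[OF xy] in auto)
      from LIMSEQ_D[OF this e] obtain m1 where
        m1: "\<And>m. m \<ge> m1 \<Longrightarrow> \<bar>N.expectation (\<lambda>\<omega>. ?h (grid_diameter m (Z m \<omega>))) - N.expectation (\<lambda>\<omega>. ?h (D \<omega>))\<bar> < e"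
        by auto
      \<comment> \<open>\<open>Suc m\<close> avoids the empty grid, on which
        \<open>grid_mesh\<close> is the maximum of an empty set.\<close>
      have "(\<lambda>m. N.expectation (\<lambda>\<omega>. ?g (grid_mesh (Suc m) (Z (Suc m) \<omega>)))) \<longlonglongrightarrow> N.expectation (\<lambda>\<omega>. ?g 0)"
      proof (rule integral_dominated_convergence[where w="\<lambda>_. 1"])
        show "(\<lambda>\<omega>. ?g (grid_mesh (Suc m) (Z (Suc m) \<omega>))) \<in> borel_measurable N" for m
          by (intro borel_measurable_diff borel_measurable_const measurable_compose[OF gm cm[OF l2]]) simp
        show "AE \<omega> in N. (\<lambda>m. ?g (grid_mesh (Suc m) (Z (Suc m) \<omega>))) \<longlonglongrightarrow> ?g 0"
          using limits(2)[THEN LIMSEQ_Suc]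
          by (intro AE_I2 tendsto_diff tendsto_const continuous_on_tendsto_compose[OF continuous_on_cts_step[OF l2, of UNIV]]) auto
      qed (use cts_step_range[OF l2] in auto)
      moreover have "?g 0 = 0" using l by (simp add: cts_step_def)
      ultimately have "(\<lambda>m. N.expectation (\<lambda>\<omega>. ?g (grid_mesh (Suc m) (Z (Suc m) \<omega>)))) \<longlonglongrightarrow> 0" by simp
      from LIMSEQ_D[OF this e] obtain m2 where
        m2: "\<And>m. m \<ge> m2 \<Longrightarrow> \<bar>N.expectation (\<lambda>\<omega>. ?g (grid_mesh (Suc m) (Z (Suc m) \<omega>)))\<bar> < e"
        by auto
      obtain m3 :: nat where m3: "4 * v / l\<^sup>2 < real m3" using reals_Archimedean2 by blast
      have large: "4 * v \<le> l\<^sup>2 * real k" if "m3 \<le> k" for k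
      proof -
        have "4 * v / l\<^sup>2 \<le> real k" using m3 that by linarith
        then show ?thesis using l by (simp add: divide_le_eq mult.commute)
      qed
      define m where "m = Suc (m1 + m2 + m3)"
      have m: "0 < m" "m \<ge> m1" "m3 \<le> m" by (auto simp: m_def)
      have g_small: "N.expectation (\<lambda>\<omega>. ?g (grid_mesh m (Z m \<omega>))) < e"
        using m2[of "m1 + m2 + m3"] by (auto simp: m_def)
      have "(\<lambda>n. expectation (\<lambda>\<omega>. ?h (grid_diameter m (B n m \<omega>)))) \<longlonglongrightarrow> N.expectation (\<lambda>\<omega>. ?h (grid_diameter m (Z m \<omega>)))"
        unfolding B_def Z_def R_def
        using cts_step_range[OF xy]
        by (intro block_expectation_tendsto[OF b m(1), where C=1 and f="\<lambda>v. ?h (grid_diameter m v)"]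
            continuous_on_compose2[OF continuous_on_cts_step[OF xy, of UNIV] continuous_on_grid_diameter]) auto
      from LIMSEQ_D[OF this e] obtain n1 where
        n1: "\<And>n. n \<ge> n1 \<Longrightarrow> \<bar>expectation (\<lambda>\<omega>. ?h (grid_diameter m (B n m \<omega>))) - N.expectation (\<lambda>\<omega>. ?h (grid_diameter m (Z m \<omega>)))\<bar> < e"
        by auto
      have "(\<lambda>n. expectation (\<lambda>\<omega>. ?g (grid_mesh m (B n m \<omega>)))) \<longlonglongrightarrow> N.expectation (\<lambda>\<omega>. ?g (grid_mesh m (Z m \<omega>)))"
        unfolding B_def Z_def R_def
        using cts_step_range[OF l2]
        by (intro block_expectation_tendsto[OF b m(1), where C=1 and f="\<lambda>v. ?g (grid_mesh m v)"]
            continuous_on_diff continuous_on_const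
            continuous_on_compose2[OF continuous_on_cts_step[OF l2, of UNIV] continuous_on_grid_mesh[OF m(1)]]) auto
      from LIMSEQ_D[OF this e] obtain n2 where
        n2: "\<And>n. n \<ge> n2 \<Longrightarrow> \<bar>expectation (\<lambda>\<omega>. ?g (grid_mesh m (B n m \<omega>))) - N.expectation (\<lambda>\<omega>. ?g (grid_mesh m (Z m \<omega>)))\<bar> < e"
        by auto
      have "norm (expectation (\<lambda>\<omega>. ?h (walk_diameter \<xi> n \<omega> / sqrt (real n))) - N.expectation (\<lambda>\<omega>. ?h (D \<omega>))) < r"
        if n: "n \<ge> Suc (n1 + n2 + m3)" for n
      proof -
        have n': "0 < n" "n \<ge> n1" "n \<ge> n2" "m3 \<le> n" using n by auto
        have "\<bar>expectation (\<lambda>\<omega>. ?h (walk_diameter \<xi> n \<omega> / sqrt (real n))) - expectation (\<lambda>\<omega>. ?h (grid_diameter m (B n m \<omega>)))\<bar> \<le>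
            e + 2 * expectation (\<lambda>\<omega>. ?g (grid_mesh m (B n m \<omega>)))"
          using walk_diameter_test_function_le[OF xy m(1) n'(1) l] large[OF m(3)] large[OF n'(4)]
          unfolding v_def[symmetric] B_def le by blast
        moreover have "r = 8 * e" by (simp add: e_def)
        ultimately show ?thesis
          using n1[OF n'(2)] n2[OF n'(3)] m1[OF m(2)] g_small e unfolding real_norm_def by linarith
      qed
      then show "\<exists>no. \<forall>n\<ge>no. norm (expectation (\<lambda>\<omega>. ?h (walk_diameter \<xi> n \<omega> / sqrt (real n))) - N.expectation (\<lambda>\<omega>. ?h (D \<omega>))) < r"
        by blast
    qed
    moreover have "(\<integral>a. ?h a \<partial>distr M borel (\<lambda>\<omega>. walk_diameter \<xi> n \<omega> / sqrt (real n))) =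
        expectation (\<lambda>\<omega>. ?h (walk_diameter \<xi> n \<omega> / sqrt (real n)))" for n
      by (rule integral_distr[OF _ cm[OF xy]]) measurable
    moreover have "(\<integral>a. ?h a \<partial>distr N borel D) = N.expectation (\<lambda>\<omega>. ?h (D \<omega>))"
      by (rule integral_distr[OF D cm[OF xy]])
    ultimately show "(\<lambda>n. \<integral>a. ?h a \<partial>distr M borel (\<lambda>\<omega>. walk_diameter \<xi> n \<omega> / sqrt (real n))) \<longlonglongrightarrow> (\<integral>a. ?h a \<partial>distr N borel D)"
      by simp
  qed
  then show ?thesis unfolding D_def[abs_def] .
qed

end

theorem theorem5p6:
  fixes M :: "'a measure" and X :: "'a \<Rightarrow> real ^ 'd" and \<xi> :: "nat \<Rightarrow> 'a \<Rightarrow> real ^ 'd"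
    and \<mu> :: "real ^ 'd"
    and N :: "'b measure" and b :: "real \<Rightarrow> 'b \<Rightarrow> real ^ 'd"
  assumes "prob_space M"
    and "prob_space.indep_vars M (\<lambda>_. borel) \<xi> {1..}"
    and "\<And>i. i \<ge> 1 \<Longrightarrow> distr M borel (\<xi> i) = distr M borel X"
    and "integrable M X"
    and "(\<integral>\<omega>. X \<omega> \<partial>M) = \<mu>"
  shows "(AE \<omega> in M. (\<lambda>n. walk_diameter \<xi> n \<omega> / real n) \<longlonglongrightarrow> norm \<mu>) \<and>
    (\<mu> = 0 \<longrightarrow> integrable M (\<lambda>\<omega>. (norm (X \<omega>))\<^sup>2) \<longrightarrow> standard_brownian_motion N b \<longrightarrow>
      weak_conv_m (\<lambda>n. distr M borel (\<lambda>\<omega>. walk_diameter \<xi> n \<omega> / sqrt (real n)))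
        (distr N borel
          (\<lambda>\<omega>. diameter ((\<lambda>t. matrix_sqrt (second_moment_matrix M X) *v b t \<omega>) ` {0..1}))))"
proof (intro conjI impI)
  interpret prob_space M by fact
  have "AE \<omega> in M. (\<lambda>n. partial_sum \<xi> n \<omega> /\<^sub>R real n) \<longlonglongrightarrow> \<mu>"
    using partial_sum_average_tendsto[OF assms(2) _ assms(4)] assms(3,5) by simp
  then show "AE \<omega> in M. (\<lambda>n. walk_diameter \<xi> n \<omega> / real n) \<longlonglongrightarrow> norm \<mu>"
    by eventually_elim (rule walk_diameter_tendsto)
  assume "\<mu> = 0" "integrable M (\<lambda>\<omega>. (norm (X \<omega>))\<^sup>2)" and b: "standard_brownian_motion N b"
  then interpret centered_random_walk M \<xi> X
    using assms by unfold_locales auto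
  show "weak_conv_m (\<lambda>n. distr M borel (\<lambda>\<omega>. walk_diameter \<xi> n \<omega> / sqrt (real n)))
        (distr N borel
          (\<lambda>\<omega>. diameter ((\<lambda>t. matrix_sqrt (second_moment_matrix M X) *v b t \<omega>) ` {0..1})))"
    by (rule walk_diameter_weak_conv[OF b])
qed

end
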